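(* For every algebraic polytope $P$ there exists a polytope $\widehat{P}$ that is projectively unique and that has a face projectively equivalent to $P$.
   Context: A polytope is the convex hull of finitely many points in some $\mathbb{R}^d$. A polytope is algebraic if all coordinates of all of its vertices are real algebraic numbers. Two polytopes are projectively equivalent if there is a projective transformation (between the affine spaces in which they lie, e.g. their affine spans) mapping one onto the other. A polytope $P$ in $\mathbb{R}^d$ is projectively unique if for every polytope $P'$ in $\mathbb{R}^d$ combinatorially equivalent to $P$ (and every combinatorial isomorphism from $P$ to $P'$) there is a projective transformation of $\mathbb{R}^d$ that realizes the given combinatorial isomorphism from $P$ to $P'$. *)

theory Defs
  imports
    "HOL-Analysis.Analysis"
    "HOL-Analysis.Finite_Function_Topology"
    "HOL-Computational_Algebra.Polynomial"
begin

text \<open>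
  The dimension has to be quantified inside the statement, so \<open>\<real>\<^sup>d\<close> is not a type here: it is the
  subspace of the finitely supported real sequences \<^typ>\<open>nat \<Rightarrow>\<^sub>0 real\<close> on which all
  coordinates with index \<open>\<ge> d\<close> vanish.
\<close>

definition eucl :: "nat \<Rightarrow> (nat \<Rightarrow>\<^sub>0 real) set" where
  "eucl d = {x. Poly_Mapping.keys x \<subseteq> {..<d}}"

definition polytope_in :: "nat \<Rightarrow> (nat \<Rightarrow>\<^sub>0 real) set \<Rightarrow> bool" where
  "polytope_in d P \<longleftrightarrow> polytope P \<and> P \<subseteq> eucl d"

definition algebraic_polytope_in :: "nat \<Rightarrow> (nat \<Rightarrow>\<^sub>0 real) set \<Rightarrow> bool" where
  "algebraic_polytope_in d P \<longleftrightarrow>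
     polytope_in d P \<and>
     (\<forall>v. v extreme_point_of P \<longrightarrow> (\<forall>i<d. algebraic (Poly_Mapping.lookup v i)))"

text \<open>
  An affine space \<open>A\<close> is embedded at height \<open>1\<close>; the linear space spanned by \<open>A \<times> {1}\<close> has the
  projective completion of \<open>A\<close> as its projectivization.  A projective transformation from \<open>A\<close> to
  \<open>B\<close> is given by a linear isomorphism between these spans (the values of \<open>L\<close> outside the span
  of \<open>A \<times> {1}\<close> are irrelevant).  In affine coordinates it has the form
  \<open>x \<mapsto> (M x + b) / (c x + \<delta>)\<close>, and it is defined at \<open>x\<close> when \<open>c x + \<delta> \<noteq> 0\<close>, i.e. when
  \<open>x\<close> is not sent to infinity.
\<close>

definition homogenization :: "'a::real_vector set \<Rightarrow> ('a \<times> real) set" where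
  "homogenization A = span (A \<times> {1})"

definition projective_transformation ::
    "('a::real_vector \<times> real \<Rightarrow> 'b::real_vector \<times> real) \<Rightarrow> 'a set \<Rightarrow> 'b set \<Rightarrow> bool" where
  "projective_transformation L A B \<longleftrightarrow>
     linear L \<and> bij_betw L (homogenization A) (homogenization B)"

definition proj_defined_on ::
    "('a::real_vector \<times> real \<Rightarrow> 'b::real_vector \<times> real) \<Rightarrow> 'a set \<Rightarrow> bool" where
  "proj_defined_on L S \<longleftrightarrow> (\<forall>x\<in>S. snd (L (x, 1)) \<noteq> 0)"

definition proj_app ::
    "('a::real_vector \<times> real \<Rightarrow> 'b::real_vector \<times> real) \<Rightarrow> 'a \<Rightarrow> 'b" where
  "proj_app L x = fst (L (x, 1)) /\<^sub>R snd (L (x, 1))"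

definition projectively_equivalent :: "'a::real_vector set \<Rightarrow> 'b::real_vector set \<Rightarrow> bool" where
  "projectively_equivalent P Q \<longleftrightarrow>
     (\<exists>L. projective_transformation L (affine hull P) (affine hull Q) \<and>
          proj_defined_on L P \<and> proj_app L ` P = Q)"

text \<open>
  Combinatorial isomorphisms are isomorphisms of face lattices; \<^const>\<open>face_of\<close> counts the
  empty set and the whole polytope as faces.
\<close>

definition combinatorial_isomorphism ::
    "('a::real_vector set \<Rightarrow> 'b::real_vector set) \<Rightarrow> 'a set \<Rightarrow> 'b set \<Rightarrow> bool" where
  "combinatorial_isomorphism \<phi> P Q \<longleftrightarrow>
     bij_betw \<phi> {F. F face_of P} {G. G face_of Q} \<and>
     (\<forall>F G. F face_of P \<longrightarrow> G face_of P \<longrightarrow> (F \<subseteq> G \<longleftrightarrow> \<phi> F \<subseteq> \<phi> G))"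

definition projectively_unique_in :: "nat \<Rightarrow> (nat \<Rightarrow>\<^sub>0 real) set \<Rightarrow> bool" where
  "projectively_unique_in d P \<longleftrightarrow>
     polytope_in d P \<and>
     (\<forall>P' \<phi>. polytope_in d P' \<longrightarrow> combinatorial_isomorphism \<phi> P P' \<longrightarrow>
        (\<exists>L. projective_transformation L (eucl d) (eucl d) \<and> proj_defined_on L P \<and>
             (\<forall>F. F face_of P \<longrightarrow> proj_app L ` F = \<phi> F)))"

lemma subspace_eucl: "subspace (eucl d)"
proof (rule subspaceI)
  show "0 \<in> eucl d" by (simp add: eucl_def)
next
  fix x y assume "x \<in> eucl d" "y \<in> eucl d"
  then show "x + y \<in> eucl d"
    unfolding eucl_def using Poly_Mapping.keys_add[of x y] by blast
next
  fix c :: real and x assume x: "x \<in> eucl d"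
  have "Poly_Mapping.lookup (c *\<^sub>R x) i = c * Poly_Mapping.lookup x i" for i
  proof -
    have "finite {i. c *\<^sub>R Poly_Mapping.lookup x i \<noteq> 0}"
      by (rule finite_subset[OF _ finite_keys[of x]]) (auto simp: in_keys_iff)
    then show ?thesis by (simp add: scaleR_poly_mapping_def)
  qed
  then show "c *\<^sub>R x \<in> eucl d"
    using x by (auto simp: eucl_def in_keys_iff subset_iff)
qed

lemma homogenization_subspace:
  assumes "subspace V"
  shows "homogenization V = V \<times> UNIV"
proof
  have "subspace (V \<times> (UNIV :: real set))"
    using assms by (intro subspace_Times) auto
  then show "homogenization V \<subseteq> V \<times> UNIV"
    unfolding homogenization_def by (intro span_minimal) auto
next
  show "V \<times> UNIV \<subseteq> homogenization V"
  proof clarify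
    fix x :: 'a and t :: real assume x: "x \<in> V"
    have "(x, t) = (x, 1) + (t - 1) *\<^sub>R (0, 1)" by simp
    also have "\<dots> \<in> span (V \<times> {1})"
      using x assms by (intro span_add span_scale span_base) (auto simp: subspace_0)
    finally show "(x, t) \<in> homogenization V" by (simp add: homogenization_def)
  qed
qed

end

(*
  P is made a base of the pyramid with apex 0 over a translate of P at height 1.  Let R be a finite
  set of vectors and let Q be the convex hull of the pyramid together with, for each r in R, the
  points r and -r lifted by a coordinate of their own (a Lawrence extension).  A set of vertices of
  Q spans a face iff no linear dependency of the homogenized vertices is nonnegative and nontrivial
  off it.  So the face lattice of Q determines the sign patterns of the minimal dependencies of R
  and which vertices of the pyramid are joined to 0 along a direction in R.

  R is chosen to contain the vertices of the base and a von Staudt configuration: the vectors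
  e_i - x e_j with x in a finite set X of reals, and e_0 - x e_1 - y e_2.  Three-term dependencies
  between them express x y and x + y, so any other realization of the sign patterns is, up to a
  linear map and rescaling, given by a real-valued map on X which respects the order and the sums
  and products that lie in X.  If X contains the Horner steps of integer polynomials and rational
  bounds that isolate their roots, this map is the identity.  Hence every realization of Q has
  linearly equivalent R; the edges at 0 then fix each base vertex up to a factor along its ray, and
  parallelism of the base with vectors in R makes these factors equal.
*)
theory Submission
  imports Defs
begin

section \<open>Rigid finite sets of algebraic numbers\<close>

text \<open>A face lattice only tells off which sets some dependency is nonnegative and nontrivial.
  Lifted pairs turn this into sign information: a dependency has opposite signs at the two lifts of
  r, so placing one lift into the set prescribes the sign at r. Even so, a set that is not facial
  yields only some dependency whose signs conform to the prescribed ones, possibly with more zeros.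
  Conformal witnesses in both directions suffice when a vector is expressed in an independent
  family, and every computation is arranged in that form.

  Signs see vectors only up to positive factors. Some of this freedom is spent on normalizing the
  images of e_0 - e_j; the rest is harmless, because a projective transformation may rescale
  homogenized vertices by positive factors. The order on X is essential: sums and products alone
  cannot distinguish a real algebraic number from a real conjugate. Multiplication composes e_i - x
  e_j with e_j - y e_k, so three indices must exist, and two coordinates beyond the height of the
  pyramid provide them in every dimension.\<close>

definition ordered_partial_hom :: "real set \<Rightarrow> (real \<Rightarrow> real) \<Rightarrow> bool" where
  "ordered_partial_hom X h \<longleftrightarrow> h 1 = 1 \<and>
     (\<forall>x\<in>X. \<forall>y\<in>X. x + y \<in> X \<longrightarrow> h (x + y) = h x + h y) \<and>
     (\<forall>x\<in>X. \<forall>y\<in>X. x * y \<in> X \<longrightarrow> h (x * y) = h x * h y) \<and>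
     (\<forall>x\<in>X. \<forall>y\<in>X. x < y \<longrightarrow> h x < h y)"

text \<open>The numbers \<open>0\<close> and \<open>1\<close> are included because, as parameters,
  they give the basis vectors and their differences.\<close>

definition hom_rigid :: "real set \<Rightarrow> bool" where
  "hom_rigid X \<longleftrightarrow> 0 \<in> X \<and> 1 \<in> X \<and> (\<forall>h. ordered_partial_hom X h \<longrightarrow> (\<forall>x\<in>X. h x = x))"

lemma ordered_partial_hom_mono:
  "ordered_partial_hom X h \<Longrightarrow> Y \<subseteq> X \<Longrightarrow> ordered_partial_hom Y h"
  unfolding ordered_partial_hom_def by (meson subsetD)

lemma ordered_partial_homD:
  assumes "ordered_partial_hom X h"
  shows "h 1 = 1"
    and "x \<in> X \<Longrightarrow> y \<in> X \<Longrightarrow> x + y \<in> X \<Longrightarrow> h (x + y) = h x + h y"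
    and "x \<in> X \<Longrightarrow> y \<in> X \<Longrightarrow> x * y \<in> X \<Longrightarrow> h (x * y) = h x * h y"
    and "x \<in> X \<Longrightarrow> y \<in> X \<Longrightarrow> x < y \<Longrightarrow> h x < h y"
  using assms unfolding ordered_partial_hom_def by blast+

text \<open>A partial homomorphism restricts to each member of the union, so every algebraic number
  can be treated by itself.\<close>

lemma hom_rigid_UN:
  assumes "I \<noteq> {}" "\<And>i. i \<in> I \<Longrightarrow> hom_rigid (X i)"
  shows "hom_rigid (\<Union>i\<in>I. X i)"
  unfolding hom_rigid_def
proof (intro conjI allI impI ballI)
  show "0 \<in> (\<Union>i\<in>I. X i)" "1 \<in> (\<Union>i\<in>I. X i)"
    using assms by (auto simp: hom_rigid_def)
next
  fix h x assume h: "ordered_partial_hom (\<Union>i\<in>I. X i) h" and "x \<in> (\<Union>i\<in>I. X i)"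
  then obtain i where i: "i \<in> I" "x \<in> X i" by blast
  have "ordered_partial_hom (X i) h"
    using ordered_partial_hom_mono[OF h] i(1) by blast
  then show "h x = x" using assms(2)[OF i(1)] i(2) by (auto simp: hom_rigid_def)
qed

text \<open>Integers are reached by repeatedly adding \<open>1\<close>, which is legitimate only
  while all partial sums stay in \<open>X\<close>; hence the whole interval. Negative integers
  follow from \<open>i + (- i) = 0\<close>.\<close>

lemma ordered_partial_hom_int:
  assumes h: "ordered_partial_hom X h" and X: "real_of_int ` {- k..k} \<subseteq> X" and i: "\<bar>i\<bar> \<le> k"
  shows "h (real_of_int i) = real_of_int i"
proof -
  have mem: "real_of_int j \<in> X" if "\<bar>j\<bar> \<le> k" for j
    using X that by (auto simp: image_subset_iff abs_le_iff)
  have add: "h (x + y) = h x + h y" if "x \<in> X" "y \<in> X" "x + y \<in> X" for x y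
    using h that by (auto simp: ordered_partial_hom_def)
  have h0: "h 0 = 0"
    using add[of 0 0] mem[of 0] i by simp
  have nat: "h (real m) = real m" if "int m \<le> k" for m
    using that
  proof (induction m)
    case (Suc m)
    have "h (real m + 1) = h (real m) + h 1"
      using mem[of 1] mem[of "int m"] mem[of "int m + 1"] Suc.prems by (intro add) auto
    then show ?case using Suc h by (simp add: ordered_partial_hom_def add.commute)
  qed (simp add: h0)
  show ?thesis
  proof (cases "i \<ge> 0")
    case True
    then show ?thesis using nat[of "nat i"] i by simp
  next
    case False
    have "h (real_of_int i + real_of_int (- i)) = h (real_of_int i) + h (real_of_int (- i))"
      using mem[of i] mem[of "- i"] mem[of 0] i by (intro add) auto
    moreover have "h (real_of_int (- i)) = - real_of_int i"
      using nat[of "nat (- i)"] False i by simp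
    ultimately show ?thesis using h0 by simp
  qed
qed

section \<open>Horner evaluation with partially defined operations\<close>

abbreviation horner :: "real list \<Rightarrow> real \<Rightarrow> real" where
  "horner cs x \<equiv> horner_sum (\<lambda>c. c) x cs"

text \<open>The products are recorded along with the sums, because a law of
  \<open>ordered_partial_hom\<close> applies only when the result of the operation lies in
  \<open>X\<close>.\<close>

fun horner_steps :: "real list \<Rightarrow> real \<Rightarrow> real set" where
  "horner_steps [] x = {0}"
| "horner_steps (c # cs) x = {c, x * horner cs x, horner (c # cs) x} \<union> horner_steps cs x"

lemma horner_in_horner_steps: "horner cs x \<in> horner_steps cs x"
  by (cases cs) auto

lemma finite_horner_steps: "finite (horner_steps cs x)"
  by (induction cs) auto

text \<open>Here \<open>h\<close> need not fix \<open>x\<close>; this is what sends a root to a root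
  \<open>h x\<close> of the same polynomial.\<close>

lemma ordered_partial_hom_horner:
  assumes h: "ordered_partial_hom X h" and "horner_steps cs x \<subseteq> X" "x \<in> X" "h 0 = 0"
    and "\<And>c. c \<in> set cs \<Longrightarrow> h c = c"
  shows "h (horner cs x) = horner cs (h x)"
  using assms(2,5)
proof (induction cs)
  case (Cons c cs)
  have mem: "horner cs x \<in> X" "x * horner cs x \<in> X" "c \<in> X" "c + x * horner cs x \<in> X"
    using Cons.prems(1) horner_in_horner_steps[of x cs] by auto
  have "h (c + x * horner cs x) = h c + h x * h (horner cs x)"
    using ordered_partial_homD(2)[OF h mem(3,2,4)] ordered_partial_homD(3)[OF h \<open>x \<in> X\<close> mem(1,2)] by simp
  then show ?case using Cons by simp
qed (use assms(4) in simp)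

text \<open>Once \<open>x\<close> is fixed, rigidity still demands that the auxiliary values put
  into \<open>X\<close> be fixed as well.\<close>

lemma ordered_partial_hom_horner_steps:
  assumes h: "ordered_partial_hom X h" and "horner_steps cs x \<subseteq> X" "x \<in> X" "h 0 = 0" "h x = x"
    and "\<And>c. c \<in> set cs \<Longrightarrow> h c = c" and "y \<in> horner_steps cs x"
  shows "h y = y"
  using assms(2,6,7)
proof (induction cs)
  case (Cons c cs)
  have *: "h (horner bs x) = horner bs x" if "horner_steps bs x \<subseteq> X" "set bs \<subseteq> set (c # cs)" for bs
    using ordered_partial_hom_horner[OF h that(1) \<open>x \<in> X\<close> \<open>h 0 = 0\<close>] Cons.prems(2) that(2) \<open>h x = x\<close>
    by auto
  have "horner cs x \<in> X" "x * horner cs x \<in> X"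
    using Cons.prems(1) horner_in_horner_steps[of x cs] by auto
  then have "h (x * horner cs x) = x * horner cs x"
    using ordered_partial_homD(3)[OF h \<open>x \<in> X\<close>, of "horner cs x"] *[of cs] Cons.prems(1) \<open>h x = x\<close>
    by (simp add: subset_insertI)
  then show ?case using Cons *[of "c # cs"] by auto
qed (use assms(4) in simp)

text \<open>
  A root of an integer polynomial is pinned down by the polynomial, evaluated by Horner's scheme
  inside \<open>X\<close>, together with an isolating interval whose end points are rational.
\<close>

lemma algebraic_imp_hom_rigid:
  fixes a :: real
  assumes "algebraic a"
  shows "\<exists>X. finite X \<and> hom_rigid X \<and> a \<in> X \<and> - a \<in> X"
proof -
  obtain p where p: "\<And>i. coeff p i \<in> \<int>" "p \<noteq> 0" "poly p a = 0"
    using assms unfolding algebraic_def by blast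
  have fin: "finite {x. poly p x = 0}" using p(2) by (rule poly_roots_finite)
  obtain \<epsilon> where \<epsilon>: "\<epsilon> > 0" "\<And>x. poly p x = 0 \<Longrightarrow> \<bar>x - a\<bar> < \<epsilon> \<Longrightarrow> x = a"
  proof -
    obtain d where "d > 0" "\<forall>x\<in>{x. poly p x = 0}. x \<noteq> a \<longrightarrow> d \<le> dist a x"
      using finite_set_avoid[OF fin] by blast
    then show ?thesis by (intro that[of d]) (auto simp: dist_real_def abs_minus_commute)
  qed
  obtain t where t: "inverse (real (Suc t)) < \<epsilon>" using reals_Archimedean[OF \<epsilon>(1)] by blast
  \<comment> \<open>The isolating interval is cleared of its denominator \<open>T\<close>:
    \<open>s \<le> T * a < s + 1\<close> involves integers and \<open>T * a\<close> only, and
    \<open>1 / T < \<epsilon>\<close> makes the interval isolating.\<close>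
  define T where "T = real (Suc t)"
  define s where "s = \<lfloor>T * a\<rfloor>"
  define cs where "cs = coeffs p"
  \<comment> \<open>\<open>k\<close> covers \<open>T\<close>, all coefficients and both end points
    \<open>s\<close> and \<open>s + 1\<close>, so that all of them are fixed by
    \<open>h\<close>.\<close>
  define k where "k = Max (insert (int (Suc t)) (insert (\<bar>s\<bar> + 1) ((\<lambda>c. \<bar>\<lfloor>c\<rfloor>\<bar>) ` set cs)))"
  have k: "int (Suc t) \<le> k" "\<bar>s\<bar> + 1 \<le> k" "\<And>c. c \<in> set cs \<Longrightarrow> \<bar>\<lfloor>c\<rfloor>\<bar> \<le> k"
    unfolding k_def by (intro Max_ge; simp)+
  have cs_int: "c \<in> \<int>" if "c \<in> set cs" for c
  proof -
    have "c \<in> range (coeff p)" using that range_coeff[of p] unfolding cs_def by blast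
    then show ?thesis using p(1) by auto
  qed
  define X where "X = real_of_int ` {- k..k} \<union> {a, - a, T * a} \<union> horner_steps cs a"
  have "finite X" unfolding X_def by (simp add: finite_horner_steps)
  moreover have "hom_rigid X"
    unfolding hom_rigid_def
  proof (intro conjI allI impI ballI)
    have intX: "real_of_int i \<in> X" if "\<bar>i\<bar> \<le> k" for i
      using that by (auto simp: X_def abs_le_iff)
    show X01: "0 \<in> X" "1 \<in> X"
      using intX[of 0] intX[of 1] k(1) by simp_all
    fix h x assume h: "ordered_partial_hom X h" and x: "x \<in> X"
    have int: "h (real_of_int i) = real_of_int i" if "\<bar>i\<bar> \<le> k" for i
      by (rule ordered_partial_hom_int[OF h _ that]) (auto simp: X_def)
    have h0: "h 0 = 0" using int[of 0] k(1) by simp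
    have hT: "h T = T" using int[of "int (Suc t)"] k(1) by (simp add: T_def)
    have TX: "T \<in> X" using intX[of "int (Suc t)"] k(1) by (simp add: T_def)
    have hcs: "h c = c" if "c \<in> set cs" for c
    proof -
      have "c \<in> \<int>" using that by (rule cs_int)
      then obtain i where "c = real_of_int i" by (rule Ints_cases)
      then show ?thesis using int[of i] k(3)[OF that] by simp
    qed
    have aX: "a \<in> X" "- a \<in> X" "T * a \<in> X" and sX: "horner_steps cs a \<subseteq> X"
      by (auto simp: X_def)
    have mono: "h u \<le> h v" if "u \<in> X" "v \<in> X" "u \<le> v" for u v
      using ordered_partial_homD(4)[OF h that(1,2)] that(3) by (cases "u = v") auto
    have hTa: "h (T * a) = T * h a"
      using ordered_partial_homD(3)[OF h TX aX(1,3)] hT by simp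
    have root: "poly p (h a) = 0"
      using ordered_partial_hom_horner[OF h sX aX(1) h0 hcs] p(3) h0
      by (simp add: poly_def cs_def id_def)
    have "real_of_int s \<le> T * a" "T * a < real_of_int (s + 1)" unfolding s_def by linarith+
    moreover have "real_of_int s \<le> T * h a"
      using mono[OF intX[of s] aX(3)] int[of s] k(2) hTa \<open>real_of_int s \<le> T * a\<close> by simp
    moreover have "T * h a < real_of_int (s + 1)"
    proof -
      have "h (T * a) < h (real_of_int (s + 1))"
        using k(2) \<open>T * a < real_of_int (s + 1)\<close>
        by (intro ordered_partial_homD(4)[OF h aX(3) intX]) auto
      then show ?thesis using int[of "s + 1"] k(2) hTa by auto
    qed
    ultimately have "\<bar>T * h a - T * a\<bar> < 1" by simp
    then have "T * \<bar>h a - a\<bar> < 1"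
      by (metis T_def abs_mult abs_of_nat right_diff_distrib)
    then have "\<bar>h a - a\<bar> < inverse T" unfolding T_def by (simp add: field_simps)
    then have ha: "h a = a" using \<epsilon>(2)[OF root] t unfolding T_def by linarith
    have hma: "h (- a) = - a"
    proof -
      have "h (a + - a) = h a + h (- a)"
        using X01(1) by (intro ordered_partial_homD(2)[OF h aX(1,2)]) simp
      then show ?thesis using h0 ha by simp
    qed
    show "h x = x"
      using x ordered_partial_hom_horner_steps[OF h sX aX(1) h0 ha hcs] ha hma hTa int
      unfolding X_def by auto
  qed
  ultimately show ?thesis unfolding X_def by (intro exI[of _ X]) (auto simp: X_def)
qed

lemma algebraic_set_imp_hom_rigid:
  assumes "finite S" "\<And>a. a \<in> S \<Longrightarrow> algebraic a"
  shows "\<exists>X. finite X \<and> hom_rigid X \<and> S \<subseteq> X \<and> uminus ` S \<subseteq> X"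
proof -
  \<comment> \<open>Adding \<open>0\<close> keeps the union nonempty when \<open>S\<close> is
    empty.\<close>
  have "\<exists>X. finite X \<and> hom_rigid X \<and> a \<in> X \<and> - a \<in> X" if "a \<in> insert 0 S" for a
    using that assms(2) by (intro algebraic_imp_hom_rigid) (auto intro: rat_imp_algebraic)
  then obtain X where X: "\<And>a. a \<in> insert 0 S \<Longrightarrow> finite (X a) \<and> hom_rigid (X a) \<and> a \<in> X a \<and> - a \<in> X a"
    by metis
  have "hom_rigid (\<Union>a\<in>insert 0 S. X a)"
    by (rule hom_rigid_UN) (use X in auto)
  moreover have "finite (\<Union>a\<in>insert 0 S. X a)"
    by (intro finite_UN_I) (use assms(1) X in auto)
  moreover have "S \<subseteq> (\<Union>a\<in>insert 0 S. X a)" "uminus ` S \<subseteq> (\<Union>a\<in>insert 0 S. X a)"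
    using X by auto
  ultimately show ?thesis by blast
qed

section \<open>Conformal transfer of linear dependencies\<close>

text \<open>The sign vector of \<open>\<nu>\<close> arises from that of \<open>\<mu>\<close> by
  replacing some signs by zero; zeros of \<open>\<mu>\<close> persist. Sets that are not facial
  provide such a witness, not one with equal signs.\<close>

definition conformally_covered :: "'i set \<Rightarrow> ('i \<Rightarrow> 'a::real_vector) \<Rightarrow> ('i \<Rightarrow> 'b::real_vector) \<Rightarrow> bool" where
  "conformally_covered R f g \<longleftrightarrow>
     (\<forall>\<mu>. (\<Sum>r\<in>R. \<mu> r *\<^sub>R f r) = 0 \<longrightarrow> (\<exists>r\<in>R. \<mu> r \<noteq> 0) \<longrightarrow>
       (\<exists>\<nu>. (\<Sum>r\<in>R. \<nu> r *\<^sub>R g r) = 0 \<and> (\<exists>r\<in>R. \<nu> r \<noteq> 0) \<and>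
            (\<forall>r\<in>R. (\<mu> r \<ge> 0 \<longrightarrow> \<nu> r \<ge> 0) \<and> (\<mu> r \<le> 0 \<longrightarrow> \<nu> r \<le> 0))))"

lemma conformally_coveredE:
  assumes "conformally_covered R f g" "(\<Sum>r\<in>R. \<mu> r *\<^sub>R f r) = 0" "r \<in> R" "\<mu> r \<noteq> 0"
  obtains \<nu> where "(\<Sum>r\<in>R. \<nu> r *\<^sub>R g r) = 0" "\<exists>r\<in>R. \<nu> r \<noteq> 0"
    "\<forall>r\<in>R. (\<mu> r \<ge> 0 \<longrightarrow> \<nu> r \<ge> 0) \<and> (\<mu> r \<le> 0 \<longrightarrow> \<nu> r \<le> 0)"
  using assms unfolding conformally_covered_def by blast

text \<open>Extend a dependency on \<open>T\<close> by zero; conformality makes its companion vanish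
  off \<open>T\<close> too.\<close>

lemma conformally_covered_subset:
  assumes "conformally_covered R f g" "finite R" "T \<subseteq> R"
  shows "conformally_covered T f g"
  unfolding conformally_covered_def
proof (intro allI impI)
  fix \<mu> assume \<mu>: "(\<Sum>r\<in>T. \<mu> r *\<^sub>R f r) = 0" and nz: "\<exists>r\<in>T. \<mu> r \<noteq> 0"
  define \<mu>' where "\<mu>' r = (if r \<in> T then \<mu> r else 0)" for r
  have "(\<Sum>r\<in>R. \<mu>' r *\<^sub>R f r) = (\<Sum>r\<in>T. \<mu>' r *\<^sub>R f r)"
    using assms(2,3) by (intro sum.mono_neutral_right) (auto simp: \<mu>'_def)
  also have "\<dots> = 0" using \<mu> by (simp add: \<mu>'_def)
  finally have "(\<Sum>r\<in>R. \<mu>' r *\<^sub>R f r) = 0" .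
  moreover obtain r where "r \<in> T" "\<mu> r \<noteq> 0" using nz by blast
  moreover from this have "r \<in> R" "\<mu>' r \<noteq> 0" using assms(3) by (auto simp: \<mu>'_def)
  ultimately obtain \<nu> where \<nu>: "(\<Sum>r\<in>R. \<nu> r *\<^sub>R g r) = 0" "\<exists>r\<in>R. \<nu> r \<noteq> 0"
      "\<forall>r\<in>R. (\<mu>' r \<ge> 0 \<longrightarrow> \<nu> r \<ge> 0) \<and> (\<mu>' r \<le> 0 \<longrightarrow> \<nu> r \<le> 0)"
    using conformally_coveredE[OF assms(1)] by blast
  have z: "\<nu> r = 0" if "r \<in> R - T" for r
    using bspec[OF \<nu>(3), of r] that by (simp add: \<mu>'_def)
  have "(\<Sum>r\<in>R. \<nu> r *\<^sub>R g r) = (\<Sum>r\<in>T. \<nu> r *\<^sub>R g r)"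
    using assms(2,3) z by (intro sum.mono_neutral_right) auto
  moreover have "\<exists>r\<in>T. \<nu> r \<noteq> 0" using \<nu>(2) z by auto
  moreover have "\<forall>r\<in>T. (\<mu> r \<ge> 0 \<longrightarrow> \<nu> r \<ge> 0) \<and> (\<mu> r \<le> 0 \<longrightarrow> \<nu> r \<le> 0)"
    using \<nu>(3) assms(3) by (metis \<mu>'_def subsetD)
  ultimately show "\<exists>\<nu>. (\<Sum>r\<in>T. \<nu> r *\<^sub>R g r) = 0 \<and> (\<exists>r\<in>T. \<nu> r \<noteq> 0) \<and>
      (\<forall>r\<in>T. (\<mu> r \<ge> 0 \<longrightarrow> \<nu> r \<ge> 0) \<and> (\<mu> r \<le> 0 \<longrightarrow> \<nu> r \<le> 0))"
    using \<nu>(1) by auto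
qed

text \<open>Indexed, unlike independence of the image: repeated vectors count as dependent, so
  injectivity of \<open>f\<close> need not be known beforehand.\<close>

definition independent_family :: "'i set \<Rightarrow> ('i \<Rightarrow> 'a::real_vector) \<Rightarrow> bool" where
  "independent_family T f \<longleftrightarrow> (\<forall>c. (\<Sum>t\<in>T. c t *\<^sub>R f t) = 0 \<longrightarrow> (\<forall>t\<in>T. c t = 0))"

lemma independent_familyD:
  "independent_family T f \<Longrightarrow> (\<Sum>t\<in>T. c t *\<^sub>R f t) = 0 \<Longrightarrow> t \<in> T \<Longrightarrow> c t = 0"
  unfolding independent_family_def by blast

lemma independent_family_unique:
  assumes "independent_family T f" "(\<Sum>t\<in>T. a t *\<^sub>R f t) = (\<Sum>t\<in>T. b t *\<^sub>R f t)" "t \<in> T"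
  shows "a t = b t"
proof -
  have "(\<Sum>t\<in>T. (a t - b t) *\<^sub>R f t) = 0"
    using assms(2) by (simp add: scaleR_diff_left sum_subtractf)
  from independent_familyD[OF assms(1) this assms(3)] show ?thesis by simp
qed

lemma independent_family_transfer:
  assumes "conformally_covered T g f" "independent_family T f"
  shows "independent_family T g"
  unfolding independent_family_def
proof (intro allI impI, rule ccontr)
  fix c assume c: "(\<Sum>t\<in>T. c t *\<^sub>R g t) = 0" and "\<not> (\<forall>t\<in>T. c t = 0)"
  then obtain t where "t \<in> T" "c t \<noteq> 0" by blast
  then obtain \<nu> where "(\<Sum>t\<in>T. \<nu> t *\<^sub>R f t) = 0" "\<exists>t\<in>T. \<nu> t \<noteq> 0"
    using conformally_coveredE[OF assms(1) c] by blast
  then show False using assms(2) unfolding independent_family_def by blast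
qed

text \<open>Over an independent \<open>T\<close> the relation for \<open>r\<close> is unique up to a
  factor. So the conformal relation among the \<open>g\<close> vectors must involve
  \<open>r\<close>, and carrying it back to \<open>f\<close> shows that no coefficient has
  degenerated. Only signs are transferred, not values.\<close>

lemma representation_transfer:
  assumes fin: "finite R" and fg: "conformally_covered R f g" and gf: "conformally_covered R g f"
    and r: "r \<in> R" and T: "T \<subseteq> R" and indep: "independent_family T f"
    and rep: "f r = (\<Sum>t\<in>T. c t *\<^sub>R f t)"
  obtains c' where "g r = (\<Sum>t\<in>T. c' t *\<^sub>R g t)" "\<forall>t\<in>T. sgn (c' t) = sgn (c t)"
proof (cases "r \<in> T")
  case True
  have finT: "finite T" using fin T finite_subset by blast
  have delta: "(\<Sum>t\<in>T. (if t = r then 1 else 0) *\<^sub>R h t) = h r" for h :: "'a \<Rightarrow> 'd::real_vector"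
  proof -
    have "(\<Sum>t\<in>T. (if t = r then 1 else 0) *\<^sub>R h t) = (\<Sum>t\<in>T. if t = r then h t else 0)"
      by (intro sum.cong) auto
    then show ?thesis using finT True by simp
  qed
  have "c t = (if t = r then 1 else 0)" if "t \<in> T" for t
    using independent_family_unique[OF indep _ that, of c "\<lambda>t. if t = r then 1 else 0"] rep delta[of f] by simp
  then show ?thesis
    using that[of "\<lambda>t. if t = r then 1 else 0"] delta[of g] by simp
next
  case False
  have finT: "finite T" using fin T finite_subset by blast
  have fg': "conformally_covered (insert r T) f g" and gf': "conformally_covered (insert r T) g f"
    using conformally_covered_subset[OF fg fin] conformally_covered_subset[OF gf fin] r T by simp_all
  have gind: "independent_family T g"
    using independent_family_transfer indep conformally_covered_subset[OF gf fin T] by blast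
  define \<mu> where "\<mu> t = (if t = r then -1 else c t)" for t
  have split: "(\<Sum>t\<in>insert r T. \<kappa> t *\<^sub>R h t) = \<kappa> r *\<^sub>R h r + (\<Sum>t\<in>T. \<kappa> t *\<^sub>R h t)"
    for \<kappa> and h :: "'a \<Rightarrow> 'd::real_vector"
    using finT False by simp
  have \<mu>T: "(\<Sum>t\<in>T. \<mu> t *\<^sub>R f t) = (\<Sum>t\<in>T. c t *\<^sub>R f t)"
    using False by (intro sum.cong) (auto simp: \<mu>_def)
  have "(\<Sum>t\<in>insert r T. \<mu> t *\<^sub>R f t) = 0"
    unfolding split \<mu>T using rep by (simp add: \<mu>_def)
  moreover have "\<mu> r \<noteq> 0" by (simp add: \<mu>_def)
  ultimately obtain \<nu> where \<nu>: "(\<Sum>t\<in>insert r T. \<nu> t *\<^sub>R g t) = 0" "\<exists>t\<in>insert r T. \<nu> t \<noteq> 0"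
      "\<forall>t\<in>insert r T. (\<mu> t \<ge> 0 \<longrightarrow> \<nu> t \<ge> 0) \<and> (\<mu> t \<le> 0 \<longrightarrow> \<nu> t \<le> 0)"
    using conformally_coveredE[OF fg' _ insertI1] by blast
  have \<nu>r: "\<nu> r < 0"
  proof (rule ccontr)
    assume "\<not> \<nu> r < 0"
    then have "\<nu> r = 0" using bspec[OF \<nu>(3), of r] by (simp add: \<mu>_def)
    then have "\<forall>t\<in>T. \<nu> t = 0"
      using \<nu>(1) gind unfolding split independent_family_def by simp
    then show False using \<nu>(2) \<open>\<nu> r = 0\<close> by auto
  qed
  then have "\<nu> r \<noteq> 0" by simp
  \<comment> \<open>A coefficient lost on the way to \<open>g\<close> stays lost on the way back,
    but over \<open>f\<close> every dependency of these vectors is a multiple of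
    \<open>\<mu>\<close>, which is nonzero at \<open>t\<close>.\<close>
  have nz: "\<nu> t \<noteq> 0" if t: "t \<in> T" "c t \<noteq> 0" for t
  proof
    assume "\<nu> t = 0"
    obtain \<kappa> where \<kappa>: "(\<Sum>t\<in>insert r T. \<kappa> t *\<^sub>R f t) = 0" "\<exists>t\<in>insert r T. \<kappa> t \<noteq> 0"
      "\<forall>t\<in>insert r T. (\<nu> t \<ge> 0 \<longrightarrow> \<kappa> t \<ge> 0) \<and> (\<nu> t \<le> 0 \<longrightarrow> \<kappa> t \<le> 0)"
      using conformally_coveredE[OF gf' \<nu>(1) insertI1 \<open>\<nu> r \<noteq> 0\<close>] by blast
    have \<kappa>t: "\<kappa> t = 0" using bspec[OF \<kappa>(3), of t] t \<open>\<nu> t = 0\<close> by auto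
    have sum0: "(\<Sum>s\<in>T. (\<kappa> s + \<kappa> r * c s) *\<^sub>R f s) = 0"
      using \<kappa>(1) unfolding split rep
      by (simp add: scaleR_add_left sum.distrib scaleR_sum_right add.commute)
    have z: "\<kappa> s + \<kappa> r * c s = 0" if "s \<in> T" for s
      by (rule independent_familyD[OF indep sum0 that])
    have "\<kappa> r = 0" using z[OF t(1)] t(2) \<kappa>t by simp
    moreover have "\<forall>s\<in>T. \<kappa> s = 0" using z \<open>\<kappa> r = 0\<close> by simp
    ultimately show False using \<kappa>(2) by auto
  qed
  define c' where "c' t = \<nu> t / (- \<nu> r)" for t
  have "(- \<nu> r) *\<^sub>R g r = (\<Sum>t\<in>T. \<nu> t *\<^sub>R g t)"
    using \<nu>(1) unfolding split by (simp add: neg_eq_iff_add_eq_0)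
  then have "inverse (- \<nu> r) *\<^sub>R ((- \<nu> r) *\<^sub>R g r) = (\<Sum>t\<in>T. c' t *\<^sub>R g t)"
    by (simp add: c'_def scaleR_sum_right divide_inverse mult.commute)
  then have "g r = (\<Sum>t\<in>T. c' t *\<^sub>R g t)" using \<nu>r by simp
  moreover have "sgn (c' t) = sgn (c t)" if "t \<in> T" for t
  proof -
    have "t \<noteq> r" using that False by auto
    then have "(c t \<ge> 0 \<longrightarrow> \<nu> t \<ge> 0) \<and> (c t \<le> 0 \<longrightarrow> \<nu> t \<le> 0)"
      using bspec[OF \<nu>(3), of t] that by (simp add: \<mu>_def)
    then have "sgn (\<nu> t) = sgn (c t)" using nz[OF that] by (auto simp: sgn_if)
    then show ?thesis using \<nu>r by (simp add: c'_def sgn_divide)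
  qed
  ultimately show ?thesis by (intro that ballI)
qed

lemma representation_transfer_2:
  assumes "finite R" "conformally_covered R f g" "conformally_covered R g f"
    and "r \<in> R" "s \<in> R" "t \<in> R"
    and indep: "\<And>a b. a *\<^sub>R f s + b *\<^sub>R f t = 0 \<Longrightarrow> a = 0 \<and> b = 0"
    and rep: "f r = a *\<^sub>R f s + b *\<^sub>R f t"
  obtains a' b' where "g r = a' *\<^sub>R g s + b' *\<^sub>R g t" "sgn a' = sgn a" "sgn b' = sgn b"
proof -
  have "s \<noteq> t" using indep[of 1 "-1"] by auto
  have sum2: "(\<Sum>i\<in>{s, t}. c i *\<^sub>R h i) = c s *\<^sub>R h s + c t *\<^sub>R h t" for c and h :: "'a \<Rightarrow> 'd::real_vector"
    using \<open>s \<noteq> t\<close> by simp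
  define c where "c i = (if i = s then a else b)" for i
  have ind: "independent_family {s, t} f"
    unfolding independent_family_def sum2 using indep by blast
  have rep': "f r = (\<Sum>i\<in>{s, t}. c i *\<^sub>R f i)"
    unfolding sum2 c_def using \<open>s \<noteq> t\<close> rep by simp
  have "{s, t} \<subseteq> R" using assms(5,6) by simp
  then obtain c' where c': "g r = (\<Sum>i\<in>{s, t}. c' i *\<^sub>R g i)" "\<forall>i\<in>{s, t}. sgn (c' i) = sgn (c i)"
    by (rule representation_transfer[OF assms(1-4) _ ind rep'])
  show ?thesis
    using that[of "c' s" "c' t"] c'(1) c'(2) \<open>s \<noteq> t\<close> unfolding sum2 c_def by simp
qed

text \<open>These coordinate functionals are later applied to vector identities in order to compare
  coefficients.\<close>

lemma dual_family:
  fixes E :: "'i \<Rightarrow> 'b::real_vector"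
  assumes "finite I" "independent_family I E"
  obtains \<phi> :: "'i \<Rightarrow> 'b \<Rightarrow> real" where "\<And>i. linear (\<phi> i)"
    "\<And>i j. i \<in> I \<Longrightarrow> j \<in> I \<Longrightarrow> \<phi> i (E j) = (if i = j then 1 else 0)"
proof -
  have inj: "inj_on E I"
  proof (rule inj_onI)
    fix i j assume ij: "i \<in> I" "j \<in> I" "E i = E j"
    show "i = j"
    proof (rule ccontr)
      assume "i \<noteq> j"
      define c where "c k = (if k = i then 1 else if k = j then -1 else (0::real))" for k
      have "(\<Sum>k\<in>I. c k *\<^sub>R E k) = (\<Sum>k\<in>{i, j}. c k *\<^sub>R E k)"
        using assms(1) ij by (intro sum.mono_neutral_right) (auto simp: c_def)
      also have "\<dots> = 0" using \<open>i \<noteq> j\<close> ij by (simp add: c_def)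
      finally have sum0: "(\<Sum>k\<in>I. c k *\<^sub>R E k) = 0" .
      have "c i = 0" by (rule independent_familyD[OF assms(2) sum0 ij(1)])
      then show False by (simp add: c_def)
    qed
  qed
  have ind: "independent (E ` I)"
  proof (rule independent_if_scalars_zero)
    show "c v = 0" if c: "(\<Sum>v\<in>E ` I. c v *\<^sub>R v) = 0" and v: "v \<in> E ` I" for c v
    proof -
      have sum0: "(\<Sum>i\<in>I. c (E i) *\<^sub>R E i) = 0"
        using c by (simp add: sum.reindex[OF inj])
      obtain i where "i \<in> I" "v = E i" using v by blast
      then show ?thesis using independent_familyD[OF assms(2) sum0, of i] by simp
    qed
  qed (use assms(1) in simp)
  have "\<exists>\<phi>. linear \<phi> \<and> (\<forall>v\<in>E ` I. \<phi> v = (if v = E i then 1 else (0::real)))" for i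
    by (rule linear_independent_extend[OF ind])
  then have "\<forall>i. \<exists>\<phi>. linear \<phi> \<and> (\<forall>v\<in>E ` I. \<phi> v = (if v = E i then 1 else (0::real)))" by blast
  from choice[OF this] obtain \<phi>
    where \<phi>: "\<And>i. linear (\<phi> i) \<and> (\<forall>v\<in>E ` I. \<phi> i v = (if v = E i then 1 else (0::real)))"
    by blast
  show ?thesis
  proof (rule that[of \<phi>])
    show "linear (\<phi> i)" for i using \<phi> by blast
    show "\<phi> i (E j) = (if i = j then 1 else 0)" if "i \<in> I" "j \<in> I" for i j
    proof -
      have "\<phi> i (E j) = (if E j = E i then 1 else 0)" using \<phi>[of i] that(2) by blast
      moreover have "E j = E i \<longleftrightarrow> i = j" using inj that by (auto simp: inj_on_def)
      ultimately show ?thesis by simp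
    qed
  qed
qed

section \<open>Von Staudt configurations\<close>

text \<open>The vectors \<open>e i - x *\<^sub>R e j\<close> act like the edges of a graph on the
  indices with labels \<open>x\<close> (a gain graph): going around a triangle multiplies
  labels.\<close>

locale von_staudt_configuration =
  fixes n :: nat and e :: "nat \<Rightarrow> 'a::real_vector" and X :: "real set" and R :: "'a set"
    and g :: "'a \<Rightarrow> 'b::real_vector" and \<psi> :: "nat \<Rightarrow> 'a \<Rightarrow> real"
  assumes n: "3 \<le> n"
    and \<psi>: "\<And>i. linear (\<psi> i)" "\<And>i j. i < n \<Longrightarrow> j < n \<Longrightarrow> \<psi> i (e j) = (if i = j then 1 else 0)"
    and X: "hom_rigid X" and R: "finite R"
    and R_pair: "\<And>i j x. i < n \<Longrightarrow> j < n \<Longrightarrow> i \<noteq> j \<Longrightarrow> x \<in> X \<Longrightarrow> e i - x *\<^sub>R e j \<in> R"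
    and R_triple: "\<And>x y. x \<in> X \<Longrightarrow> y \<in> X \<Longrightarrow> e 0 - x *\<^sub>R e 1 - y *\<^sub>R e 2 \<in> R"
    and fg: "conformally_covered R (\<lambda>r. r) g" and gf: "conformally_covered R g (\<lambda>r. r)"
begin

lemma X01: "0 \<in> X" "1 \<in> X" using X by (auto simp: hom_rigid_def)

lemma n012: "0 < n" "1 < n" "2 < n" "Suc 0 < n" using n by auto

lemma R_e: "i < n \<Longrightarrow> e i \<in> R"
  using R_pair[of i "if i = 0 then 1 else 0" 0] X01(1) n012 by (cases "i = 0") auto

lemmas \<psi>_simps = linear_add[OF \<psi>(1)] linear_diff[OF \<psi>(1)] linear_cmul[OF \<psi>(1)]
  linear_sum[OF \<psi>(1)] linear_0[OF \<psi>(1)] \<psi>(2)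

lemma independent_e: "independent_family {..<n} e"
  unfolding independent_family_def
proof (intro allI impI ballI)
  fix c i assume c: "(\<Sum>t<n. c t *\<^sub>R e t) = 0" and i: "i \<in> {..<n}"
  have "c i = (\<Sum>t<n. if t = i then c i else 0)" using i by simp
  also have "\<dots> = (\<Sum>t<n. c t * \<psi> i (e t))"
    using i by (intro sum.cong) (auto simp: \<psi>(2))
  also have "\<dots> = \<psi> i (\<Sum>t<n. c t *\<^sub>R e t)" by (simp add: \<psi>_simps)
  finally show "c i = 0" using c by (simp add: \<psi>_simps)
qed

lemma independent_pair:
  fixes \<psi>1 \<psi>2 :: "'a \<Rightarrow> real"
  assumes "linear \<psi>1" "linear \<psi>2" "\<psi>1 s \<noteq> (0::real)" "\<psi>1 t = 0" "\<psi>2 t \<noteq> (0::real)"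
    and "a *\<^sub>R s + b *\<^sub>R t = 0"
  shows "a = 0 \<and> b = 0"
proof -
  have "a * \<psi>1 s = \<psi>1 (a *\<^sub>R s + b *\<^sub>R t)"
    using assms(1,4) by (simp add: linear_add linear_cmul)
  also have "\<dots> = 0" unfolding assms(6) by (rule linear_0[OF assms(1)])
  finally have "a = 0" using assms(3) by simp
  moreover have "a * \<psi>2 s + b * \<psi>2 t = \<psi>2 (a *\<^sub>R s + b *\<^sub>R t)"
    using assms(2) by (simp add: linear_add linear_cmul)
  moreover have "\<dots> = 0" unfolding assms(6) by (rule linear_0[OF assms(2)])
  ultimately show ?thesis using assms(5) by simp
qed

lemma transfer_2:
  assumes "r \<in> R" "s \<in> R" "t \<in> R" "r = a *\<^sub>R s + b *\<^sub>R t"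
    and "linear \<psi>1" "linear \<psi>2" "\<psi>1 s \<noteq> (0::real)" "\<psi>1 t = 0" "\<psi>2 t \<noteq> (0::real)"
  obtains a' b' where "g r = a' *\<^sub>R g s + b' *\<^sub>R g t" "sgn a' = sgn a" "sgn b' = sgn b"
  by (rule representation_transfer_2[OF R fg gf assms(1-3) independent_pair[OF assms(5-9)] assms(4)])

text \<open>The coefficient \<open>1\<close> of \<open>s\<close> has positive sign, hence so has its
  transferred value; this lets scale factors be cancelled later.\<close>

lemma transfer_2_pos:
  assumes "r = s + b *\<^sub>R t" "r \<in> R" "s \<in> R" "t \<in> R"
    and "linear \<psi>1" "linear \<psi>2" "\<psi>1 s \<noteq> (0::real)" "\<psi>1 t = 0" "\<psi>2 t \<noteq> (0::real)"
  obtains a' b' where "g r = a' *\<^sub>R g s + b' *\<^sub>R g t" "a' > 0" "sgn b' = sgn b"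
proof -
  have "r = 1 *\<^sub>R s + b *\<^sub>R t" using assms(1) by simp
  then obtain a' b' where "g r = a' *\<^sub>R g s + b' *\<^sub>R g t" "sgn a' = sgn 1" "sgn b' = sgn b"
    by (rule transfer_2[OF assms(2-4) _ assms(5-9)])
  then show ?thesis using that by (simp add: sgn_1_pos)
qed

lemma independent_g: "independent_family {..<n} (\<lambda>i. g (e i))"
proof -
  have inj: "inj_on e {..<n}"
    by (rule inj_onI) (metis \<psi>(2) lessThan_iff zero_neq_one)
  have sub: "e ` {..<n} \<subseteq> R" using R_e by auto
  have "independent_family (e ` {..<n}) (\<lambda>r. r)"
    unfolding independent_family_def
    using independent_familyD[OF independent_e, of "\<lambda>i. c (e i)" for c] by (auto simp: sum.reindex[OF inj])
  then have *: "independent_family (e ` {..<n}) g"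
    using independent_family_transfer conformally_covered_subset[OF gf R sub] by blast
  show ?thesis
    unfolding independent_family_def
  proof (intro allI impI ballI)
    fix c i assume c: "(\<Sum>t<n. c t *\<^sub>R g (e t)) = 0" and i: "i \<in> {..<n}"
    have "(\<Sum>r\<in>e ` {..<n}. c (the_inv_into {..<n} e r) *\<^sub>R g r) = 0"
      using c by (simp add: sum.reindex[OF inj] the_inv_into_f_f[OF inj])
    from independent_familyD[OF * this, of "e i"] show "c i = 0"
      using i by (simp add: the_inv_into_f_f[OF inj])
  qed
qed

lemma pair_image:
  assumes "i < n" "j < n" "i \<noteq> j" "x \<in> X"
  shows "\<exists>a b. g (e i - x *\<^sub>R e j) = a *\<^sub>R g (e i) - b *\<^sub>R g (e j) \<and> a > 0 \<and> sgn b = sgn x"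
proof -
  have "e i - x *\<^sub>R e j = e i + (- x) *\<^sub>R e j" by simp
  then obtain a b where "g (e i - x *\<^sub>R e j) = a *\<^sub>R g (e i) + b *\<^sub>R g (e j)" "a > 0" "sgn b = sgn (- x)"
    by (rule transfer_2_pos[OF _ R_pair[OF assms] R_e[OF assms(1)] R_e[OF assms(2)] \<psi>(1)[of i] \<psi>(1)[of j]])
      (use \<psi>(2) assms in auto)
  then show ?thesis
    by (intro exI[of _ a] exI[of _ "- b"]) (auto simp: sgn_minus)
qed

end

text \<open>
  After rescaling, the images of \<open>e 0 - e j\<close> are positive multiples of \<open>E 0 - E j\<close>; then
  the image of every \<open>e i - x *\<^sub>R e j\<close> has the form \<open>E i - val i j x *\<^sub>R E j\<close> up to scaling.
\<close>

locale normalized_configuration = von_staudt_configuration n e X R g \<psi>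
  for n and e :: "nat \<Rightarrow> 'a::real_vector" and X R and g :: "'a \<Rightarrow> 'b::real_vector" and \<psi> +
  fixes E :: "nat \<Rightarrow> 'b" and val :: "nat \<Rightarrow> nat \<Rightarrow> real \<Rightarrow> real" and \<phi> :: "nat \<Rightarrow> 'b \<Rightarrow> real"
  assumes E: "\<And>i. i < n \<Longrightarrow> \<exists>s>0. g (e i) = s *\<^sub>R E i"
    and val: "\<And>i j x. i < n \<Longrightarrow> j < n \<Longrightarrow> i \<noteq> j \<Longrightarrow> x \<in> X \<Longrightarrow>
          \<exists>a>0. g (e i - x *\<^sub>R e j) = a *\<^sub>R (E i - val i j x *\<^sub>R E j)"
    and sgn_val: "\<And>i j x. i < n \<Longrightarrow> j < n \<Longrightarrow> i \<noteq> j \<Longrightarrow> x \<in> X \<Longrightarrow> sgn (val i j x) = sgn x"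
    and val_0: "\<And>j. j < n \<Longrightarrow> 0 \<noteq> j \<Longrightarrow> val 0 j 1 = 1"
    and \<phi>: "\<And>i. linear (\<phi> i)" "\<And>i j. i < n \<Longrightarrow> j < n \<Longrightarrow> \<phi> i (E j) = (if i = j then 1 else 0)"
begin

lemmas \<phi>_simps = linear_add[OF \<phi>(1)] linear_diff[OF \<phi>(1)] linear_cmul[OF \<phi>(1)]
  linear_sum[OF \<phi>(1)] \<phi>(2)

text \<open>In \<open>(e i - x e j) + x (e j - y e k)\<close> the vector \<open>e j\<close> cancels.
  The image relation must cancel \<open>E j\<close> as well, and comparing coefficients of
  \<open>E i\<close>, \<open>E j\<close>, \<open>E k\<close> gives the product.\<close>

lemma val_mult:
  assumes "i < n" "j < n" "k < n" "i \<noteq> j" "j \<noteq> k" "i \<noteq> k" "x \<in> X" "y \<in> X" "x * y \<in> X"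
  shows "val i k (x * y) = val i j x * val j k y"
proof -
  obtain a1 where a1: "a1 > 0" "g (e i - x *\<^sub>R e j) = a1 *\<^sub>R (E i - val i j x *\<^sub>R E j)"
    using val[of i j x] assms by blast
  obtain a2 where a2: "a2 > 0" "g (e j - y *\<^sub>R e k) = a2 *\<^sub>R (E j - val j k y *\<^sub>R E k)"
    using val[of j k y] assms by blast
  obtain a3 where a3: "a3 > 0" "g (e i - (x * y) *\<^sub>R e k) = a3 *\<^sub>R (E i - val i k (x * y) *\<^sub>R E k)"
    using val[of i k "x * y"] assms by blast
  have "e i - (x * y) *\<^sub>R e k = (e i - x *\<^sub>R e j) + x *\<^sub>R (e j - y *\<^sub>R e k)"
    by (simp add: scaleR_diff_right)
  then obtain a b where ab: "g (e i - (x * y) *\<^sub>R e k) = a *\<^sub>R g (e i - x *\<^sub>R e j) + b *\<^sub>R g (e j - y *\<^sub>R e k)"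
      "a > 0"
    by (rule transfer_2_pos[OF _ R_pair[of i k] R_pair[of i j] R_pair[of j k] \<psi>(1)[of i] \<psi>(1)[of j]])
      (use assms in \<open>auto simp: \<psi>_simps\<close>)
  note eq = ab(1)[unfolded a1 a2 a3]
  from arg_cong[OF eq, of "\<phi> i"] arg_cong[OF eq, of "\<phi> j"] arg_cong[OF eq, of "\<phi> k"]
  have "a3 = a * a1" "b * a2 = a * a1 * val i j x" "a3 * val i k (x * y) = b * a2 * val j k y"
    using assms by (simp_all add: \<phi>_simps)
  then have "a3 * val i k (x * y) = a3 * (val i j x * val j k y)" by simp
  then show ?thesis using a3(1) by simp
qed

text \<open>The normalization gives this only for pairs starting at \<open>0\<close>. Triangles
  through \<open>0\<close> with all parameters \<open>1\<close>, and a third index when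
  \<open>j = 0\<close>, carry it to the other pairs.\<close>

lemma val_1:
  assumes "i < n" "j < n" "i \<noteq> j"
  shows "val i j 1 = 1"
proof -
  have *: "val i j 1 = 1" if "i < n" "j < n" "i \<noteq> j" "i \<noteq> 0" "j \<noteq> 0" for i j
    using val_mult[of 0 i j 1 1] val_0[of i] val_0[of j] X01 n012 that by simp
  consider "i = 0" | "j = 0" | "i \<noteq> 0" "j \<noteq> 0" by blast
  then show ?thesis
  proof cases
    case 2
    define k :: nat where "k = (if i = 1 then 2 else 1)"
    have k: "k < n" "k \<noteq> 0" "k \<noteq> i" using n012 by (auto simp: k_def)
    show ?thesis
      using val_mult[of i 0 k 1 1] *[of i k] val_0[of k] X01 n012 k assms 2 by simp
  qed (use * val_0 assms in auto)
qed

lemma val_right: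
  assumes "i < n" "j < n" "k < n" "i \<noteq> j" "i \<noteq> k" "x \<in> X"
  shows "val i j x = val i k x"
  using val_mult[of i j k x 1] val_1[of j k] assms X01 by (cases "j = k") auto

lemma val_left:
  assumes "i < n" "j < n" "k < n" "i \<noteq> k" "j \<noteq> k" "x \<in> X"
  shows "val i k x = val j k x"
  using val_mult[of i j k 1 x] val_1[of i j] assms X01 by (cases "i = j") auto

text \<open>Multiplying by the parameter \<open>1\<close> changes one index at a time. From
  \<open>i = 1\<close> the direct way would pass through the degenerate pair \<open>(1, 1)\<close>,
  hence the detour over \<open>k\<close>.\<close>

lemma val_eq:
  assumes "i < n" "j < n" "i \<noteq> j" "x \<in> X"
  shows "val i j x = val 0 1 x"
proof -
  have *: "val i j x = val 0 1 x" if "i < n" "j < n" "i \<noteq> j" "i \<noteq> 1" for i j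
    using val_right[of i j 1 x] val_left[of i 0 1 x] that n012 assms(4) by simp
  show ?thesis
  proof (cases "i = 1")
    case True
    define k :: nat where "k = (if j = 0 then 2 else 0)"
    have k: "k < n" "k \<noteq> 1" "k \<noteq> j" using n012 by (auto simp: k_def)
    have "val i j x = val k j x"
      by (rule val_left[OF assms(1) k(1) assms(2,3) k(3) assms(4)])
    also have "\<dots> = val 0 1 x" by (rule *[OF k(1) assms(2) k(3,2)])
    finally show ?thesis .
  next
    case False
    then show ?thesis using *[OF assms(1-3)] by blast
  qed
qed

text \<open>The vector is a combination of \<open>e 0 - x e 1\<close> and \<open>e 2\<close>, and
  also of \<open>e 0 - y e 2\<close> and \<open>e 1\<close>. Each description fixes one of the two
  coefficient ratios.\<close>

lemma triple_image:
  assumes "x \<in> X" "y \<in> X"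
  shows "\<exists>a>0. g (e 0 - x *\<^sub>R e 1 - y *\<^sub>R e 2) = a *\<^sub>R (E 0 - val 0 1 x *\<^sub>R E 1 - val 0 1 y *\<^sub>R E 2)"
proof -
  let ?w = "e 0 - x *\<^sub>R e 1 - y *\<^sub>R e 2"
  obtain a1 where a1: "a1 > 0" "g (e 0 - x *\<^sub>R e 1) = a1 *\<^sub>R (E 0 - val 0 1 x *\<^sub>R E 1)"
    using val[of 0 1 x] assms n012 by auto
  obtain a2 where a2: "a2 > 0" "g (e 0 - y *\<^sub>R e 2) = a2 *\<^sub>R (E 0 - val 0 1 y *\<^sub>R E 2)"
    using val[of 0 2 y] val_eq[of 0 2 y] assms n012 by auto
  obtain s1 where s1: "s1 > 0" "g (e 1) = s1 *\<^sub>R E 1" using E n012 by blast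
  obtain s2 where s2: "s2 > 0" "g (e 2) = s2 *\<^sub>R E 2" using E n012 by blast
  have "?w = (e 0 - x *\<^sub>R e 1) + (- y) *\<^sub>R e 2" by simp
  then obtain a b where ab: "g ?w = a *\<^sub>R g (e 0 - x *\<^sub>R e 1) + b *\<^sub>R g (e 2)" "a > 0"
    by (rule transfer_2_pos[OF _ R_triple R_pair[of 0 1] R_e[of 2] \<psi>(1)[of 0] \<psi>(1)[of 2]])
      (use assms n012 in \<open>auto simp: \<psi>_simps\<close>)
  have "?w = (e 0 - y *\<^sub>R e 2) + (- x) *\<^sub>R e 1" by simp
  then obtain c d where cd: "g ?w = c *\<^sub>R g (e 0 - y *\<^sub>R e 2) + d *\<^sub>R g (e 1)" "c > 0"
    by (rule transfer_2_pos[OF _ R_triple R_pair[of 0 2] R_e[of 1] \<psi>(1)[of 0] \<psi>(1)[of 1]])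
      (use assms n012 in \<open>auto simp: \<psi>_simps\<close>)
  have eq: "a *\<^sub>R a1 *\<^sub>R (E 0 - val 0 1 x *\<^sub>R E 1) + b *\<^sub>R s2 *\<^sub>R E 2
      = c *\<^sub>R a2 *\<^sub>R (E 0 - val 0 1 y *\<^sub>R E 2) + d *\<^sub>R s1 *\<^sub>R E 1"
    using ab(1) cd(1) unfolding a1(2) a2(2) s1(2) s2(2) by simp
  from arg_cong[OF eq, of "\<phi> 0"] arg_cong[OF eq, of "\<phi> 2"]
  have 1: "a * a1 = c * a2" "b * s2 = - (c * a2 * val 0 1 y)"
    using n012 by (simp_all add: \<phi>_simps)
  have "g ?w = (a * a1) *\<^sub>R (E 0 - val 0 1 x *\<^sub>R E 1) + (b * s2) *\<^sub>R E 2"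
    using ab(1) unfolding a1(2) s2(2) by simp
  also have "\<dots> = (a * a1) *\<^sub>R (E 0 - val 0 1 x *\<^sub>R E 1 - val 0 1 y *\<^sub>R E 2)"
    unfolding 1(2) 1(1)[symmetric] by (simp add: algebra_simps)
  finally show ?thesis using ab(2) a1(1) by (intro exI[of _ "a * a1"]) simp
qed

text \<open>Adding \<open>y (e 2 - e 1)\<close> to the triple vector moves the parameter
  \<open>y\<close> from \<open>e 2\<close> to \<open>e 1\<close>. By \<open>val_1\<close> the image
  of \<open>e 2 - e 1\<close> still has opposite coefficients, so the parameters add.\<close>

lemma val_add:
  assumes "x \<in> X" "y \<in> X" "x + y \<in> X"
  shows "val 0 1 (x + y) = val 0 1 x + val 0 1 y"
proof -
  let ?w = "e 0 - x *\<^sub>R e 1 - y *\<^sub>R e 2"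
  obtain a1 where a1: "a1 > 0" "g ?w = a1 *\<^sub>R (E 0 - val 0 1 x *\<^sub>R E 1 - val 0 1 y *\<^sub>R E 2)"
    using triple_image assms by blast
  obtain a2 where a2: "a2 > 0" "g (e 2 - 1 *\<^sub>R e 1) = a2 *\<^sub>R (E 2 - E 1)"
    using val[of 2 1 1] val_1[of 2 1] X01 n012 by auto
  obtain a3 where a3: "a3 > 0" "g (e 0 - (x + y) *\<^sub>R e 1) = a3 *\<^sub>R (E 0 - val 0 1 (x + y) *\<^sub>R E 1)"
    using val[of 0 1 "x + y"] assms n012 by auto
  have "e 0 - (x + y) *\<^sub>R e 1 = ?w + y *\<^sub>R (e 2 - 1 *\<^sub>R e 1)" by (simp add: algebra_simps)
  then obtain a b where ab: "g (e 0 - (x + y) *\<^sub>R e 1) = a *\<^sub>R g ?w + b *\<^sub>R g (e 2 - 1 *\<^sub>R e 1)" "a > 0"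
    by (rule transfer_2_pos[OF _ R_pair[of 0 1] R_triple R_pair[of 2 1] \<psi>(1)[of 0] \<psi>(1)[of 2]])
      (use assms X01 n012 in \<open>auto simp: \<psi>_simps\<close>)
  note eq = ab(1)[unfolded a1 a2 a3]
  from arg_cong[OF eq, of "\<phi> 0"] arg_cong[OF eq, of "\<phi> 1"] arg_cong[OF eq, of "\<phi> 2"]
  have "a3 = a * a1" "a3 * val 0 1 (x + y) = a * a1 * val 0 1 x + b * a2" "b * a2 = a * a1 * val 0 1 y"
    using n012 by (simp_all add: \<phi>_simps)
  then have "a3 * val 0 1 (x + y) = a3 * (val 0 1 x + val 0 1 y)" by (simp add: algebra_simps)
  then show ?thesis using a3(1) by simp
qed

text \<open>The two vectors differ by \<open>(y - x) e 1\<close>, and the sign of this coefficient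
  is transferred.\<close>

lemma val_less:
  assumes "x \<in> X" "y \<in> X" "x < y"
  shows "val 0 1 x < val 0 1 y"
proof -
  obtain a1 where a1: "a1 > 0" "g (e 0 - x *\<^sub>R e 1) = a1 *\<^sub>R (E 0 - val 0 1 x *\<^sub>R E 1)"
    using val[of 0 1 x] assms n012 by auto
  obtain a2 where a2: "a2 > 0" "g (e 0 - y *\<^sub>R e 1) = a2 *\<^sub>R (E 0 - val 0 1 y *\<^sub>R E 1)"
    using val[of 0 1 y] assms n012 by auto
  obtain s where s: "s > 0" "g (e 1) = s *\<^sub>R E 1" using E n012 by blast
  have "e 0 - x *\<^sub>R e 1 = (e 0 - y *\<^sub>R e 1) + (y - x) *\<^sub>R e 1" by (simp add: algebra_simps)
  then obtain a b where ab: "g (e 0 - x *\<^sub>R e 1) = a *\<^sub>R g (e 0 - y *\<^sub>R e 1) + b *\<^sub>R g (e 1)" "a > 0"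
      "sgn b = sgn (y - x)"
    by (rule transfer_2_pos[OF _ R_pair[of 0 1] R_pair[of 0 1] R_e[of 1] \<psi>(1)[of 0] \<psi>(1)[of 1]])
      (use assms n012 in \<open>auto simp: \<psi>_simps\<close>)
  note eq = ab(1)[unfolded a1 a2 s]
  from arg_cong[OF eq, of "\<phi> 0"] arg_cong[OF eq, of "\<phi> 1"]
  have 1: "a1 = a * a2" "a1 * val 0 1 x = a * a2 * val 0 1 y - b * s"
    using n012 by (simp_all add: \<phi>_simps)
  have "b > 0" using ab(3) assms(3) by (simp add: sgn_if split: if_splits)
  then have "a1 * val 0 1 x < a1 * val 0 1 y" using 1 s(1) by simp
  then show ?thesis using a1(1) by simp
qed

lemma val_id:
  assumes "i < n" "j < n" "i \<noteq> j" "x \<in> X"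
  shows "val i j x = x"
proof -
  have "ordered_partial_hom X (val 0 1)"
    unfolding ordered_partial_hom_def
  proof (intro conjI ballI impI)
    show "val 0 1 1 = 1" using val_1 n012 by simp
    fix x y assume xy: "x \<in> X" "y \<in> X"
    show "val 0 1 (x + y) = val 0 1 x + val 0 1 y" if "x + y \<in> X"
      using val_add xy that by blast
    show "val 0 1 x < val 0 1 y" if "x < y" using val_less xy that by blast
    show "val 0 1 (x * y) = val 0 1 x * val 0 1 y" if "x * y \<in> X"
      using val_mult[of 0 1 2 x y] val_eq[of 0 2 "x * y"] val_eq[of 1 2 y] xy that n012 by simp
  qed
  then show ?thesis using X assms(4) val_eq[OF assms] unfolding hom_rigid_def by metis
qed

text \<open>Coordinates are read off one at a time: grouping \<open>e p + a k e k\<close> into one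
  configuration vector makes \<open>r\<close> a combination of an independent family, and the
  transferred relation keeps the ratio of the coefficients at \<open>E p\<close> and
  \<open>E k\<close>. The sign in \<open>- a k \<in> X\<close> comes from the form
  \<open>e i - x e j\<close>.\<close>

lemma general_image:
  assumes r: "r \<in> R" "r = e p + (\<Sum>k\<in>{..<n} - {p}. a k *\<^sub>R e k)" and p: "p < n"
    and a: "\<And>k. k < n \<Longrightarrow> k \<noteq> p \<Longrightarrow> - a k \<in> X"
  shows "\<exists>c>0. g r = c *\<^sub>R (E p + (\<Sum>k\<in>{..<n} - {p}. a k *\<^sub>R E k))"
proof -
  have *: "\<exists>c>0. \<exists>b. g r = c *\<^sub>R (E p + a k *\<^sub>R E k) + (\<Sum>l\<in>{..<n} - {p, k}. b l *\<^sub>R E l)"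
    if k: "k < n" "k \<noteq> p" for k
  proof -
    let ?u = "e p - (- a k) *\<^sub>R e k" and ?L = "{..<n} - {p, k}"
    let ?T = "insert ?u (e ` ?L)"
    have inj: "inj_on e ?L"
      by (rule inj_onI) (metis DiffD1 \<psi>(2) lessThan_iff zero_neq_one)
    have u: "?u \<notin> e ` ?L"
    proof
      assume "?u \<in> e ` ?L"
      then obtain l where "l \<in> ?L" "?u = e l" by blast
      from arg_cong[OF this(2), of "\<psi> p"] this(1) show False
        using p k by (simp add: \<psi>_simps)
    qed
    have T: "(\<Sum>t\<in>?T. c t *\<^sub>R h t) = c ?u *\<^sub>R h ?u + (\<Sum>l\<in>?L. c (e l) *\<^sub>R h (e l))"
      for c and h :: "'a \<Rightarrow> 'c::real_vector"
      using u by (simp add: sum.reindex[OF inj])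
    have ind: "independent_family ?T (\<lambda>r. r)"
      unfolding independent_family_def
    proof (intro allI impI)
      fix c assume "(\<Sum>t\<in>?T. c t *\<^sub>R t) = 0"
      then have 0: "c ?u *\<^sub>R ?u + (\<Sum>l\<in>?L. c (e l) *\<^sub>R e l) = 0" unfolding T .
      have "\<psi> p (c ?u *\<^sub>R ?u + (\<Sum>l\<in>?L. c (e l) *\<^sub>R e l)) = c ?u"
        using p k by (simp add: \<psi>_simps)
      then have cu: "c ?u = 0" unfolding 0 by (simp add: \<psi>_simps)
      have sum0: "(\<Sum>l\<in>?L. c (e l) *\<^sub>R e l) = 0" using 0 cu by simp
      have "c (e l) = 0" if "l \<in> ?L" for l
      proof -
        have "(\<Sum>i\<in>?L. c (e i) * \<psi> l (e i)) = (\<Sum>i\<in>?L. if i = l then c (e l) else 0)"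
          using that by (intro sum.cong) (auto simp: \<psi>(2))
        moreover have "\<psi> l (\<Sum>l\<in>?L. c (e l) *\<^sub>R e l) = (\<Sum>i\<in>?L. c (e i) * \<psi> l (e i))"
          by (simp add: linear_sum[OF \<psi>(1)] linear_cmul[OF \<psi>(1)])
        ultimately show ?thesis using that unfolding sum0 by (simp add: linear_0[OF \<psi>(1)])
      qed
      with cu show "\<forall>t\<in>?T. c t = 0" by blast
    qed
    have sub: "?T \<subseteq> R" using R_pair[OF p k(1) _ a[OF k]] k R_e by auto
    define c where "c t = (if t = ?u then 1 else a (the_inv_into ?L e t))" for t
    have ce: "c (e l) = a l" if "l \<in> ?L" for l
    proof -
      have "e l \<noteq> ?u" using u that by (metis imageI)
      then show ?thesis using that by (simp add: c_def the_inv_into_f_f[OF inj])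
    qed
    have "{..<n} - {p} = insert k ?L" using k by auto
    then have "(\<Sum>i\<in>{..<n} - {p}. a i *\<^sub>R e i) = a k *\<^sub>R e k + (\<Sum>l\<in>?L. a l *\<^sub>R e l)" by simp
    moreover have "(\<Sum>l\<in>?L. c (e l) *\<^sub>R e l) = (\<Sum>l\<in>?L. a l *\<^sub>R e l)"
      by (rule sum.cong[OF refl]) (simp only: ce)
    moreover have "c ?u = 1" by (simp add: c_def)
    ultimately have "r = c ?u *\<^sub>R ?u + (\<Sum>l\<in>?L. c (e l) *\<^sub>R e l)"
      using r(2) by simp
    then have rep: "r = (\<Sum>t\<in>?T. c t *\<^sub>R t)" unfolding T .
    obtain c' where c': "g r = (\<Sum>t\<in>?T. c' t *\<^sub>R g t)" "\<forall>t\<in>?T. sgn (c' t) = sgn (c t)"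
      by (rule representation_transfer[OF R fg gf r(1) sub ind rep])
    have "sgn (c' ?u) = 1" using c'(2) by (simp add: c_def)
    then have "c' ?u > 0" by (simp only: sgn_1_pos)
    obtain q where q: "q > 0" "g ?u = q *\<^sub>R (E p + a k *\<^sub>R E k)"
      using val[OF p k(1) _ a[OF k]] val_id[OF p k(1) _ a[OF k]] k by auto
    have "\<forall>i\<in>{..<n}. \<exists>s. g (e i) = s *\<^sub>R E i" using E by blast
    from bchoice[OF this] obtain s where s: "\<And>i. i < n \<Longrightarrow> g (e i) = s i *\<^sub>R E i" by blast
    have "(\<Sum>l\<in>?L. c' (e l) *\<^sub>R g (e l)) = (\<Sum>l\<in>?L. (c' (e l) * s l) *\<^sub>R E l)"
      by (rule sum.cong[OF refl]) (simp add: s)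
    then have "g r = (c' ?u * q) *\<^sub>R (E p + a k *\<^sub>R E k) + (\<Sum>l\<in>?L. (c' (e l) * s l) *\<^sub>R E l)"
      unfolding c'(1) T q(2) by simp
    then show ?thesis using mult_pos_pos[OF \<open>c' ?u > 0\<close> q(1)]
      by (intro exI[of _ "c' ?u * q"] conjI exI[of _ "\<lambda>l. c' (e l) * s l"])
  qed
  have \<phi>p: "\<phi> p (g r) > 0 \<and> \<phi> k (g r) = a k * \<phi> p (g r)" if k: "k < n" "k \<noteq> p" for k
  proof -
    obtain c b where cb: "c > 0" "g r = c *\<^sub>R (E p + a k *\<^sub>R E k) + (\<Sum>l\<in>{..<n} - {p, k}. b l *\<^sub>R E l)"
      using *[OF k] by (elim exE conjE) (rule that)
    have "\<phi> p (g r) = c" "\<phi> k (g r) = a k * c"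
      unfolding cb(2) using p k by (simp_all add: \<phi>_simps)
    then show ?thesis using cb(1) by simp
  qed
  \<comment> \<open>A single grouping already shows that \<open>g r\<close> is a combination of the
    \<open>E i\<close>; the ratios then give all its coefficients.\<close>
  define k0 :: nat where "k0 = (if p = 0 then 1 else 0)"
  have k0: "k0 < n" "k0 \<noteq> p" using n012 by (auto simp: k0_def)
  obtain c b where cb: "c > 0" "g r = c *\<^sub>R (E p + a k0 *\<^sub>R E k0) + (\<Sum>l\<in>{..<n} - {p, k0}. b l *\<^sub>R E l)"
    using *[OF k0] by (elim exE conjE) (rule that)
  have "b l = a l * \<phi> p (g r)" if "l \<in> {..<n} - {p, k0}" for l
  proof -
    have "(\<Sum>i\<in>{..<n} - {p, k0}. b i * \<phi> l (E i)) = (\<Sum>i\<in>{..<n} - {p, k0}. if i = l then b l else 0)"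
      using that by (intro sum.cong) (auto simp: \<phi>(2))
    then have "\<phi> l (g r) = b l"
      unfolding cb(2) using that p k0 by (simp add: \<phi>_simps)
    then show ?thesis using \<phi>p[of l] that by simp
  qed
  moreover have "\<phi> p (g r) = c"
    unfolding cb(2) using p k0 by (simp add: \<phi>_simps)
  ultimately have b: "b l = a l * c" if "l \<in> {..<n} - {p, k0}" for l using that by simp
  have "{..<n} - {p} = insert k0 ({..<n} - {p, k0})" using k0 by auto
  then have "(\<Sum>k\<in>{..<n} - {p}. a k *\<^sub>R E k) = a k0 *\<^sub>R E k0 + (\<Sum>l\<in>{..<n} - {p, k0}. a l *\<^sub>R E l)"
    by simp
  moreover have "(\<Sum>l\<in>{..<n} - {p, k0}. b l *\<^sub>R E l) = (\<Sum>l\<in>{..<n} - {p, k0}. c *\<^sub>R a l *\<^sub>R E l)"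
    by (rule sum.cong[OF refl]) (simp only: b scaleR_scaleR mult.commute)
  ultimately have "g r = c *\<^sub>R (E p + (\<Sum>k\<in>{..<n} - {p}. a k *\<^sub>R E k))"
    unfolding cb(2) by (simp add: scaleR_add_right scaleR_sum_right)
  then show ?thesis using cb(1) by (intro exI conjI)
qed

end

context von_staudt_configuration
begin

text \<open>Each \<open>g (e j)\<close> with \<open>j > 0\<close> is rescaled so that the image of
  \<open>e 0 - e j\<close> becomes proportional to \<open>E 0 - E j\<close>, while
  \<open>E 0\<close> is \<open>g (e 0)\<close>. This uses up the freedom of positive diagonal maps,
  apart from a common factor.\<close>

lemma normalization:
  obtains E val \<phi> where "normalized_configuration n e X R g \<psi> E val \<phi>"
proof -
  have "\<forall>j. \<exists>s. j < n \<longrightarrow> s > 0 \<and> (j \<noteq> 0 \<longrightarrow>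
      (\<exists>a>0. g (e 0 - 1 *\<^sub>R e j) = a *\<^sub>R (g (e 0) - s *\<^sub>R g (e j))))" (is "\<forall>j. ?P j")
  proof
    fix j show "?P j"
    proof (cases "j < n \<and> j \<noteq> 0")
      case True
      then obtain a b where ab: "g (e 0 - 1 *\<^sub>R e j) = a *\<^sub>R g (e 0) - b *\<^sub>R g (e j)" "a > 0" "sgn b = sgn 1"
        using pair_image[of 0 j 1] n012 X01 by auto
      have "g (e 0 - 1 *\<^sub>R e j) = a *\<^sub>R (g (e 0) - (b / a) *\<^sub>R g (e j))"
        using ab(2) unfolding ab(1) by (simp add: scaleR_diff_right)
      moreover have "b / a > 0" using ab(2,3) by (simp add: sgn_1_pos)
      ultimately show ?thesis using ab(2) by blast
    qed (auto intro: exI[of _ 1])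
  qed
  from choice[OF this] obtain s where s: "\<And>j. j < n \<Longrightarrow> s j > 0"
    "\<And>j. j < n \<Longrightarrow> j \<noteq> 0 \<Longrightarrow> \<exists>a>0. g (e 0 - 1 *\<^sub>R e j) = a *\<^sub>R (g (e 0) - s j *\<^sub>R g (e j))" by blast
  define t where "t j = (if j = 0 then 1 else s j)" for j
  define E where "E j = t j *\<^sub>R g (e j)" for j
  have t: "t j > 0" if "j < n" for j using s(1)[OF that] by (simp add: t_def)
  have gE: "g (e j) = inverse (t j) *\<^sub>R E j" if "j < n" for j
    using t[OF that] by (simp add: E_def)
  have Eind: "independent_family {..<n} E"
    unfolding independent_family_def
  proof (intro allI impI ballI)
    fix c i assume "(\<Sum>j<n. c j *\<^sub>R E j) = 0" and i: "i \<in> {..<n}"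
    then have "(\<Sum>j<n. (c j * t j) *\<^sub>R g (e j)) = 0" by (simp add: E_def)
    from independent_familyD[OF independent_g this i] show "c i = 0" using t[of i] i by simp
  qed
  obtain \<phi> :: "nat \<Rightarrow> 'b \<Rightarrow> real" where \<phi>: "\<And>i. linear (\<phi> i)"
    "\<And>i j. i \<in> {..<n} \<Longrightarrow> j \<in> {..<n} \<Longrightarrow> \<phi> i (E j) = (if i = j then 1 else 0)"
    using dual_family[OF _ Eind] by blast
  have "\<exists>y. (\<exists>a>0. g (e i - x *\<^sub>R e j) = a *\<^sub>R (E i - y *\<^sub>R E j)) \<and> sgn y = sgn x \<and> (i = 0 \<and> x = 1 \<longrightarrow> y = 1)"
    if ij: "i < n" "j < n" "i \<noteq> j" "x \<in> X" for i j x
  proof (cases "i = 0 \<and> x = 1")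
    case True
    then show ?thesis using s(2)[of j] ij by (auto simp: E_def t_def)
  next
    case False
    obtain a b where ab: "g (e i - x *\<^sub>R e j) = a *\<^sub>R g (e i) - b *\<^sub>R g (e j)" "a > 0" "sgn b = sgn x"
      using pair_image[OF ij] by blast
    \<comment> \<open>Obtained by writing \<open>g (e i)\<close> and \<open>g (e j)\<close> in terms
      of \<open>E\<close> and factoring out \<open>a / t i\<close>.\<close>
    define y where "y = b * t i / (a * t j)"
    have "g (e i - x *\<^sub>R e j) = (a / t i) *\<^sub>R (E i - y *\<^sub>R E j)"
      using ab(2) t[OF ij(1)] t[OF ij(2)] ij unfolding ab(1) by (simp add: gE y_def scaleR_diff_right field_simps)
    moreover have "a / t i > 0" using ab(2) t[OF ij(1)] by simp
    moreover have "sgn y = sgn x" using ab(2,3) t[of i] t[of j] ij by (simp add: y_def sgn_mult sgn_divide)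
    ultimately show ?thesis using False by blast
  qed
  then have "\<forall>p. \<exists>y. fst p < n \<longrightarrow> fst (snd p) < n \<longrightarrow> fst p \<noteq> fst (snd p) \<longrightarrow> snd (snd p) \<in> X \<longrightarrow>
      (\<exists>a>0. g (e (fst p) - snd (snd p) *\<^sub>R e (fst (snd p))) = a *\<^sub>R (E (fst p) - y *\<^sub>R E (fst (snd p))))
      \<and> sgn y = sgn (snd (snd p)) \<and> (fst p = 0 \<and> snd (snd p) = 1 \<longrightarrow> y = 1)"
    (is "\<forall>p. \<exists>y. ?Q p y") by meson
  from choice[OF this] obtain v where v0: "\<forall>p. ?Q p (v p)" ..
  have v: "i < n \<Longrightarrow> j < n \<Longrightarrow> i \<noteq> j \<Longrightarrow> x \<in> X \<Longrightarrow>
      (\<exists>a>0. g (e i - x *\<^sub>R e j) = a *\<^sub>R (E i - v (i, j, x) *\<^sub>R E j))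
      \<and> sgn (v (i, j, x)) = sgn x \<and> (i = 0 \<and> x = 1 \<longrightarrow> v (i, j, x) = 1)" for i j x
    using spec[OF v0, of "(i, j, x)"] unfolding fst_conv snd_conv by blast
  have "normalized_configuration n e X R g \<psi> E (\<lambda>i j x. v (i, j, x)) \<phi>"
  proof
    show "\<exists>s>0. g (e i) = s *\<^sub>R E i" if "i < n" for i
      using gE[OF that] t[OF that] by (metis positive_imp_inverse_positive)
    show "v (0, j, 1) = 1" if "j < n" "0 \<noteq> j" for j
      using v[of 0 j 1] that n012 X01 by simp
  qed (use v \<phi> in \<open>simp_all add: linear_add linear_cmul\<close>)
  then show ?thesis by (rule that)
qed

text \<open>A positive factor at each \<open>r\<close> must be allowed, since conformal covering
  does not see such factors. The third alternative accommodates the base vertices, whose coordinates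
  are parameters up to sign.\<close>

theorem linear_up_to_scaling:
  assumes cases: "\<And>r. r \<in> R \<Longrightarrow>
      (\<exists>i j x. i < n \<and> j < n \<and> i \<noteq> j \<and> x \<in> X \<and> r = e i - x *\<^sub>R e j) \<or>
      (\<exists>x y. x \<in> X \<and> y \<in> X \<and> r = e 0 - x *\<^sub>R e 1 - y *\<^sub>R e 2) \<or>
      (\<exists>p a. p < n \<and> r = e p + (\<Sum>k\<in>{..<n} - {p}. a k *\<^sub>R e k) \<and> (\<forall>k<n. k \<noteq> p \<longrightarrow> - a k \<in> X))"
  obtains M where "linear M" "independent_family {..<n} (\<lambda>i. M (e i))"
    "\<forall>r\<in>R. \<exists>c>0. g r = c *\<^sub>R M r"
proof -
  obtain E val \<phi> where "normalized_configuration n e X R g \<psi> E val \<phi>"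
    by (rule normalization)
  then interpret normalized_configuration n e X R g \<psi> E val \<phi> .
  define M where "M x = (\<Sum>i<n. \<psi> i x *\<^sub>R E i)" for x
  have linM: "linear M"
    unfolding M_def
    by (intro linear_compose_sum ballI linearI)
      (simp_all add: \<psi>_simps scaleR_add_left)
  have Me: "M (e j) = E j" if "j < n" for j
  proof -
    have "M (e j) = (\<Sum>i<n. if i = j then E j else 0)"
      unfolding M_def using that by (intro sum.cong) (auto simp: \<psi>(2))
    then show ?thesis using that by simp
  qed
  have "independent_family {..<n} (\<lambda>i. M (e i))"
    unfolding independent_family_def
  proof (intro allI impI ballI)
    fix c i assume c: "(\<Sum>t<n. c t *\<^sub>R M (e t)) = 0" and i: "i \<in> {..<n}"
    have "c i = (\<Sum>t<n. if t = i then c i else 0)" using i by simp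
    also have "\<dots> = (\<Sum>t<n. c t * \<phi> i (M (e t)))"
      using i by (intro sum.cong) (auto simp: Me \<phi>(2))
    also have "\<dots> = \<phi> i (\<Sum>t<n. c t *\<^sub>R M (e t))"
      by (simp add: linear_sum[OF \<phi>(1)] linear_cmul[OF \<phi>(1)])
    finally show "c i = 0" using c by (simp add: linear_0[OF \<phi>(1)])
  qed
  moreover have "\<exists>c>0. g r = c *\<^sub>R M r" if r: "r \<in> R" for r
    using cases[OF r]
  proof (elim disjE exE conjE)
    fix i j x assume ij: "i < n" "j < n" "i \<noteq> j" "x \<in> X" and r: "r = e i - x *\<^sub>R e j"
    have "M r = E i - x *\<^sub>R E j"
      unfolding r using linM ij by (simp add: linear_diff linear_cmul Me)
    then show ?thesis using val[OF ij] val_id[OF ij] r by simp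
  next
    fix x y assume xy: "x \<in> X" "y \<in> X" and r: "r = e 0 - x *\<^sub>R e 1 - y *\<^sub>R e 2"
    have "M r = E 0 - x *\<^sub>R E 1 - y *\<^sub>R E 2"
      unfolding r using linM n012 by (simp add: linear_diff linear_cmul Me)
    then show ?thesis
      using triple_image[OF xy] val_id[of 0 1 x] val_id[of 0 1 y] xy n012 r by simp
  next
    fix p a assume p: "p < n" and req: "r = e p + (\<Sum>k\<in>{..<n} - {p}. a k *\<^sub>R e k)"
      and a: "\<forall>k<n. k \<noteq> p \<longrightarrow> - a k \<in> X"
    have "M r = E p + (\<Sum>k\<in>{..<n} - {p}. a k *\<^sub>R E k)"
      unfolding req using linM p by (simp add: linear_add linear_sum linear_cmul Me)
    then show ?thesis using general_image[OF r req p] a by simp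
  qed
  ultimately show ?thesis using that linM by blast
qed

end

section \<open>Faces of polytopes and linear dependencies\<close>

text \<open>Splitting off \<open>j\<close> writes the point as \<open>(1 - s) x j + s q\<close> with
  \<open>q\<close> the renormalized rest. Unless this degenerates, the point is interior to a
  segment in \<open>C\<close>, whose ends then lie in the face.\<close>

lemma face_of_contains_support:
  assumes F: "F face_of C" and C: "convex C" and I: "finite I" "x ` I \<subseteq> C"
    and u: "\<And>i. i \<in> I \<Longrightarrow> u i \<ge> 0" "(\<Sum>i\<in>I. u i) = 1" "(\<Sum>i\<in>I. u i *\<^sub>R x i) \<in> F"
    and j: "j \<in> I" "u j > 0"
  shows "x j \<in> F"
proof -
  define p where "p = (\<Sum>i\<in>I. u i *\<^sub>R x i)"
  define s where "s = (\<Sum>i\<in>I - {j}. u i)"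
  have s: "u j + s = 1" using u(2) I(1) j(1) by (simp add: s_def sum.remove)
  have p: "p = u j *\<^sub>R x j + (\<Sum>i\<in>I - {j}. u i *\<^sub>R x i)"
    using I(1) j(1) by (simp add: p_def sum.remove)
  have s0: "s \<ge> 0" unfolding s_def using u(1) by (intro sum_nonneg) auto
  show ?thesis
  proof (cases "s = 0")
    case True
    then have "\<forall>i\<in>I - {j}. u i = 0"
      unfolding s_def using I(1) u(1) by (subst (asm) sum_nonneg_eq_0_iff) auto
    then have "p = x j" using p s True by simp
    then show ?thesis using u(3) by (simp add: p_def)
  next
    case False
    then have sp: "s > 0" using s0 by simp
    define q where "q = (\<Sum>i\<in>I - {j}. (u i / s) *\<^sub>R x i)"
    have "q \<in> C"
      unfolding q_def
    proof (rule convex_sum)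
      show "(\<Sum>i\<in>I - {j}. u i / s) = 1"
        using sp by (simp add: s_def sum_divide_distrib[symmetric])
    qed (use I C u(1) sp in auto)
    have "s *\<^sub>R q = (\<Sum>i\<in>I - {j}. u i *\<^sub>R x i)"
      using sp by (simp add: q_def scaleR_sum_right)
    moreover have "u j = 1 - s" using s by simp
    ultimately have pq: "p = (1 - s) *\<^sub>R x j + s *\<^sub>R q" using p by simp
    show ?thesis
    proof (cases "x j = q")
      case True
      then have "p = x j" using pq by (simp add: scaleR_left_distrib[symmetric])
      then show ?thesis using u(3) by (simp add: p_def)
    next
      case False
      have "p \<in> open_segment (x j) q"
        unfolding in_segment using False pq sp s j(2) by (intro conjI exI[of _ s]) auto
      then show ?thesis
        using face_ofD[OF F _ _ \<open>q \<in> C\<close>] u(3) I(2) j(1) by (auto simp: p_def)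
    qed
  qed
qed

text \<open>The weights live on indices, so \<open>x\<close> need not be injective.\<close>

lemma in_convex_hull_image:
  assumes "finite I" "p \<in> convex hull (x ` I)"
  obtains u where "\<forall>i\<in>I. u i \<ge> 0" "(\<Sum>i\<in>I. u i) = 1" "p = (\<Sum>i\<in>I. u i *\<^sub>R x i)"
  using assms
proof (induction I arbitrary: p thesis rule: finite_induct)
  case (insert j I)
  show ?case
  proof (cases "I = {}")
    case True
    then show ?thesis using insert.prems by (intro insert.prems(1)[of "\<lambda>_. 1"]) auto
  next
    case False
    then obtain a b q where ab: "a \<ge> 0" "b \<ge> 0" "a + b = 1" "q \<in> convex hull (x ` I)"
      "p = a *\<^sub>R x j + b *\<^sub>R q"
      using insert.prems(2) by (auto simp: convex_hull_insert)
    obtain u where u: "\<forall>i\<in>I. u i \<ge> 0" "(\<Sum>i\<in>I. u i) = 1" "q = (\<Sum>i\<in>I. u i *\<^sub>R x i)"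
      using insert.IH[OF _ ab(4)] by blast
    define v where "v i = (if i = j then a else b * u i)" for i
    have "(\<Sum>i\<in>I. v i) = (\<Sum>i\<in>I. b * u i)"
      using insert.hyps by (intro sum.cong) (auto simp: v_def)
    then have "(\<Sum>i\<in>I. v i) = b" using u(2) by (simp add: sum_distrib_left[symmetric])
    moreover have "(\<Sum>i\<in>I. v i *\<^sub>R x i) = b *\<^sub>R q"
      unfolding u(3) scaleR_sum_right using insert.hyps by (intro sum.cong) (auto simp: v_def)
    ultimately show ?thesis
      using insert.hyps ab u(1) by (intro insert.prems(1)[of v]) (auto simp: v_def)
  qed
qed simp

text \<open>Discarding points in the hull of the others does not change the hull; when none can be
  discarded, every remaining point is extreme.\<close>

lemma convex_hull_extreme_points:
  assumes "finite S"
  shows "convex hull {v. v extreme_point_of convex hull S} = convex hull S"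
  using assms
proof (induction "card S" arbitrary: S rule: less_induct)
  case less
  show ?case
  proof (cases "\<exists>a\<in>S. a \<in> convex hull (S - {a})")
    case True
    then obtain a where a: "a \<in> S" "a \<in> convex hull (S - {a})" by blast
    then have eq: "convex hull (S - {a}) = convex hull S"
      by (metis hull_redundant insert_Diff)
    have "card (S - {a}) < card S" using a(1) less.prems by (rule card_Diff1_less[rotated])
    from less.hyps[OF this] less.prems eq show ?thesis by simp
  next
    case False
    have "a extreme_point_of convex hull S" if "a \<in> S" for a
      using extreme_point_of_convex_hull_insert[of "S - {a}" a] False less.prems that
      by (simp add: insert_absorb)
    then have "{v. v extreme_point_of convex hull S} = S"
      using extreme_point_of_convex_hull by blast
    then show ?thesis by simp
  qed
qed

lemma face_of_convex_hull_eq: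
  assumes V: "finite V" and F: "F face_of convex hull V"
  shows "F = convex hull (V \<inter> F)"
proof
  show "convex hull (V \<inter> F) \<subseteq> F"
    using face_of_imp_convex[OF F] by (intro hull_minimal) auto
  show "F \<subseteq> convex hull (V \<inter> F)"
  proof
    fix p assume p: "p \<in> F"
    have "p \<in> convex hull ((\<lambda>v. v) ` V)" using face_of_imp_subset[OF F] p by auto
    then obtain u where u: "\<forall>v\<in>V. u v \<ge> 0" "(\<Sum>v\<in>V. u v) = 1" "p = (\<Sum>v\<in>V. u v *\<^sub>R v)"
      by (rule in_convex_hull_image[OF V])
    have z: "u v = 0" if "v \<in> V" "v \<notin> F" for v
    proof (rule ccontr)
      assume "u v \<noteq> 0"
      then have "u v > 0" using u(1) that by (simp add: order_less_le)
      have "v \<in> F"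
        by (rule face_of_contains_support[OF F _ V, of "\<lambda>v. v" u])
          (use u p that \<open>u v > 0\<close> hull_subset[of V convex] in auto)
      then show False using that by simp
    qed
    have sums: "(\<Sum>v\<in>V \<inter> F. u v) = (\<Sum>v\<in>V. u v)" "(\<Sum>v\<in>V \<inter> F. u v *\<^sub>R v) = (\<Sum>v\<in>V. u v *\<^sub>R v)"
      by (rule sum.mono_neutral_left, use V z in force, blast, use z in force)+
    show "p \<in> convex hull (V \<inter> F)"
      unfolding u(3) sums(2)[symmetric]
      by (rule convex_sum) (use V u sums(1) in \<open>auto intro: hull_inc\<close>)
  qed
qed

text \<open>
  For \<open>w i = (x i, 1)\<close> this says that the affine hull of \<open>x ` S\<close> misses the convex
  hull of the other points.
\<close>

definition facial :: "'i set \<Rightarrow> ('i \<Rightarrow> 'a::real_vector) \<Rightarrow> 'i set \<Rightarrow> bool" where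
  "facial I w S \<longleftrightarrow> (\<forall>l. (\<Sum>i\<in>I. l i *\<^sub>R w i) = 0 \<longrightarrow> (\<forall>i\<in>I - S. l i \<ge> 0) \<longrightarrow> (\<forall>i\<in>I - S. l i = 0))"

lemma facialD:
  "facial I w S \<Longrightarrow> (\<Sum>i\<in>I. l i *\<^sub>R w i) = 0 \<Longrightarrow> (\<And>i. i \<in> I - S \<Longrightarrow> l i \<ge> 0) \<Longrightarrow> i \<in> I - S \<Longrightarrow> l i = 0"
  unfolding facial_def by blast

lemma sum_lift:
  "(\<Sum>i\<in>I. l i *\<^sub>R (x i, 1::real)) = (\<Sum>i\<in>I. l i *\<^sub>R x i, \<Sum>i\<in>I. l i)"
  by (induction I rule: infinite_finite_induct) (auto simp: zero_prod_def)

text \<open>A point common to the affine hull and to the hull of the remaining points, written in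
  both ways and subtracted, is a dependency that is nonnegative and of total weight one off
  \<open>S\<close>.\<close>

lemma face_of_if_facial:
  assumes I: "finite I" and x: "inj_on x I" and S: "S \<subseteq> I" and fac: "facial I (\<lambda>i. (x i, 1::real)) S"
  shows "convex hull (x ` S) face_of convex hull (x ` I)"
proof (rule face_of_convex_hulls)
  show "affine hull x ` S \<inter> convex hull (x ` I - x ` S) = {}"
  proof (rule ccontr)
    assume "affine hull x ` S \<inter> convex hull (x ` I - x ` S) \<noteq> {}"
    then obtain p where p: "p \<in> affine hull x ` S" "p \<in> convex hull (x ` I - x ` S)" by blast
    have "x ` I - x ` S = x ` (I - S)" using x S by (simp add: inj_on_image_set_diff)
    then have "p \<in> convex hull (x ` (I - S))" using p(2) by simp
    then obtain u where u: "\<forall>i\<in>I - S. u i \<ge> 0" "(\<Sum>i\<in>I - S. u i) = 1" "p = (\<Sum>i\<in>I - S. u i *\<^sub>R x i)"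
      by (rule in_convex_hull_image[OF finite_Diff[OF I]])
    have finS: "finite S" using I S finite_subset by blast
    have injS: "inj_on x S" using x S inj_on_subset by blast
    obtain v where v: "(\<Sum>y\<in>x ` S. v y) = 1" "p = (\<Sum>y\<in>x ` S. v y *\<^sub>R y)"
      using p(1) finS by (auto simp: affine_hull_finite)
    define l where "l i = (if i \<in> S then - v (x i) else u i)" for i
    have split: "(\<Sum>i\<in>I. h i) = (\<Sum>i\<in>I - S. h i) + (\<Sum>i\<in>S. h i)" for h :: "'a \<Rightarrow> 'c::real_vector"
      using sum.subset_diff[OF S I] .
    have a: "(\<Sum>i\<in>I - S. l i *\<^sub>R x i) = p" "(\<Sum>i\<in>I - S. l i) = 1"
      using u(2,3) by (simp_all add: l_def)
    have b: "(\<Sum>i\<in>S. l i *\<^sub>R x i) = - p" "(\<Sum>i\<in>S. l i) = - 1"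
      using v by (simp_all add: l_def sum.reindex[OF injS] sum_negf)
    have "(\<Sum>i\<in>I. l i *\<^sub>R (x i, 1::real)) = 0"
      unfolding sum_lift split a b by (simp add: zero_prod_def)
    then have "l i = 0" if "i \<in> I - S" for i
      by (rule facialD[OF fac]) (use u(1) that in \<open>auto simp: l_def\<close>)
    then show False using a(2) by simp
  qed
qed (use I S in auto)

lemma facial_singletons_imp_inj:
  assumes "finite I" "\<And>i. i \<in> I \<Longrightarrow> facial I (\<lambda>i. (x i, 1::real)) {i}"
  shows "inj_on x I"
proof (rule inj_onI, rule ccontr)
  fix i j assume ij: "i \<in> I" "j \<in> I" "x i = x j" "i \<noteq> j"
  define l where "l k = (if k = i then -1 else if k = j then 1 else (0::real))" for k
  have "(\<Sum>k\<in>I. l k *\<^sub>R (x k, 1::real)) = (\<Sum>k\<in>{i, j}. l k *\<^sub>R (x k, 1::real))"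
    using assms(1) ij by (intro sum.mono_neutral_right) (auto simp: l_def zero_prod_def)
  also have "\<dots> = 0" using ij by (simp add: l_def zero_prod_def)
  finally have "l j = 0"
    by (rule facialD[OF assms(2)[OF ij(1)]]) (use ij in \<open>auto simp: l_def\<close>)
  then show False using ij by (simp add: l_def)
qed

lemma facial_singletons_imp_extreme:
  assumes "finite I" "\<And>i. i \<in> I \<Longrightarrow> facial I (\<lambda>i. (x i, 1::real)) {i}" "i \<in> I"
  shows "x i extreme_point_of convex hull (x ` I)"
  using face_of_if_facial[OF assms(1) facial_singletons_imp_inj[OF assms(1,2)] _ assms(2)[OF assms(3)]]
    assms(3) by (simp add: face_of_singleton)

text \<open>The positive and negative parts of a violating dependency, divided by their common total
  \<open>T\<close>, represent the same point. The negative part is supported in \<open>S\<close>, so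
  the point lies in the face, and hence so does \<open>x j\<close>; being extreme,
  \<open>x j\<close> would be one of the points indexed by \<open>S\<close>.\<close>

lemma facial_if_face_of:
  assumes I: "finite I" and x: "inj_on x I" and ext: "\<And>i. i \<in> I \<Longrightarrow> x i extreme_point_of convex hull (x ` I)"
    and S: "S \<subseteq> I" and F: "convex hull (x ` S) face_of convex hull (x ` I)"
  shows "facial I (\<lambda>i. (x i, 1::real)) S"
  unfolding facial_def
proof (intro allI impI ballI, rule ccontr)
  fix l j assume l: "(\<Sum>i\<in>I. l i *\<^sub>R (x i, 1::real)) = 0" "\<forall>i\<in>I - S. l i \<ge> 0" and j: "j \<in> I - S" "l j \<noteq> 0"
  have lj: "l j > 0" using l(2) j by (simp add: order_less_le)
  define pos where "pos i = max (l i) 0" for i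
  define neg where "neg i = max (- l i) 0" for i
  have l_eq: "l i = pos i - neg i" for i by (simp add: pos_def neg_def)
  have sums: "(\<Sum>i\<in>I. l i *\<^sub>R x i) = 0" "(\<Sum>i\<in>I. l i) = 0"
    using l(1) unfolding sum_lift by (auto simp: zero_prod_def)
  define T where "T = (\<Sum>i\<in>I. pos i)"
  have Tn: "(\<Sum>i\<in>I. neg i) = T"
    using sums(2) by (simp add: l_eq sum_subtractf T_def)
  have pn: "(\<Sum>i\<in>I. pos i *\<^sub>R x i) = (\<Sum>i\<in>I. neg i *\<^sub>R x i)"
    using sums(1) by (simp add: l_eq scaleR_diff_left sum_subtractf)
  have "T > 0"
    unfolding T_def using I j lj by (intro sum_pos2[of _ j]) (auto simp: pos_def)
  have negS: "neg i = 0" if "i \<in> I - S" for i using l(2) that by (simp add: neg_def)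
  have finS: "finite S" using I S finite_subset by blast
  have "(\<Sum>i\<in>S. (neg i / T) *\<^sub>R x i) \<in> convex hull (x ` S)"
  proof (rule convex_sum)
    have "(\<Sum>i\<in>S. neg i) = (\<Sum>i\<in>I. neg i)"
      using I S negS by (intro sum.mono_neutral_left) auto
    then show "(\<Sum>i\<in>S. neg i / T) = 1"
      using \<open>T > 0\<close> Tn by (simp add: sum_divide_distrib[symmetric])
  qed (use finS \<open>T > 0\<close> in \<open>auto simp: neg_def intro: hull_inc\<close>)
  also have "(\<Sum>i\<in>S. (neg i / T) *\<^sub>R x i) = (\<Sum>i\<in>I. (neg i / T) *\<^sub>R x i)"
    using I S negS by (intro sum.mono_neutral_left) auto
  also have "\<dots> = inverse T *\<^sub>R (\<Sum>i\<in>I. neg i *\<^sub>R x i)"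
    by (simp add: scaleR_sum_right divide_inverse mult.commute)
  also have "\<dots> = (\<Sum>i\<in>I. (pos i / T) *\<^sub>R x i)"
    unfolding pn[symmetric] by (simp add: scaleR_sum_right divide_inverse mult.commute)
  finally have "x j \<in> convex hull (x ` S)"
    by (intro face_of_contains_support[OF F convex_convex_hull I, of x "\<lambda>i. pos i / T"])
      (use \<open>T > 0\<close> j lj in \<open>auto simp: pos_def T_def sum_divide_distrib[symmetric] intro: hull_inc\<close>)
  then have "x j extreme_point_of convex hull (x ` S)"
    using extreme_point_of_face[OF F] ext j by blast
  then have "x j \<in> x ` S" by (rule extreme_point_of_convex_hull)
  then show False using x j S by (auto simp: inj_on_def)
qed

section \<open>Combinatorial isomorphisms in terms of facial index sets\<close>

lemma combinatorial_isomorphismD: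
  assumes "combinatorial_isomorphism \<phi> P Q"
  shows "F face_of P \<Longrightarrow> \<phi> F face_of Q"
    and "G face_of Q \<Longrightarrow> \<exists>F. F face_of P \<and> \<phi> F = G"
    and "F face_of P \<Longrightarrow> F' face_of P \<Longrightarrow> F \<subseteq> F' \<longleftrightarrow> \<phi> F \<subseteq> \<phi> F'"
proof -
  have img: "\<phi> ` {F. F face_of P} = {G. G face_of Q}"
    using assms by (simp add: combinatorial_isomorphism_def bij_betw_def)
  show "\<phi> F face_of Q" if "F face_of P"
    using imageI[of F "{F. F face_of P}" \<phi>] that unfolding img by simp
  show "\<exists>F. F face_of P \<and> \<phi> F = G" if "G face_of Q"
  proof -
    have "G \<in> \<phi> ` {F. F face_of P}" unfolding img using that by simp
    then show ?thesis by blast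
  qed
qed (use assms in \<open>simp add: combinatorial_isomorphism_def\<close>)

lemma combinatorial_isomorphism_empty:
  assumes "combinatorial_isomorphism \<phi> P Q"
  shows "\<phi> {} = {}"
proof -
  obtain F where F: "F face_of P" "\<phi> F = {}"
    using combinatorial_isomorphismD(2)[OF assms empty_face_of] by blast
  then show ?thesis using combinatorial_isomorphismD(3)[OF assms empty_face_of F(1)] by simp
qed

lemma combinatorial_isomorphism_inverse:
  assumes "combinatorial_isomorphism \<phi> P Q"
  shows "combinatorial_isomorphism (inv_into {F. F face_of P} \<phi>) Q P"
proof -
  have bij: "bij_betw \<phi> {F. F face_of P} {G. G face_of Q}"
    and mono: "\<And>F G. F face_of P \<Longrightarrow> G face_of P \<Longrightarrow> F \<subseteq> G \<longleftrightarrow> \<phi> F \<subseteq> \<phi> G"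
    using assms by (auto simp: combinatorial_isomorphism_def)
  let ?\<psi> = "inv_into {F. F face_of P} \<phi>"
  have inv: "\<phi> (?\<psi> G) = G" "?\<psi> G face_of P" if "G face_of Q" for G
    using bij_betw_inv_into_right[OF bij, of G] bij_betwE[OF bij_betw_inv_into[OF bij]] that by auto
  have "G \<subseteq> H \<longleftrightarrow> ?\<psi> G \<subseteq> ?\<psi> H" if "G face_of Q" "H face_of Q" for G H
    using mono[OF inv(2)[OF that(1)] inv(2)[OF that(2)]] inv(1) that by simp
  then show ?thesis
    unfolding combinatorial_isomorphism_def using bij_betw_inv_into[OF bij] by simp
qed

text \<open>The image of \<open>{v}\<close> is a nonempty face, so it contains an extreme point
  \<open>w\<close> of \<open>Q\<close>; the preimage of \<open>{w}\<close> is a nonempty face inside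
  \<open>{v}\<close>.\<close>

lemma combinatorial_isomorphism_vertex:
  assumes iso: "combinatorial_isomorphism \<phi> P Q" and Q: "polytope Q" and v: "v extreme_point_of P"
  shows "\<exists>w. w extreme_point_of Q \<and> \<phi> {v} = {w}"
proof -
  note mono = combinatorial_isomorphismD(3)[OF iso]
  have vF: "{v} face_of P" using v by (simp add: face_of_singleton)
  then have \<phi>v: "\<phi> {v} face_of Q" by (rule combinatorial_isomorphismD(1)[OF iso])
  have ne: "\<phi> {v} \<noteq> {}"
    using mono[OF vF empty_face_of] combinatorial_isomorphism_empty[OF iso] by simp
  obtain V where V: "finite V" "Q = convex hull V" using Q by (auto simp: polytope_def)
  let ?W = "{w. w extreme_point_of Q}"
  have W: "finite ?W" "Q = convex hull ?W"
    using V convex_hull_extreme_points[OF V(1)] extreme_points_of_convex_hull[of V]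
    by (auto intro: finite_subset)
  have "\<phi> {v} = convex hull (?W \<inter> \<phi> {v})"
    using face_of_convex_hull_eq[OF W(1)] \<phi>v W(2) by metis
  then have "?W \<inter> \<phi> {v} \<noteq> {}" using ne by (metis convex_hull_eq_empty)
  then obtain w where w: "w extreme_point_of Q" "w \<in> \<phi> {v}" by blast
  then have "{w} face_of Q" by (simp add: face_of_singleton)
  then obtain G where G: "G face_of P" "\<phi> G = {w}"
    using combinatorial_isomorphismD(2)[OF iso] by blast
  have "G \<subseteq> {v}" using mono[OF G(1) vF] G(2) w(2) by simp
  moreover have "G \<noteq> {}" using G(2) combinatorial_isomorphism_empty[OF iso] by auto
  ultimately have "G = {v}" by blast
  then show ?thesis using G(2) w(1) by blast
qed

text \<open>Labelling the vertices of \<open>Q\<close> by \<open>I\<close> reduces the combinatorial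
  hypothesis to equality of facial index sets, the form in which dependencies can be compared. The
  formulas for faces let a projective map be checked on vertices only.\<close>

proposition combinatorial_isomorphism_facial:
  assumes I: "finite I" and single: "\<And>i. i \<in> I \<Longrightarrow> facial I (\<lambda>i. (x i, 1::real)) {i}"
    and Q: "polytope Q" and iso: "combinatorial_isomorphism \<phi> (convex hull (x ` I)) Q"
  obtains y where "Q = convex hull (y ` I)"
    "\<And>S. S \<subseteq> I \<Longrightarrow> facial I (\<lambda>i. (x i, 1::real)) S \<longleftrightarrow> facial I (\<lambda>i. (y i, 1::real)) S"
    "\<And>F. F face_of convex hull (x ` I) \<Longrightarrow> \<phi> F = convex hull (y ` {i \<in> I. x i \<in> F})"
    "\<And>F. F face_of convex hull (x ` I) \<Longrightarrow> F = convex hull (x ` {i \<in> I. x i \<in> F})"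
proof -
  let ?P = "convex hull (x ` I)"
  have bij: "bij_betw \<phi> {F. F face_of ?P} {G. G face_of Q}"
    using iso by (simp add: combinatorial_isomorphism_def)
  note face = combinatorial_isomorphismD(1)[OF iso] and mono = combinatorial_isomorphismD(3)[OF iso]
  have xinj: "inj_on x I" by (rule facial_singletons_imp_inj[OF I single])
  have xext: "x i extreme_point_of ?P" if "i \<in> I" for i
    by (rule facial_singletons_imp_extreme[OF I single that])
  have "\<forall>i\<in>I. \<exists>w. w extreme_point_of Q \<and> \<phi> {x i} = {w}"
    using combinatorial_isomorphism_vertex[OF iso Q] xext by blast
  from bchoice[OF this] obtain y where y: "\<And>i. i \<in> I \<Longrightarrow> y i extreme_point_of Q"
    "\<And>i. i \<in> I \<Longrightarrow> \<phi> {x i} = {y i}" by blast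
  have xF: "{x i} face_of ?P" if "i \<in> I" for i using xext[OF that] by (simp add: face_of_singleton)
  have yF: "y i \<in> \<phi> F \<longleftrightarrow> x i \<in> F" if "i \<in> I" "F face_of ?P" for i F
    using mono[OF xF[OF that(1)] that(2)] y(2)[OF that(1)] by simp
  have yinj: "inj_on y I"
  proof (rule inj_onI)
    fix i j assume ij: "i \<in> I" "j \<in> I" "y i = y j"
    then have "x i = x j" using yF[OF ij(1) xF[OF ij(2)]] y(2)[OF ij(2)] by simp
    then show "i = j" using xinj ij by (auto dest: inj_onD)
  qed
  \<comment> \<open>No vertex of \<open>Q\<close> is missed: apply the vertex correspondence to the
    inverse isomorphism.\<close>
  have ysurj: "w \<in> y ` I" if w: "w extreme_point_of Q" for w
  proof -
    let ?\<psi> = "inv_into {F. F face_of ?P} \<phi>"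
    have "polytope ?P" using I by (auto simp: polytope_def)
    then obtain v where v: "v extreme_point_of ?P" "?\<psi> {w} = {v}"
      using combinatorial_isomorphism_vertex[OF combinatorial_isomorphism_inverse[OF iso] _ w] by blast
    have "\<phi> (?\<psi> {w}) = {w}"
      using w by (intro bij_betw_inv_into_right[OF bij]) (simp add: face_of_singleton)
    then have "\<phi> {v} = {w}" using v(2) by simp
    moreover obtain i where "i \<in> I" "v = x i" using extreme_point_of_convex_hull[OF v(1)] by blast
    ultimately show ?thesis using y(2) by auto
  qed
  have yW: "y ` I = {w. w extreme_point_of Q}" using y(1) ysurj by blast
  obtain V where V: "finite V" "Q = convex hull V" using Q by (auto simp: polytope_def)
  have Qy: "Q = convex hull (y ` I)"
    unfolding yW using convex_hull_extreme_points[OF V(1)] V(2) by simp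
  have yext: "y i extreme_point_of convex hull (y ` I)" if "i \<in> I" for i
    using y(1)[OF that] Qy by simp
  have xhull: "F = convex hull (x ` {i \<in> I. x i \<in> F})" if "F face_of ?P" for F
  proof -
    have "x ` {i \<in> I. x i \<in> F} = x ` I \<inter> F" by auto
    then show ?thesis using face_of_convex_hull_eq[OF _ that] I by simp
  qed
  have yhull: "\<phi> F = convex hull (y ` {i \<in> I. x i \<in> F})" if F: "F face_of ?P" for F
  proof -
    have "\<phi> F face_of convex hull (y ` I)" using face[OF F] Qy by simp
    moreover have "y ` {i \<in> I. x i \<in> F} = y ` I \<inter> \<phi> F" using yF[OF _ F] by auto
    ultimately show ?thesis using face_of_convex_hull_eq[of "y ` I" "\<phi> F"] I by simp
  qed
  \<comment> \<open>A face spanned by the vertices in \<open>S\<close> contains no other vertex,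
    since an extreme point of a hull is one of its generators.\<close>
  have index: "{i \<in> I. z i \<in> convex hull (z ` S)} = S"
    if S: "S \<subseteq> I" and z: "inj_on z I" "\<And>i. i \<in> I \<Longrightarrow> z i extreme_point_of convex hull (z ` I)"
    and F: "convex hull (z ` S) face_of convex hull (z ` I)"
    for S and z :: "'a \<Rightarrow> 'd::real_vector"
  proof
    show "S \<subseteq> {i \<in> I. z i \<in> convex hull (z ` S)}" using S by (auto intro: hull_inc)
    show "{i \<in> I. z i \<in> convex hull (z ` S)} \<subseteq> S"
    proof safe
      fix i assume i: "i \<in> I" "z i \<in> convex hull (z ` S)"
      then have "z i extreme_point_of convex hull (z ` S)"
        using extreme_point_of_face[OF F] z(2) by blast
      then have "z i \<in> z ` S" by (rule extreme_point_of_convex_hull)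
      then show "i \<in> S" using i z(1) S by (auto simp: inj_on_def)
    qed
  qed
  have fac: "facial I (\<lambda>i. (x i, 1::real)) S \<longleftrightarrow> facial I (\<lambda>i. (y i, 1::real)) S" if S: "S \<subseteq> I" for S
  proof
    assume "facial I (\<lambda>i. (x i, 1::real)) S"
    then have F: "convex hull (x ` S) face_of ?P" by (rule face_of_if_facial[OF I xinj S])
    then have "convex hull (y ` S) = \<phi> (convex hull (x ` S))"
      using yhull[OF F] index[OF S xinj xext F] by simp
    moreover have "\<phi> (convex hull (x ` S)) face_of Q" using face[OF F] .
    ultimately show "facial I (\<lambda>i. (y i, 1::real)) S"
      using facial_if_face_of[OF I yinj yext S] Qy by simp
  next
    assume "facial I (\<lambda>i. (y i, 1::real)) S"
    then have G: "convex hull (y ` S) face_of convex hull (y ` I)" by (rule face_of_if_facial[OF I yinj S])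
    then obtain F where F: "F face_of ?P" "\<phi> F = convex hull (y ` S)"
      using combinatorial_isomorphismD(2)[OF iso, of "convex hull (y ` S)"] Qy by auto
    have "{i \<in> I. x i \<in> F} = {i \<in> I. y i \<in> convex hull (y ` S)}"
      using yF[OF _ F(1)] unfolding F(2) by blast
    also have "\<dots> = S" by (rule index[OF S yinj yext G])
    finally have "F = convex hull (x ` S)" using xhull[OF F(1)] by simp
    then show "facial I (\<lambda>i. (x i, 1::real)) S"
      using facial_if_face_of[OF I xinj xext S] F(1) by simp
  qed
  show ?thesis by (rule that[OF Qy fac yhull xhull])
qed

section \<open>Lawrence extensions of pyramids\<close>

text \<open>The constructors keep apart the two roles of a base vertex, which is also a direction in
  \<open>R\<close>.\<close>

datatype 'a vert = Vtx 'a | Plus 'a | Minus 'a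

definition verts :: "'a set \<Rightarrow> 'a set \<Rightarrow> 'a vert set" where
  "verts A R = Vtx ` A \<union> Plus ` R \<union> Minus ` R"

lemma verts_simps [simp]:
  "Vtx a \<in> verts A R \<longleftrightarrow> a \<in> A" "Plus a \<in> verts A R \<longleftrightarrow> a \<in> R" "Minus a \<in> verts A R \<longleftrightarrow> a \<in> R"
  by (auto simp: verts_def)

lemma sum_verts:
  assumes "finite A" "finite R"
  shows "(\<Sum>i\<in>verts A R. f i) = (\<Sum>a\<in>A. f (Vtx a)) + (\<Sum>r\<in>R. f (Plus r) + f (Minus r))"
proof -
  have "(\<Sum>i\<in>verts A R. f i) = (\<Sum>i\<in>Vtx ` A. f i) + (\<Sum>i\<in>Plus ` R. f i) + (\<Sum>i\<in>Minus ` R. f i)"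
    unfolding verts_def using assms by (subst sum.union_disjoint; (subst sum.union_disjoint)?) auto
  then show ?thesis
    by (simp add: sum.reindex inj_on_def sum.distrib add.assoc)
qed

lemma finite_verts: "finite A \<Longrightarrow> finite R \<Longrightarrow> finite (verts A R)"
  by (simp add: verts_def)

text \<open>If only one coefficient off \<open>S\<close> can be nonzero, the dependency or its
  negative is nonnegative there.\<close>

lemma facial_single:
  assumes "facial I w S" "(\<Sum>i\<in>I. l i *\<^sub>R w i) = 0" "j \<in> I - S"
    and "\<And>i. i \<in> I - S \<Longrightarrow> i \<noteq> j \<Longrightarrow> l i = 0"
  shows "l j = 0"
proof (cases "l j \<ge> 0")
  case True
  show ?thesis
    by (rule facialD[OF assms(1,2) _ assms(3)]) (use assms(4) True in force)
next
  case False
  have "(\<Sum>i\<in>I. (- l i) *\<^sub>R w i) = 0" using assms(2) by (simp add: sum_negf)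
  then have "- l j = 0"
    by (rule facialD[OF assms(1) _ _ assms(3)]) (use assms(4) False in force)
  then show ?thesis by simp
qed

text \<open>The values \<open>(l p, l q)\<close> form a subspace of the plane meeting the
  nonnegative quadrant only in the origin: it is zero or a line of negative slope.\<close>

lemma pair_ratio:
  assumes fac: "facial I w (I - {p, q})" and pq: "p \<in> I" "q \<in> I" "p \<noteq> q"
  shows "\<exists>\<alpha> \<beta>. \<alpha> > 0 \<and> \<beta> > 0 \<and>
    (\<forall>l. (\<Sum>i\<in>I. l i *\<^sub>R w i) = 0 \<longrightarrow> (\<exists>m. l p = m * \<alpha> \<and> l q = - m * \<beta>))"
proof -
  have off: "I - (I - {p, q}) = {p, q}" using pq by auto
  have zero: "l q = 0" if "(\<Sum>i\<in>I. l i *\<^sub>R w i) = 0" "l p = 0" for l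
    by (rule facial_single[OF fac that(1)]) (use pq that(2) in auto)
  show ?thesis
  proof (cases "\<forall>l. (\<Sum>i\<in>I. l i *\<^sub>R w i) = 0 \<longrightarrow> l p = 0")
    case True
    \<comment> \<open>Zero subspace: any positive weights serve, with \<open>m = 0\<close>.\<close>
    then show ?thesis using zero by (intro exI[of _ 1]) force
  next
    case False
    then obtain l1 where l1: "(\<Sum>i\<in>I. l1 i *\<^sub>R w i) = 0" "l1 p \<noteq> 0" by blast
    obtain l0 where l0: "(\<Sum>i\<in>I. l0 i *\<^sub>R w i) = 0" "l0 p > 0"
    proof (cases "l1 p > 0")
      case True
      then show ?thesis using that[of l1] l1 by simp
    next
      case False
      have "(\<Sum>i\<in>I. (- l1 i) *\<^sub>R w i) = 0" using l1(1) by (simp add: sum_negf)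
      then show ?thesis using that[of "\<lambda>i. - l1 i"] l1(2) False by simp
    qed
    have "l0 q < 0"
    proof (rule ccontr)
      assume "\<not> l0 q < 0"
      have "l0 p = 0"
        by (rule facialD[OF fac l0(1)]) (use off l0(2) \<open>\<not> l0 q < 0\<close> in auto)
      then show False using l0(2) by simp
    qed
    moreover have "\<exists>m. l p = m * l0 p \<and> l q = - m * (- l0 q)" if l: "(\<Sum>i\<in>I. l i *\<^sub>R w i) = 0" for l
    proof -
      define m where "m = l p / l0 p"
      have "(\<Sum>i\<in>I. (l i - m * l0 i) *\<^sub>R w i) = (\<Sum>i\<in>I. l i *\<^sub>R w i) - m *\<^sub>R (\<Sum>i\<in>I. l0 i *\<^sub>R w i)"
        by (simp add: scaleR_diff_left sum_subtractf scaleR_sum_right)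
      then have "(\<Sum>i\<in>I. (l i - m * l0 i) *\<^sub>R w i) = 0" using l l0(1) by simp
      then have "l q - m * l0 q = 0" by (rule zero) (use l0(2) in \<open>simp add: m_def\<close>)
      then show ?thesis using l0(2) by (intro exI[of _ m]) (simp add: m_def)
    qed
    ultimately show ?thesis using l0(2) by (intro exI[of _ "l0 p"] exI[of _ "- l0 q"]) simp
  qed
qed

text \<open>Covers the constructed points and an arbitrary realization at once;
  \<open>\<alpha>\<close> and \<open>\<beta>\<close> allow the two lifts of \<open>r\<close> to be
  scaled independently. \<open>vtx\<close> says that a dependency nonnegative on the pyramid
  vertices vanishes there.\<close>

locale lawrence_pairs =
  fixes A R :: "'a set" and w :: "'a vert \<Rightarrow> 'b::real_vector" and \<alpha> \<beta> :: "'a \<Rightarrow> real"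
  assumes A: "finite A" and R: "finite R"
    and vtx: "facial (verts A R) w (verts A R - Vtx ` A)"
    and ab: "\<And>r. r \<in> R \<Longrightarrow> \<alpha> r > 0" "\<And>r. r \<in> R \<Longrightarrow> \<beta> r > 0"
    and ratio: "\<And>l r. (\<Sum>i\<in>verts A R. l i *\<^sub>R w i) = 0 \<Longrightarrow> r \<in> R \<Longrightarrow>
        \<exists>m. l (Plus r) = m * \<alpha> r \<and> l (Minus r) = - m * \<beta> r"
begin

text \<open>Every dependency uses a pair only through a multiple of this vector: it is the direction
  that the realization assigns to \<open>r\<close>.\<close>

definition vec :: "'a \<Rightarrow> 'b" where
  "vec r = \<alpha> r *\<^sub>R w (Plus r) - \<beta> r *\<^sub>R w (Minus r)"

lemma sum_vec:
  assumes "\<And>r. r \<in> R \<Longrightarrow> l (Plus r) = m r * \<alpha> r \<and> l (Minus r) = - m r * \<beta> r"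
  shows "(\<Sum>i\<in>verts A R. l i *\<^sub>R w i) = (\<Sum>a\<in>A. l (Vtx a) *\<^sub>R w (Vtx a)) + (\<Sum>r\<in>R. m r *\<^sub>R vec r)"
proof -
  have "(\<Sum>r\<in>R. l (Plus r) *\<^sub>R w (Plus r) + l (Minus r) *\<^sub>R w (Minus r)) = (\<Sum>r\<in>R. m r *\<^sub>R vec r)"
    using assms by (intro sum.cong) (auto simp: vec_def scaleR_diff_right)
  then show ?thesis by (simp add: sum_verts[OF A R])
qed

lemma multipliers:
  assumes "(\<Sum>i\<in>verts A R. l i *\<^sub>R w i) = 0"
  obtains m where "\<And>r. r \<in> R \<Longrightarrow> l (Plus r) = m r * \<alpha> r \<and> l (Minus r) = - m r * \<beta> r"
    "(\<Sum>a\<in>A. l (Vtx a) *\<^sub>R w (Vtx a)) + (\<Sum>r\<in>R. m r *\<^sub>R vec r) = 0"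
proof -
  have "\<forall>r\<in>R. \<exists>m. l (Plus r) = m * \<alpha> r \<and> l (Minus r) = - m * \<beta> r" using ratio[OF assms] by blast
  from bchoice[OF this] obtain m where
    m: "\<forall>r\<in>R. l (Plus r) = m r * \<alpha> r \<and> l (Minus r) = - m r * \<beta> r" ..
  then show ?thesis using that[of m] sum_vec[of l m] assms by simp
qed

lemma vtx_nonneg:
  assumes "(\<Sum>i\<in>verts A R. l i *\<^sub>R w i) = 0" "\<And>a. a \<in> A \<Longrightarrow> l (Vtx a) \<ge> 0" "a \<in> A"
  shows "l (Vtx a) = 0"
  by (rule facialD[OF vtx assms(1)]) (use assms(2,3) in auto)

end

text \<open>The lifts \<open>N\<close> with negative weight are not a facial set. A witness of this
  for the other configuration vanishes on the pyramid by \<open>vtx\<close>, and at each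
  \<open>r\<close> its sign is forced by the lift outside \<open>N\<close>. If
  \<open>\<mu> r = 0\<close>, both lifts are outside and the weight is zero.\<close>

lemma conformally_covered_vec:
  assumes w: "lawrence_pairs A R w \<alpha> \<beta>" and w': "lawrence_pairs A R w' \<alpha>' \<beta>'"
    and fac: "\<And>S. S \<subseteq> verts A R \<Longrightarrow> facial (verts A R) w' S \<Longrightarrow> facial (verts A R) w S"
  shows "conformally_covered R (lawrence_pairs.vec w \<alpha> \<beta>) (lawrence_pairs.vec w' \<alpha>' \<beta>')"
  unfolding conformally_covered_def
proof (intro allI impI)
  interpret w: lawrence_pairs A R w \<alpha> \<beta> by fact
  interpret w': lawrence_pairs A R w' \<alpha>' \<beta>' by fact
  fix \<mu> assume \<mu>: "(\<Sum>r\<in>R. \<mu> r *\<^sub>R w.vec r) = 0" "\<exists>r\<in>R. \<mu> r \<noteq> 0"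
  define l where "l i = (case i of Vtx a \<Rightarrow> 0 | Plus r \<Rightarrow> \<mu> r * \<alpha> r | Minus r \<Rightarrow> - \<mu> r * \<beta> r)" for i
  have l: "(\<Sum>i\<in>verts A R. l i *\<^sub>R w i) = 0"
    using \<mu>(1) w.sum_vec[of l \<mu>] by (simp add: l_def)
  define N where "N = {i \<in> verts A R. l i < 0}"
  obtain r0 where r0: "r0 \<in> R" "\<mu> r0 \<noteq> 0" using \<mu>(2) by blast
  define i0 where "i0 = (if \<mu> r0 > 0 then Plus r0 else Minus r0)"
  have i0: "i0 \<in> verts A R" "l i0 > 0"
    using r0 w.ab[OF r0(1)] by (auto simp: i0_def l_def mult_less_0_iff)
  have "\<not> facial (verts A R) w N"
  proof
    assume "facial (verts A R) w N"
    then have "l i0 = 0" by (rule facialD[OF _ l]) (use i0 in \<open>auto simp: N_def\<close>)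
    then show False using i0 by simp
  qed
  then have "\<not> facial (verts A R) w' N" using fac[of N] by (auto simp: N_def)
  then obtain l' j where l': "(\<Sum>i\<in>verts A R. l' i *\<^sub>R w' i) = 0" "\<forall>i\<in>verts A R - N. l' i \<ge> 0"
    and j: "j \<in> verts A R - N" "l' j \<noteq> 0"
    unfolding facial_def by blast
  have V: "l' (Vtx a) = 0" if "a \<in> A" for a
    by (rule w'.vtx_nonneg[OF l'(1) _ that]) (use l'(2) in \<open>auto simp: N_def l_def\<close>)
  obtain m where m: "\<And>r. r \<in> R \<Longrightarrow> l' (Plus r) = m r * \<alpha>' r \<and> l' (Minus r) = - m r * \<beta>' r"
    "(\<Sum>a\<in>A. l' (Vtx a) *\<^sub>R w' (Vtx a)) + (\<Sum>r\<in>R. m r *\<^sub>R w'.vec r) = 0"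
    using w'.multipliers[OF l'(1)] by blast
  have "(\<Sum>r\<in>R. m r *\<^sub>R w'.vec r) = 0" using m(2) V by simp
  moreover have "\<exists>r\<in>R. m r \<noteq> 0"
    using j V m(1) by (cases j) force+
  moreover have "(\<mu> r \<ge> 0 \<longrightarrow> m r \<ge> 0) \<and> (\<mu> r \<le> 0 \<longrightarrow> m r \<le> 0)" if r: "r \<in> R" for r
  proof (intro conjI impI)
    assume "\<mu> r \<ge> 0"
    then have "Plus r \<in> verts A R - N"
      using r w.ab[OF r] by (simp add: N_def l_def mult_less_0_iff)
    then have "l' (Plus r) \<ge> 0" by (rule bspec[OF l'(2)])
    then have "m r * \<alpha>' r \<ge> 0" using m(1)[OF r] by simp
    then show "m r \<ge> 0" using w'.ab[OF r] by (simp add: zero_le_mult_iff)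
  next
    assume "\<mu> r \<le> 0"
    then have "Minus r \<in> verts A R - N"
      using r w.ab[OF r] by (simp add: N_def l_def zero_less_mult_iff)
    then have "l' (Minus r) \<ge> 0" by (rule bspec[OF l'(2)])
    then have "- m r * \<beta>' r \<ge> 0" using m(1)[OF r] by simp
    then show "m r \<le> 0" using w'.ab[OF r] by (simp add: zero_le_mult_iff mult_le_0_iff)
  qed
  ultimately show "\<exists>\<nu>. (\<Sum>r\<in>R. \<nu> r *\<^sub>R w'.vec r) = 0 \<and> (\<exists>r\<in>R. \<nu> r \<noteq> 0) \<and>
      (\<forall>r\<in>R. (\<mu> r \<ge> 0 \<longrightarrow> \<nu> r \<ge> 0) \<and> (\<mu> r \<le> 0 \<longrightarrow> \<nu> r \<le> 0))"
    by blast
qed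


text \<open>The equations for a dependency of the homogenized vertices: the coordinate reserved for
  each \<open>r\<close>, the total weight once the pairs have cancelled, and the original
  space.\<close>

definition lawrence_dependency :: "'a::real_vector set \<Rightarrow> 'a set \<Rightarrow> ('a vert \<Rightarrow> real) \<Rightarrow> bool" where
  "lawrence_dependency A R l \<longleftrightarrow> (\<forall>r\<in>R. l (Plus r) + l (Minus r) = 0) \<and> (\<Sum>a\<in>A. l (Vtx a)) = 0 \<and>
     (\<Sum>a\<in>A. l (Vtx a) *\<^sub>R a) + (\<Sum>r\<in>R. (l (Plus r) - l (Minus r)) *\<^sub>R r) = 0"

text \<open>
  \<open>B\<close> lies in the hyperplane \<open>h = 1\<close>, so \<open>insert 0 B\<close> is the vertex set of a pyramid with
  apex \<open>0\<close>.
\<close>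

locale lawrence_extension =
  fixes B R :: "'a::real_vector set" and h :: "'a \<Rightarrow> real" and w :: "'a vert \<Rightarrow> 'b::real_vector"
  assumes B: "finite B" and R: "finite R" and h: "linear h" "\<And>b. b \<in> B \<Longrightarrow> h b = 1"
    and BR: "B \<subseteq> R" and R0: "0 \<notin> R"
    and vertex: "\<And>b. b \<in> B \<Longrightarrow> b \<notin> convex hull (B - {b})"
    and base: "\<And>a b. a \<in> B \<Longrightarrow> b \<in> B \<Longrightarrow> a - b \<in> span {r \<in> R. h r = 0}"
    and dependency: "\<And>l. (\<Sum>i\<in>verts (insert 0 B) R. l i *\<^sub>R w i) = 0 \<longleftrightarrow> lawrence_dependency (insert 0 B) R l"
begin

abbreviation "I \<equiv> verts (insert 0 B) R"

lemma B0: "0 \<notin> B" using h(2)[of 0] linear_0[OF h(1)] by auto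

lemma dependencyD:
  assumes "(\<Sum>i\<in>I. l i *\<^sub>R w i) = 0"
  shows "\<And>r. r \<in> R \<Longrightarrow> l (Minus r) = - l (Plus r)"
    and "l (Vtx 0) + (\<Sum>b\<in>B. l (Vtx b)) = 0"
    and "(\<Sum>b\<in>B. l (Vtx b) *\<^sub>R b) + (\<Sum>r\<in>R. (2 * l (Plus r)) *\<^sub>R r) = 0"
proof -
  have d: "lawrence_dependency (insert 0 B) R l" using assms dependency by blast
  then show *: "\<And>r. r \<in> R \<Longrightarrow> l (Minus r) = - l (Plus r)"
    by (auto simp: lawrence_dependency_def eq_neg_iff_add_eq_0 add.commute)
  show "l (Vtx 0) + (\<Sum>b\<in>B. l (Vtx b)) = 0"
    using d B B0 by (simp add: lawrence_dependency_def)
  have "(\<Sum>r\<in>R. (l (Plus r) - l (Minus r)) *\<^sub>R r) = (\<Sum>r\<in>R. (2 * l (Plus r)) *\<^sub>R r)"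
    using * by (intro sum.cong) auto
  then show "(\<Sum>b\<in>B. l (Vtx b) *\<^sub>R b) + (\<Sum>r\<in>R. (2 * l (Plus r)) *\<^sub>R r) = 0"
    using d B B0 by (simp add: lawrence_dependency_def)
qed

text \<open>The image of the vector equation under \<open>h\<close>. Compared with the total weight,
  it isolates the apex when only directions of height zero are used.\<close>

lemma dependency_height:
  assumes "(\<Sum>i\<in>I. l i *\<^sub>R w i) = 0"
  shows "(\<Sum>b\<in>B. l (Vtx b)) + (\<Sum>r\<in>R. 2 * l (Plus r) * h r) = 0"
proof -
  have "h ((\<Sum>b\<in>B. l (Vtx b) *\<^sub>R b) + (\<Sum>r\<in>R. (2 * l (Plus r)) *\<^sub>R r))
      = (\<Sum>b\<in>B. l (Vtx b) * h b) + (\<Sum>r\<in>R. 2 * l (Plus r) * h r)"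
    using h(1) by (simp add: linear_add linear_sum linear_cmul)
  also have "(\<Sum>b\<in>B. l (Vtx b) * h b) = (\<Sum>b\<in>B. l (Vtx b))" using h(2) by simp
  finally show ?thesis using dependencyD(3)[OF assms] h(1) by (simp add: linear_0)
qed

text \<open>Since \<open>h\<close> is \<open>1\<close> on \<open>B\<close>, the factor
  \<open>k\<close> is the total weight; if positive, dividing by it would put \<open>a\<close> into
  the hull of the other base vertices.\<close>

lemma vertex_combination:
  assumes a: "a \<in> B" and l: "\<And>b. b \<in> B - {a} \<Longrightarrow> l b \<ge> 0"
    and eq: "(\<Sum>b\<in>B - {a}. l b *\<^sub>R b) = k *\<^sub>R a" and b: "b \<in> B - {a}"
  shows "l b = 0"
proof -
  have "h (\<Sum>b\<in>B - {a}. l b *\<^sub>R b) = (\<Sum>b\<in>B - {a}. l b)"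
    using h by (simp add: linear_sum linear_cmul)
  then have k: "(\<Sum>b\<in>B - {a}. l b) = k" unfolding eq using h a by (simp add: linear_cmul)
  have "k = 0"
  proof (rule ccontr)
    assume "k \<noteq> 0"
    then have "k > 0" using k l by (metis order_less_le sum_nonneg)
    have "(\<Sum>b\<in>B - {a}. (l b / k) *\<^sub>R b) \<in> convex hull (B - {a})"
    proof (rule convex_sum)
      show "(\<Sum>b\<in>B - {a}. l b / k) = 1" using k \<open>k > 0\<close> by (simp add: sum_divide_distrib[symmetric])
    qed (use B l \<open>k > 0\<close> in \<open>auto intro: hull_inc\<close>)
    also have "(\<Sum>b\<in>B - {a}. (l b / k) *\<^sub>R b) = inverse k *\<^sub>R (\<Sum>b\<in>B - {a}. l b *\<^sub>R b)"
      by (simp add: scaleR_sum_right divide_inverse mult.commute)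
    also have "\<dots> = a" unfolding eq using \<open>k > 0\<close> by simp
    finally show False using vertex[OF a] by simp
  qed
  then have "(\<Sum>b\<in>B - {a}. l b) = 0" using k by simp
  then show ?thesis using B l b by (subst (asm) sum_nonneg_eq_0_iff) auto
qed

lemma facial_pair: "r \<in> R \<Longrightarrow> facial I w (I - {Plus r, Minus r})"
  unfolding facial_def
proof (intro allI impI ballI)
  fix l i assume r: "r \<in> R" and l: "(\<Sum>i\<in>I. l i *\<^sub>R w i) = 0"
    "\<forall>i\<in>I - (I - {Plus r, Minus r}). l i \<ge> 0" and i: "i \<in> I - (I - {Plus r, Minus r})"
  have "l (Plus r) \<ge> 0" "l (Minus r) \<ge> 0" using l(2) r by auto
  then show "l i = 0" using dependencyD(1)[OF l(1) r] i by auto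
qed

lemma facial_vtx: "facial I w (I - Vtx ` insert 0 B)"
  unfolding facial_def
proof (intro allI impI ballI)
  fix l i assume l: "(\<Sum>i\<in>I. l i *\<^sub>R w i) = 0"
    "\<forall>i\<in>I - (I - Vtx ` insert 0 B). l i \<ge> 0" and i: "i \<in> I - (I - Vtx ` insert 0 B)"
  have nn: "l (Vtx a) \<ge> 0" if "a \<in> insert 0 B" for a using l(2) that by auto
  have "(\<Sum>a\<in>insert 0 B. l (Vtx a)) = 0" using dependencyD(2)[OF l(1)] B B0 by simp
  then have "\<forall>a\<in>insert 0 B. l (Vtx a) = 0"
    using B nn by (subst (asm) sum_nonneg_eq_0_iff) auto
  then show "l i = 0" using i by auto
qed

lemma pairs_vanish:
  assumes l: "(\<Sum>i\<in>I. l i *\<^sub>R w i) = 0" and "r \<in> R" "l (Plus r) \<ge> 0" "l (Minus r) \<ge> 0"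
  shows "l (Plus r) = 0 \<and> l (Minus r) = 0"
  using dependencyD(1)[OF l assms(2)] assms(3,4) by simp

text \<open>All other pairs cancel, leaving a nonnegative combination of the other base vertices on
  the line through \<open>a\<close>. The pair of \<open>a\<close> is part of the set in order to tie
  the edge at the apex to the direction \<open>a\<close>.\<close>

lemma facial_edge:
  assumes a: "a \<in> B"
  shows "facial I w {Vtx 0, Vtx a, Plus a, Minus a}" (is "facial I w ?S")
  unfolding facial_def
proof (intro allI impI ballI)
  fix l i assume l: "(\<Sum>i\<in>I. l i *\<^sub>R w i) = 0" "\<forall>i\<in>I - ?S. l i \<ge> 0" and i: "i \<in> I - ?S"
  have pairs: "l (Plus r) = 0 \<and> l (Minus r) = 0" if "r \<in> R" "r \<noteq> a" for r
    using l(2) that by (intro pairs_vanish[OF l(1)]) auto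
  have aR: "a \<in> R" using a BR by blast
  have "(\<Sum>r\<in>R. (2 * l (Plus r)) *\<^sub>R r) = (\<Sum>r\<in>{a}. (2 * l (Plus r)) *\<^sub>R r)"
    using R aR pairs by (intro sum.mono_neutral_right) auto
  moreover have "(\<Sum>b\<in>B. l (Vtx b) *\<^sub>R b) = l (Vtx a) *\<^sub>R a + (\<Sum>b\<in>B - {a}. l (Vtx b) *\<^sub>R b)"
    using B a by (rule sum.remove)
  ultimately have "(\<Sum>b\<in>B - {a}. l (Vtx b) *\<^sub>R b) + (l (Vtx a) + 2 * l (Plus a)) *\<^sub>R a = 0"
    using dependencyD(3)[OF l(1)] by (simp add: scaleR_add_left algebra_simps)
  then have eq: "(\<Sum>b\<in>B - {a}. l (Vtx b) *\<^sub>R b) = (- (l (Vtx a) + 2 * l (Plus a))) *\<^sub>R a"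
    by (simp only: eq_neg_iff_add_eq_0 scaleR_minus_left)
  have nn: "l (Vtx b) \<ge> 0" if "b \<in> B - {a}" for b using l(2) that B0 by auto
  have "l (Vtx b) = 0" if "b \<in> B - {a}" for b
    by (rule vertex_combination[OF a nn eq that])
  then show "l i = 0" using i pairs by (cases i) auto
qed

text \<open>With \<open>R'\<close> empty this is the base; with all directions of height zero it
  detects parallelism to the base. The height equation removes the apex in both cases.\<close>

lemma facial_base:
  assumes R': "R' \<subseteq> {r \<in> R. h r = 0}"
  shows "facial I w (Vtx ` B \<union> Plus ` R' \<union> Minus ` R')" (is "facial I w ?S")
  unfolding facial_def
proof (intro allI impI ballI)
  fix l i assume l: "(\<Sum>i\<in>I. l i *\<^sub>R w i) = 0" "\<forall>i\<in>I - ?S. l i \<ge> 0" and i: "i \<in> I - ?S"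
  have pairs: "l (Plus r) = 0 \<and> l (Minus r) = 0" if "r \<in> R" "r \<notin> R'" for r
    using l(2) that by (intro pairs_vanish[OF l(1)]) auto
  have "(\<Sum>r\<in>R. 2 * l (Plus r) * h r) = 0"
    using pairs R' by (intro sum.neutral) force
  then have "l (Vtx 0) = 0" using dependency_height[OF l(1)] dependencyD(2)[OF l(1)] by simp
  then show "l i = 0" using i pairs by (cases i) auto
qed

lemma facial_apex: "facial I w {Vtx 0}"
  unfolding facial_def
proof (intro allI impI ballI)
  fix l i assume l: "(\<Sum>i\<in>I. l i *\<^sub>R w i) = 0" "\<forall>i\<in>I - {Vtx 0}. l i \<ge> 0" and i: "i \<in> I - {Vtx 0}"
  have pairs: "l (Plus r) = 0 \<and> l (Minus r) = 0" if "r \<in> R" for r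
    using l(2) that by (intro pairs_vanish[OF l(1)]) auto
  have "(\<Sum>b\<in>B. l (Vtx b)) = 0" using dependency_height[OF l(1)] pairs by simp
  moreover have nn: "l (Vtx b) \<ge> 0" if "b \<in> B" for b using l(2) that B0 by auto
  ultimately have "\<forall>b\<in>B. l (Vtx b) = 0" using B by (subst (asm) sum_nonneg_eq_0_iff) auto
  then show "l i = 0" using i pairs by (cases i) auto
qed

lemma facial_singleton:
  assumes i: "i \<in> I"
  shows "facial I w {i}"
proof -
  consider "i = Vtx 0" | a where "a \<in> B" "i = Vtx a" | r where "r \<in> R" "i = Plus r \<or> i = Minus r"
    using i by (cases i) auto
  then show ?thesis
  proof cases
    case 1
    then show ?thesis using facial_apex by simp
  next
    case 2
    show ?thesis
      unfolding facial_def
    proof (intro allI impI ballI)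
      fix l j assume l: "(\<Sum>i\<in>I. l i *\<^sub>R w i) = 0" "\<forall>j\<in>I - {i}. l j \<ge> 0" and j: "j \<in> I - {i}"
      \<comment> \<open>\<open>Vtx a\<close> is the only index common to the edge set and the base,
        and both are facial.\<close>
      have z: "l k = 0" if "k \<in> I - {Vtx 0, Vtx a, Plus a, Minus a}" for k
        by (rule facialD[OF facial_edge[OF 2(1)] l(1) _ that]) (use l(2) 2 in auto)
      have z0: "l k = 0" if "k \<in> I - (Vtx ` B \<union> Plus ` {} \<union> Minus ` {})" for k
        by (rule facialD[OF facial_base[of "{}"] l(1) _ that]) (use l(2) 2 in auto)
      show "l j = 0" using z[of j] z0[of j] j 2 B0 by (cases j) auto
    qed
  next
    case 3
    show ?thesis
      unfolding facial_def
    proof (intro allI impI ballI)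
      fix l j assume l: "(\<Sum>i\<in>I. l i *\<^sub>R w i) = 0" "\<forall>j\<in>I - {i}. l j \<ge> 0" and j: "j \<in> I - {i}"
      have V: "l (Vtx a) = 0" if "a \<in> insert 0 B" for a
        by (rule facialD[OF facial_vtx l(1)]) (use l(2) 3 that in auto)
      have pairs: "l (Plus s) = 0 \<and> l (Minus s) = 0" if "s \<in> R" "s \<noteq> r" for s
        using l(2) that 3 by (intro pairs_vanish[OF l(1)]) auto
      have "(\<Sum>s\<in>R. (2 * l (Plus s)) *\<^sub>R s) = (\<Sum>s\<in>{r}. (2 * l (Plus s)) *\<^sub>R s)"
        using R 3(1) pairs by (intro sum.mono_neutral_right) auto
      then have "(2 * l (Plus r)) *\<^sub>R r = 0" using dependencyD(3)[OF l(1)] V by simp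
      then have "l (Plus r) = 0" using R0 3(1) by auto
      then have "l (Minus r) = 0" using dependencyD(1)[OF l(1) 3(1)] by simp
      then show "l j = 0" using \<open>l (Plus r) = 0\<close> pairs V j by (cases j) auto
    qed
  qed
qed


section \<open>Comparison with an arbitrary configuration having the same facial sets\<close>

lemma standard_pairs: "lawrence_pairs (insert 0 B) R w (\<lambda>_. 1 / 2) (\<lambda>_. 1 / 2)"
proof
  fix l r assume "(\<Sum>i\<in>I. l i *\<^sub>R w i) = 0" "r \<in> R"
  then show "\<exists>m. l (Plus r) = m * (1 / 2) \<and> l (Minus r) = - m * (1 / 2)"
    using dependencyD(1) by (intro exI[of _ "2 * l (Plus r)"]) simp
qed (use B R facial_vtx in auto)

text \<open>The lifts of \<open>r\<close> enter the vector equation as \<open>r\<close> and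
  \<open>- r\<close>, so with weight \<open>1 / 2\<close> each the recovered directions have the
  dependencies of \<open>R\<close> itself.\<close>

lemma sum_standard_vec:
  "(\<Sum>r\<in>R. \<mu> r *\<^sub>R lawrence_pairs.vec w (\<lambda>_. 1 / 2) (\<lambda>_. 1 / 2) r) = 0 \<longleftrightarrow> (\<Sum>r\<in>R. \<mu> r *\<^sub>R r) = 0"
proof -
  interpret lawrence_pairs "insert 0 B" R w "\<lambda>_. 1 / 2" "\<lambda>_. 1 / 2" by (rule standard_pairs)
  define l where "l i = (case i of Vtx a \<Rightarrow> 0 | Plus r \<Rightarrow> \<mu> r / 2 | Minus r \<Rightarrow> - \<mu> r / 2)" for i
  have "(\<Sum>i\<in>I. l i *\<^sub>R w i) = (\<Sum>r\<in>R. \<mu> r *\<^sub>R vec r)"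
    by (subst sum_vec[of l \<mu>]) (auto simp: l_def)
  moreover have "lawrence_dependency (insert 0 B) R l \<longleftrightarrow> (\<Sum>r\<in>R. \<mu> r *\<^sub>R r) = 0"
    by (simp add: lawrence_dependency_def l_def)
  ultimately show ?thesis using dependency[of l] by simp
qed

text \<open>That the complement of a pair is facial carries over, so by \<open>pair_ratio\<close>
  the other configuration also consists of pairs, with weights of its own.\<close>

lemma facially_equivalent_pairs:
  assumes fac: "\<And>S. S \<subseteq> I \<Longrightarrow> facial I w S \<longleftrightarrow> facial I w' S"
  obtains \<alpha> \<beta> where "lawrence_pairs (insert 0 B) R w' \<alpha> \<beta>"
    "conformally_covered R (\<lambda>r. r) (lawrence_pairs.vec w' \<alpha> \<beta>)"
    "conformally_covered R (lawrence_pairs.vec w' \<alpha> \<beta>) (\<lambda>r. r)"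
proof -
  have "\<forall>r\<in>R. \<exists>p. fst p > 0 \<and> snd p > 0 \<and>
      (\<forall>l. (\<Sum>i\<in>I. l i *\<^sub>R w' i) = 0 \<longrightarrow> (\<exists>m. l (Plus r) = m * fst p \<and> l (Minus r) = - m * snd p))"
  proof
    fix r assume r: "r \<in> R"
    have "facial I w' (I - {Plus r, Minus r})" using fac[of "I - {Plus r, Minus r}"] facial_pair[OF r] by auto
    from pair_ratio[OF this] r obtain a b where "a > 0" "b > 0"
      "\<forall>l. (\<Sum>i\<in>I. l i *\<^sub>R w' i) = 0 \<longrightarrow> (\<exists>m. l (Plus r) = m * a \<and> l (Minus r) = - m * b)" by auto
    then show "\<exists>p. fst p > 0 \<and> snd p > 0 \<and>
      (\<forall>l. (\<Sum>i\<in>I. l i *\<^sub>R w' i) = 0 \<longrightarrow> (\<exists>m. l (Plus r) = m * fst p \<and> l (Minus r) = - m * snd p))"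
      by (intro exI[of _ "(a, b)"]) simp
  qed
  from bchoice[OF this] obtain f where f: "\<forall>r\<in>R. fst (f r) > 0 \<and> snd (f r) > 0 \<and>
      (\<forall>l. (\<Sum>i\<in>I. l i *\<^sub>R w' i) = 0 \<longrightarrow> (\<exists>m. l (Plus r) = m * fst (f r) \<and> l (Minus r) = - m * snd (f r)))" ..
  have P: "lawrence_pairs (insert 0 B) R w' (\<lambda>r. fst (f r)) (\<lambda>r. snd (f r))"
  proof
    show "facial I w' (I - Vtx ` insert 0 B)" using fac[of "I - Vtx ` insert 0 B"] facial_vtx by auto
  qed (use B R f in auto)
  have "conformally_covered R (lawrence_pairs.vec w (\<lambda>_. 1 / 2) (\<lambda>_. 1 / 2)) (lawrence_pairs.vec w' (\<lambda>r. fst (f r)) (\<lambda>r. snd (f r)))"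
    by (rule conformally_covered_vec[OF standard_pairs P]) (use fac in blast)
  moreover have "conformally_covered R (lawrence_pairs.vec w' (\<lambda>r. fst (f r)) (\<lambda>r. snd (f r))) (lawrence_pairs.vec w (\<lambda>_. 1 / 2) (\<lambda>_. 1 / 2))"
    by (rule conformally_covered_vec[OF P standard_pairs]) (use fac in blast)
  ultimately show ?thesis
    using that[OF P] unfolding conformally_covered_def sum_standard_vec by blast
qed

text \<open>The factors \<open>\<rho> r\<close> of the directions, \<open>\<kappa> a\<close> of the
  edges and a common length \<open>L\<close> are positive and are collected in \<open>c\<close>.
  Equality of dependencies is the form from which an injective linear map can be built.\<close>

theorem rigidity:
  assumes fac: "\<And>S. S \<subseteq> I \<Longrightarrow> facial I w S \<longleftrightarrow> facial I w' S"
    and P: "lawrence_pairs (insert 0 B) R w' \<alpha> \<beta>"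
    and M: "linear M" "\<And>x. x \<in> span R \<Longrightarrow> M x = 0 \<Longrightarrow> x = 0"
    and vecM: "\<And>r. r \<in> R \<Longrightarrow> \<exists>c>0. lawrence_pairs.vec w' \<alpha> \<beta> r = c *\<^sub>R M r"
  shows "\<exists>c. (\<forall>i\<in>I. c i > 0) \<and>
    (\<forall>l. (\<Sum>i\<in>I. l i *\<^sub>R w i) = 0 \<longleftrightarrow> (\<Sum>i\<in>I. (l i * c i) *\<^sub>R w' i) = 0)"
proof -
  interpret P: lawrence_pairs "insert 0 B" R w' \<alpha> \<beta> by (rule P)
  have "\<forall>r\<in>R. \<exists>c. c > 0 \<and> P.vec r = c *\<^sub>R M r" using vecM by blast
  from bchoice[OF this] obtain \<rho> where \<rho>: "\<And>r. r \<in> R \<Longrightarrow> \<rho> r > 0" "\<And>r. r \<in> R \<Longrightarrow> P.vec r = \<rho> r *\<^sub>R M r"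
    by blast
  \<comment> \<open>Without base vertices the apex is the only pyramid vertex involved, so neither
    sign of its weight is possible.\<close>
  have apex: "l (Vtx 0) = 0" if "(\<Sum>i\<in>I. l i *\<^sub>R w' i) = 0" "\<And>b. b \<in> B \<Longrightarrow> l (Vtx b) = 0" for l
    by (rule facial_single[OF P.vtx that(1)]) (use that(2) in auto)
  have edge: "\<exists>\<kappa> \<tau>. \<kappa> > 0 \<and> \<tau> > 0 \<and> \<kappa> *\<^sub>R w' (Vtx a) = w' (Vtx 0) + \<tau> *\<^sub>R M a" if a: "a \<in> B" for a
  proof -
    have aR: "a \<in> R" and a0: "a \<noteq> 0" using a BR B0 by auto
    \<comment> \<open>The relation between vertex \<open>a\<close>, the apex and the direction
      \<open>a\<close>; \<open>N\<close> is its negative part.\<close>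
    define l where "l i = (if i = Vtx a then 1 else if i = Vtx 0 then -1
        else if i = Plus a then - 1 / 2 else if i = Minus a then 1 / 2 else (0::real))" for i
    define N where "N = {Vtx 0, Plus a}"
    have "(\<Sum>b\<in>B. l (Vtx b)) = (\<Sum>b\<in>{a}. l (Vtx b))"
      by (rule sum.mono_neutral_right) (use B a B0 in \<open>auto simp: l_def\<close>)
    moreover have "(\<Sum>b\<in>B. l (Vtx b) *\<^sub>R b) = (\<Sum>b\<in>{a}. l (Vtx b) *\<^sub>R b)"
      by (rule sum.mono_neutral_right) (use B a B0 in \<open>auto simp: l_def\<close>)
    moreover have "(\<Sum>r\<in>R. (l (Plus r) - l (Minus r)) *\<^sub>R r) = (\<Sum>r\<in>{a}. (l (Plus r) - l (Minus r)) *\<^sub>R r)"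
      by (rule sum.mono_neutral_right) (use R aR in \<open>auto simp: l_def\<close>)
    ultimately have "lawrence_dependency (insert 0 B) R l"
      using B B0 a0 by (simp add: lawrence_dependency_def l_def)
    then have "(\<Sum>i\<in>I. l i *\<^sub>R w i) = 0" by (simp add: dependency)
    then have "\<not> facial I w N"
    proof (rule contrapos_pn)
      assume "facial I w N"
      show "(\<Sum>i\<in>I. l i *\<^sub>R w i) \<noteq> 0"
      proof
        assume "(\<Sum>i\<in>I. l i *\<^sub>R w i) = 0"
        then have "l (Vtx a) = 0"
          by (rule facialD[OF \<open>facial I w N\<close>]) (use a a0 in \<open>auto simp: N_def l_def\<close>)
        then show False by (simp add: l_def)
      qed
    qed
    \<comment> \<open>The other configuration has a relation conforming to these signs, and the edge
      set confines it to four indices.\<close>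
    then have "\<not> facial I w' N" using fac[of N] aR by (simp add: N_def)
    then obtain l' j where l': "(\<Sum>i\<in>I. l' i *\<^sub>R w' i) = 0" "\<forall>i\<in>I - N. l' i \<ge> 0"
      and j: "j \<in> I - N" "l' j \<noteq> 0"
      unfolding facial_def by blast
    have "facial I w' {Vtx 0, Vtx a, Plus a, Minus a}"
      using fac[of "{Vtx 0, Vtx a, Plus a, Minus a}"] facial_edge[OF a] a aR by simp
    then have z: "l' i = 0" if "i \<in> I - {Vtx 0, Vtx a, Plus a, Minus a}" for i
      by (rule facialD[OF _ l'(1) _ that]) (use l'(2) in \<open>auto simp: N_def\<close>)
    have zV: "l' (Vtx b) = 0" if "b \<in> B" "b \<noteq> a" for b
      using z[of "Vtx b"] that B0 by auto
    obtain m where m: "\<And>r. r \<in> R \<Longrightarrow> l' (Plus r) = m r * \<alpha> r \<and> l' (Minus r) = - m r * \<beta> r"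
      "(\<Sum>b\<in>insert 0 B. l' (Vtx b) *\<^sub>R w' (Vtx b)) + (\<Sum>r\<in>R. m r *\<^sub>R P.vec r) = 0"
      using P.multipliers[OF l'(1)] by blast
    have mr: "m r = 0" if "r \<in> R" "r \<noteq> a" for r
      using m(1)[OF that(1)] z[of "Plus r"] P.ab[OF that(1)] that by simp
    have "(\<Sum>r\<in>R. m r *\<^sub>R P.vec r) = (\<Sum>r\<in>{a}. m r *\<^sub>R P.vec r)"
      using R aR mr by (intro sum.mono_neutral_right) auto
    moreover have "(\<Sum>b\<in>B. l' (Vtx b) *\<^sub>R w' (Vtx b)) = (\<Sum>b\<in>{a}. l' (Vtx b) *\<^sub>R w' (Vtx b))"
      using B a zV by (intro sum.mono_neutral_right) auto
    ultimately have eq: "l' (Vtx 0) *\<^sub>R w' (Vtx 0) + l' (Vtx a) *\<^sub>R w' (Vtx a) + (m a * \<rho> a) *\<^sub>R M a = 0"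
      using m(2) B B0 \<rho>(2)[OF aR] by simp
    have "l' (Minus a) \<ge> 0" using l'(2) aR by (simp add: N_def)
    then have ma: "m a \<le> 0" using m(1)[OF aR] P.ab[OF aR] by (simp add: mult_le_0_iff)
    have u0: "l' (Vtx a) \<ge> 0" using l'(2) a a0 by (simp add: N_def)
    \<comment> \<open>No coefficient degenerates. Without \<open>Vtx a\<close> the apex drops out,
      and \<open>M a \<noteq> 0\<close> removes the direction too; a nonnegative apex weight
      contradicts \<open>vtx_nonneg\<close>; without the direction, faciality of the apex is
      violated.\<close>
    have u: "l' (Vtx a) > 0"
    proof (rule ccontr)
      assume "\<not> l' (Vtx a) > 0"
      then have ua: "l' (Vtx a) = 0" using u0 by simp
      then have "l' (Vtx 0) = 0" using ua zV by (intro apex[OF l'(1)]) metis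
      then have "(m a * \<rho> a) *\<^sub>R M a = 0" using eq ua by simp
      moreover have "M a \<noteq> 0" using M(2)[of a] a0 span_base[OF aR] by blast
      ultimately have "m a = 0" using \<rho>(1)[OF aR] by simp
      then have "l' j = 0" using j(1) z[of j] m(1)[OF aR] ua \<open>l' (Vtx 0) = 0\<close> by (cases "j \<in> {Vtx 0, Vtx a, Plus a, Minus a}") auto
      then show False using j(2) by simp
    qed
    have t: "l' (Vtx 0) < 0"
    proof (rule ccontr)
      assume "\<not> l' (Vtx 0) < 0"
      then have "l' (Vtx a) = 0" using l'(2) a
        by (intro P.vtx_nonneg[OF l'(1)]) (auto simp: N_def)
      then show False using u by simp
    qed
    have "m a \<noteq> 0"
    proof
      assume "m a = 0"
      have "facial I w' {Vtx 0}" using fac[of "{Vtx 0}"] facial_apex by simp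
      then have "l' (Vtx a) = 0"
        by (rule facialD[OF _ l'(1)]) (use l'(2) a a0 m(1)[OF aR] \<open>m a = 0\<close> in \<open>auto simp: N_def\<close>)
      then show False using u by simp
    qed
    then have ma: "m a < 0" using ma by simp
    define t where "t = - l' (Vtx 0)"
    have "t > 0" using t by (simp add: t_def)
    have "l' (Vtx a) *\<^sub>R w' (Vtx a) = t *\<^sub>R w' (Vtx 0) + (- m a * \<rho> a) *\<^sub>R M a"
      using eq by (simp add: t_def algebra_simps eq_neg_iff_add_eq_0)
    then have "inverse t *\<^sub>R (l' (Vtx a) *\<^sub>R w' (Vtx a)) = inverse t *\<^sub>R (t *\<^sub>R w' (Vtx 0) + (- m a * \<rho> a) *\<^sub>R M a)"
      by simp
    then have "(l' (Vtx a) / t) *\<^sub>R w' (Vtx a) = w' (Vtx 0) + (- m a * \<rho> a / t) *\<^sub>R M a"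
      using \<open>t > 0\<close> by (simp add: scaleR_diff_right divide_inverse mult.commute)
    moreover have "l' (Vtx a) / t > 0" "- m a * \<rho> a / t > 0"
      using u \<open>t > 0\<close> ma \<rho>(1)[OF aR] by (simp_all add: mult_neg_pos divide_neg_pos)
    ultimately show ?thesis by blast
  qed
  then have "\<forall>a\<in>B. \<exists>p. fst p > 0 \<and> snd p > 0 \<and> fst p *\<^sub>R w' (Vtx a) = w' (Vtx 0) + snd p *\<^sub>R M a"
    by (metis fst_conv snd_conv)
  from bchoice[OF this] obtain f where f: "\<forall>a\<in>B. fst (f a) > 0 \<and> snd (f a) > 0 \<and>
      fst (f a) *\<^sub>R w' (Vtx a) = w' (Vtx 0) + snd (f a) *\<^sub>R M a" ..
  define \<kappa> where "\<kappa> a = fst (f a)" for a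
  define \<tau> where "\<tau> a = snd (f a)" for a
  have \<kappa>: "\<kappa> a > 0" and \<tau>: "\<tau> a > 0" and \<kappa>\<tau>: "\<kappa> a *\<^sub>R w' (Vtx a) = w' (Vtx 0) + \<tau> a *\<^sub>R M a" if "a \<in> B" for a
    using f that by (auto simp: \<kappa>_def \<tau>_def)
  have \<tau>_eq: "\<tau> a = \<tau> b" if a: "a \<in> B" and b: "b \<in> B" for a b
  proof (cases "a = b")
    case False
    define R' where "R' = {r \<in> R. h r = 0}"
    have R': "R' \<subseteq> R" "finite R'" using R by (auto simp: R'_def)
    obtain v where v: "a - b = (\<Sum>r\<in>R'. v r *\<^sub>R r)"
      using base[OF a b] R'(2) unfolding R'_def[symmetric] by (auto simp: span_finite)
    define m where "m r = (if r \<in> R' then - v r / \<rho> r else 0)" for r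
    \<comment> \<open>The edge relations of \<open>a\<close> and \<open>b\<close>, divided by
      \<open>\<tau> a\<close> and \<open>\<tau> b\<close> and subtracted, leave
      \<open>M (a - b)\<close>, a combination of directions of height zero, and a multiple of the
      apex. The apex is off the face of the base and these directions, so its coefficient
      vanishes.\<close>
    define l where "l i = (case i of
        Vtx c \<Rightarrow> (if c = a then \<kappa> a / \<tau> a else if c = b then - \<kappa> b / \<tau> b
          else if c = 0 then 1 / \<tau> b - 1 / \<tau> a else 0)
      | Plus r \<Rightarrow> m r * \<alpha> r | Minus r \<Rightarrow> - m r * \<beta> r)" for i
    have "(\<Sum>r\<in>R. m r *\<^sub>R P.vec r) = (\<Sum>r\<in>R'. m r *\<^sub>R P.vec r)"
      using R R' by (intro sum.mono_neutral_right) (auto simp: m_def)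
    also have "\<dots> = (\<Sum>r\<in>R'. - v r *\<^sub>R M r)"
    proof (rule sum.cong[OF refl])
      fix r assume r: "r \<in> R'"
      then have "r \<in> R" using R' by blast
      then show "m r *\<^sub>R P.vec r = - v r *\<^sub>R M r"
        using r \<rho>(1)[of r] by (simp add: m_def \<rho>(2))
    qed
    also have "\<dots> = - M (a - b)"
      unfolding v using M(1) by (simp add: linear_sum linear_cmul sum_negf)
    finally have pairs: "(\<Sum>r\<in>R. m r *\<^sub>R P.vec r) = M b - M a" using M(1) by (simp add: linear_diff)
    have "(\<Sum>c\<in>B. l (Vtx c) *\<^sub>R w' (Vtx c)) = (\<Sum>c\<in>{a, b}. l (Vtx c) *\<^sub>R w' (Vtx c))"
      using B B0 a b by (intro sum.mono_neutral_right) (auto simp: l_def)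
    also have "\<dots> = (1 / \<tau> a) *\<^sub>R (\<kappa> a *\<^sub>R w' (Vtx a)) - (1 / \<tau> b) *\<^sub>R (\<kappa> b *\<^sub>R w' (Vtx b))"
      using False by (simp add: l_def)
    also have "\<dots> = (1 / \<tau> a - 1 / \<tau> b) *\<^sub>R w' (Vtx 0) + (M a - M b)"
      unfolding \<kappa>\<tau>[OF a] \<kappa>\<tau>[OF b] using \<tau>[OF a] \<tau>[OF b] by (simp add: algebra_simps)
    finally have vs: "(\<Sum>c\<in>B. l (Vtx c) *\<^sub>R w' (Vtx c)) = (1 / \<tau> a - 1 / \<tau> b) *\<^sub>R w' (Vtx 0) + (M a - M b)" .
    have l0: "l (Vtx 0) = 1 / \<tau> b - 1 / \<tau> a" using a b B0 by (auto simp: l_def)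
    have sv: "(\<Sum>i\<in>I. l i *\<^sub>R w' i) =
        (\<Sum>c\<in>insert 0 B. l (Vtx c) *\<^sub>R w' (Vtx c)) + (\<Sum>r\<in>R. m r *\<^sub>R P.vec r)"
      by (rule P.sum_vec) (simp add: l_def)
    have sB: "(\<Sum>c\<in>insert 0 B. l (Vtx c) *\<^sub>R w' (Vtx c)) =
        l (Vtx 0) *\<^sub>R w' (Vtx 0) + (\<Sum>c\<in>B. l (Vtx c) *\<^sub>R w' (Vtx c))"
      using B B0 by simp
    have l: "(\<Sum>i\<in>I. l i *\<^sub>R w' i) = 0"
      unfolding sv sB vs pairs l0 by (simp add: algebra_simps)
    have face: "facial I w' (Vtx ` B \<union> Plus ` R' \<union> Minus ` R')"
    proof -
      have "Vtx ` B \<union> Plus ` R' \<union> Minus ` R' \<subseteq> I" using R' by auto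
      then show ?thesis using fac facial_base[of R'] by (simp add: R'_def)
    qed
    have "l (Vtx 0) = 0"
    proof (rule facial_single[OF face l])
      show "l i = 0" if "i \<in> I - (Vtx ` B \<union> Plus ` R' \<union> Minus ` R')" "i \<noteq> Vtx 0" for i
        using that by (cases i) (auto simp: l_def m_def)
    qed (use B0 in auto)
    then show ?thesis unfolding l0 using \<tau>[OF a] \<tau>[OF b] by (simp add: field_simps)
  qed simp
  obtain L where L: "L > 0" "\<And>a. a \<in> B \<Longrightarrow> \<tau> a = L"
  proof (cases "B = {}")
    case True
    then show ?thesis using that[of 1] by simp
  next
    case False
    then obtain a where "a \<in> B" by blast
    then show ?thesis using that[of "\<tau> a"] \<tau> \<tau>_eq by blast
  qed
  \<comment> \<open>The scaled lifts of \<open>r\<close> differ by \<open>2 * L\<close> times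
    \<open>M r\<close>, as the original ones represent a difference of \<open>2 r\<close>; the apex
    keeps its scale.\<close>
  define c where "c i = (case i of Vtx a \<Rightarrow> if a \<in> B then \<kappa> a else 1
    | Plus r \<Rightarrow> 2 * L / \<rho> r * \<alpha> r | Minus r \<Rightarrow> 2 * L / \<rho> r * \<beta> r)" for i
  have cpos: "\<forall>i\<in>I. c i > 0"
  proof
    fix i assume "i \<in> I"
    then show "c i > 0" using \<kappa> \<rho>(1) P.ab L(1) by (cases i) (auto simp: c_def)
  qed
  have cV: "c (Vtx a) *\<^sub>R w' (Vtx a) = w' (Vtx 0) + L *\<^sub>R M a" if "a \<in> insert 0 B" for a
    using that \<kappa>\<tau> L(2) B0 M(1) by (cases "a = 0") (auto simp: c_def linear_0)
  have key: "(\<Sum>i\<in>I. (l i * c i) *\<^sub>R w' i) = (\<Sum>a\<in>insert 0 B. l (Vtx a)) *\<^sub>R w' (Vtx 0) +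
      L *\<^sub>R M ((\<Sum>a\<in>insert 0 B. l (Vtx a) *\<^sub>R a) + (\<Sum>r\<in>R. (l (Plus r) - l (Minus r)) *\<^sub>R r))"
    if pm: "\<forall>r\<in>R. l (Plus r) + l (Minus r) = 0" for l
  proof -
    have 1: "(\<Sum>i\<in>I. (l i * c i) *\<^sub>R w' i) =
        (\<Sum>a\<in>insert 0 B. (l (Vtx a) * c (Vtx a)) *\<^sub>R w' (Vtx a)) + (\<Sum>r\<in>R. (l (Plus r) * (2 * L / \<rho> r)) *\<^sub>R P.vec r)"
      by (rule P.sum_vec) (use pm in \<open>auto simp: c_def eq_neg_iff_add_eq_0[symmetric] add.commute\<close>)
    have 2: "(\<Sum>a\<in>insert 0 B. (l (Vtx a) * c (Vtx a)) *\<^sub>R w' (Vtx a)) =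
        (\<Sum>a\<in>insert 0 B. l (Vtx a)) *\<^sub>R w' (Vtx 0) + L *\<^sub>R (\<Sum>a\<in>insert 0 B. l (Vtx a) *\<^sub>R M a)"
    proof -
      have "(\<Sum>a\<in>insert 0 B. (l (Vtx a) * c (Vtx a)) *\<^sub>R w' (Vtx a)) =
          (\<Sum>a\<in>insert 0 B. l (Vtx a) *\<^sub>R w' (Vtx 0) + L *\<^sub>R (l (Vtx a) *\<^sub>R M a))"
      proof (rule sum.cong[OF refl])
        fix a assume a: "a \<in> insert 0 B"
        have "(l (Vtx a) * c (Vtx a)) *\<^sub>R w' (Vtx a) = l (Vtx a) *\<^sub>R (c (Vtx a) *\<^sub>R w' (Vtx a))" by simp
        also have "\<dots> = l (Vtx a) *\<^sub>R w' (Vtx 0) + L *\<^sub>R (l (Vtx a) *\<^sub>R M a)"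
          unfolding cV[OF a] by (simp add: scaleR_add_right mult.commute)
        finally show "(l (Vtx a) * c (Vtx a)) *\<^sub>R w' (Vtx a) = l (Vtx a) *\<^sub>R w' (Vtx 0) + L *\<^sub>R (l (Vtx a) *\<^sub>R M a)" .
      qed
      then show ?thesis by (simp only: sum.distrib scaleR_sum_left scaleR_sum_right)
    qed
    have 3: "(\<Sum>r\<in>R. (l (Plus r) * (2 * L / \<rho> r)) *\<^sub>R P.vec r) = L *\<^sub>R (\<Sum>r\<in>R. (l (Plus r) - l (Minus r)) *\<^sub>R M r)"
      unfolding scaleR_sum_right
    proof (rule sum.cong[OF refl])
      fix r assume r: "r \<in> R"
      have "l (Plus r) - l (Minus r) = 2 * l (Plus r)" using pm r by (simp add: add_eq_0_iff)
      then show "(l (Plus r) * (2 * L / \<rho> r)) *\<^sub>R P.vec r = L *\<^sub>R (l (Plus r) - l (Minus r)) *\<^sub>R M r"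
        using \<rho>(1)[OF r] by (simp add: \<rho>(2)[OF r])
    qed
    show ?thesis
      unfolding 1 2 3 linear_add[OF M(1)] linear_sum[OF M(1)] linear_cmul[OF M(1)]
      by (simp only: scaleR_add_right add.assoc)
  qed
  have "(\<Sum>i\<in>I. l i *\<^sub>R w i) = 0 \<longleftrightarrow> (\<Sum>i\<in>I. (l i * c i) *\<^sub>R w' i) = 0" for l
  proof
    assume "(\<Sum>i\<in>I. l i *\<^sub>R w i) = 0"
    then have d: "lawrence_dependency (insert 0 B) R l" by (simp only: dependency)
    then show "(\<Sum>i\<in>I. (l i * c i) *\<^sub>R w' i) = 0"
      using key[of l] linear_0[OF M(1)] unfolding lawrence_dependency_def
      by (elim conjE) (simp only: scaleR_zero_left scaleR_zero_right add_0)
  next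
    assume l: "(\<Sum>i\<in>I. (l i * c i) *\<^sub>R w' i) = 0"
    \<comment> \<open>The factors \<open>\<alpha> r\<close> and \<open>\<beta> r\<close> in
      \<open>c\<close> turn the ratio of weights on a pair into minus one.\<close>
    have pm: "\<forall>r\<in>R. l (Plus r) + l (Minus r) = 0"
    proof
      fix r assume r: "r \<in> R"
      obtain m where m: "l (Plus r) * c (Plus r) = m * \<alpha> r" "l (Minus r) * c (Minus r) = - m * \<beta> r"
        using P.ratio[OF l r] by blast
      have "(l (Plus r) * (2 * L / \<rho> r)) * \<alpha> r = m * \<alpha> r" "(l (Minus r) * (2 * L / \<rho> r)) * \<beta> r = (- m) * \<beta> r"
        using m unfolding c_def by (simp_all only: vert.case mult.assoc)
      moreover have "\<alpha> r \<noteq> 0" "\<beta> r \<noteq> 0" using P.ab[OF r] by auto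
      ultimately have "l (Plus r) * (2 * L / \<rho> r) = m" "l (Minus r) * (2 * L / \<rho> r) = - m"
        using mult_right_cancel by blast+
      then have "(l (Plus r) + l (Minus r)) * (2 * L / \<rho> r) = 0" by (simp only: distrib_right add.right_inverse)
      then show "l (Plus r) + l (Minus r) = 0" using \<rho>(1)[OF r] L(1) by simp
    qed
    define s where "s = (\<Sum>a\<in>insert 0 B. l (Vtx a))"
    define x where "x = (\<Sum>a\<in>insert 0 B. l (Vtx a) *\<^sub>R a) + (\<Sum>r\<in>R. (l (Plus r) - l (Minus r)) *\<^sub>R r)"
    have sx: "s *\<^sub>R w' (Vtx 0) + L *\<^sub>R M x = 0" using key[OF pm] l by (simp only: s_def x_def)
    have xR: "x \<in> span R"
      unfolding x_def using BR
      by (intro span_add span_sum span_scale) (auto intro: span_base span_zero)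
    then obtain v where v: "x = (\<Sum>r\<in>R. v r *\<^sub>R r)" using R by (auto simp: span_finite)
    define m where "m r = L * v r / \<rho> r" for r
    \<comment> \<open>Writing \<open>L *\<^sub>R M x\<close> through directions gives a dependency
      without base vertices, so \<open>apex\<close> separates \<open>s = 0\<close> from
      \<open>M x = 0\<close>.\<close>
    define l'' where "l'' i = (case i of Vtx a \<Rightarrow> if a = 0 then s else 0 | Plus r \<Rightarrow> m r * \<alpha> r | Minus r \<Rightarrow> - m r * \<beta> r)" for i
    have "(\<Sum>r\<in>R. m r *\<^sub>R P.vec r) = (\<Sum>r\<in>R. L *\<^sub>R (v r *\<^sub>R M r))"
    proof (rule sum.cong[OF refl])
      fix r assume r: "r \<in> R"
      show "m r *\<^sub>R P.vec r = L *\<^sub>R (v r *\<^sub>R M r)" using \<rho>(1)[OF r] by (simp add: m_def \<rho>(2)[OF r])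
    qed
    also have "\<dots> = L *\<^sub>R M x"
      unfolding v linear_sum[OF M(1)] linear_cmul[OF M(1)] scaleR_sum_right ..
    finally have vec: "(\<Sum>r\<in>R. m r *\<^sub>R P.vec r) = L *\<^sub>R M x" .
    have "(\<Sum>a\<in>B. l'' (Vtx a) *\<^sub>R w' (Vtx a)) = 0"
      using B0 by (intro sum.neutral) (auto simp: l''_def)
    then have "(\<Sum>i\<in>I. l'' i *\<^sub>R w' i) = 0"
      using sx vec B B0 by (subst P.sum_vec[of l'' m]) (auto simp: l''_def)
    then have "l'' (Vtx 0) = 0" by (rule apex) (use B0 in \<open>auto simp: l''_def\<close>)
    then have s0: "s = 0" by (simp add: l''_def)
    then have "M x = 0" using sx L(1) by simp
    then have "x = 0" by (rule M(2)[OF xR])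
    with s0 pm have "lawrence_dependency (insert 0 B) R l" by (simp only: lawrence_dependency_def s_def x_def)
    then show "(\<Sum>i\<in>I. l i *\<^sub>R w i) = 0" by (simp only: dependency)
  qed
  with cpos show ?thesis by blast
qed

end

section \<open>Linear and projective maps from dependencies\<close>

lemma in_span_image:
  assumes "x \<in> span (f ` I)" "finite I"
  obtains l where "x = (\<Sum>i\<in>I. l i *\<^sub>R f i)"
proof -
  let ?T = "{x. \<exists>l. x = (\<Sum>i\<in>I. l i *\<^sub>R f i)}"
  have "subspace ?T"
  proof (rule subspaceI)
    show "0 \<in> ?T" by (auto intro: exI[of _ "\<lambda>_. 0"])
  next
    fix x y assume "x \<in> ?T" "y \<in> ?T"
    then obtain l m where "x = (\<Sum>i\<in>I. l i *\<^sub>R f i)" "y = (\<Sum>i\<in>I. m i *\<^sub>R f i)" by blast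
    then have "x + y = (\<Sum>i\<in>I. (l i + m i) *\<^sub>R f i)" by (simp add: scaleR_add_left sum.distrib)
    then show "x + y \<in> ?T" by (intro CollectI exI)
  next
    fix c x assume "x \<in> ?T"
    then obtain l where "x = (\<Sum>i\<in>I. l i *\<^sub>R f i)" by blast
    then have "c *\<^sub>R x = (\<Sum>i\<in>I. (c * l i) *\<^sub>R f i)" by (simp add: scaleR_sum_right)
    then show "c *\<^sub>R x \<in> ?T" by (intro CollectI exI)
  qed
  moreover have "f i \<in> ?T" if "i \<in> I" for i
  proof -
    have "(\<Sum>j\<in>I. (if j = i then 1 else 0) *\<^sub>R f j) = (\<Sum>j\<in>I. if j = i then f j else 0)"
      by (intro sum.cong) auto
    then have "f i = (\<Sum>j\<in>I. (if j = i then 1 else 0) *\<^sub>R f j)" using assms(2) that by simp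
    then show ?thesis by (intro CollectI exI[of _ "\<lambda>j. if j = i then 1 else 0"])
  qed
  ultimately have "span (f ` I) \<subseteq> ?T" by (intro span_minimal) auto
  then show ?thesis using assms(1) that by blast
qed

text \<open>Define the map on a basis chosen among the \<open>f i\<close>; expanding another
  \<open>f i\<close> in it is a dependency, hence valid for the \<open>g i\<close>. The converse
  implication gives injectivity.\<close>

lemma linear_map_of_dependencies:
  fixes f :: "'i \<Rightarrow> 'a::real_vector" and g :: "'i \<Rightarrow> 'b::real_vector"
  assumes I: "finite I" and dep: "\<And>l. (\<Sum>i\<in>I. l i *\<^sub>R f i) = 0 \<longleftrightarrow> (\<Sum>i\<in>I. l i *\<^sub>R g i) = 0"
  obtains L where "linear L" "\<forall>i\<in>I. L (f i) = g i" "inj_on L (span (f ` I))"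
proof -
  obtain B where B: "B \<subseteq> f ` I" "independent B" "f ` I \<subseteq> span B"
    using maximal_independent_subset[of "f ` I"] by blast
  obtain J where J: "J \<subseteq> I" "inj_on f J" "B = f ` J"
    using B(1) subset_image_inj[of B f I] by blast
  have finJ: "finite J" using I J finite_subset by blast
  obtain L where L: "linear L" "\<forall>b\<in>B. L b = g (the_inv_into J f b)"
    using linear_independent_extend[OF B(2), of "\<lambda>b. g (the_inv_into J f b)"] by blast
  have LJ: "L (f j) = g j" if "j \<in> J" for j
    using L(2) J(3) that the_inv_into_f_f[OF J(2) that] by simp
  have Lf: "L (f i) = g i" if i: "i \<in> I" for i
  proof -
    have "f i \<in> span (f ` J)" using B(3) J(3) i by blast
    then obtain m where m: "f i = (\<Sum>j\<in>J. m j *\<^sub>R f j)" using in_span_image[OF _ finJ] by blast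
    define l where "l k = (if k = i then 1 else 0) - (if k \<in> J then m k else 0)" for k
    have sum: "(\<Sum>k\<in>I. l k *\<^sub>R h k) = h i - (\<Sum>j\<in>J. m j *\<^sub>R h j)" for h :: "'i \<Rightarrow> 'd::real_vector"
    proof -
      have "(\<Sum>k\<in>I. l k *\<^sub>R h k) = (\<Sum>k\<in>I. (if k = i then h k else 0) - (if k \<in> J then m k *\<^sub>R h k else 0))"
        by (intro sum.cong) (auto simp: l_def scaleR_diff_left)
      also have "\<dots> = (\<Sum>k\<in>I. if k = i then h k else 0) - (\<Sum>k\<in>I. if k \<in> J then m k *\<^sub>R h k else 0)"
        by (rule sum_subtractf)
      also have "(\<Sum>k\<in>I. if k = i then h k else 0) = h i" using I i by simp
      also have "(\<Sum>k\<in>I. if k \<in> J then m k *\<^sub>R h k else 0) = (\<Sum>k\<in>J. m k *\<^sub>R h k)"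
        using I J(1) by (simp add: sum.inter_restrict[symmetric] Int_absorb1)
      finally show ?thesis .
    qed
    have "(\<Sum>k\<in>I. l k *\<^sub>R f k) = 0" unfolding sum using m by simp
    then have "(\<Sum>k\<in>I. l k *\<^sub>R g k) = 0" using dep by blast
    then have "g i = (\<Sum>j\<in>J. m j *\<^sub>R g j)" unfolding sum by simp
    also have "\<dots> = L (f i)"
      unfolding m linear_sum[OF L(1)] linear_cmul[OF L(1)] using LJ by (intro sum.cong) auto
    finally show ?thesis ..
  qed
  have "inj_on L (span (f ` I))"
  proof (subst linear_inj_on_iff_eq_0[OF L(1) subspace_span], intro ballI impI)
    fix x assume x: "x \<in> span (f ` I)" "L x = 0"
    obtain l where l: "x = (\<Sum>i\<in>I. l i *\<^sub>R f i)" by (rule in_span_image[OF x(1) I])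
    have "L x = (\<Sum>i\<in>I. l i *\<^sub>R g i)"
      unfolding l linear_sum[OF L(1)] linear_cmul[OF L(1)] using Lf by (intro sum.cong) auto
    then show "x = 0" using x(2) dep[of l] l by simp
  qed
  then show ?thesis using that[OF L(1)] Lf by blast
qed

text \<open>The ambient space may be infinite-dimensional, so surjectivity comes from counting a
  basis of the span of \<open>S\<close>.\<close>

lemma linear_inj_on_span_imp_bij_betw:
  fixes L :: "'a::real_vector \<Rightarrow> 'a"
  assumes S: "finite S" and L: "linear L" "inj_on L (span S)" "L ` S \<subseteq> span S"
  shows "bij_betw L (span S) (span S)"
proof -
  obtain B where B: "B \<subseteq> S" "independent B" "S \<subseteq> span B"
    using maximal_independent_subset[of S] by blast
  have finB: "finite B" using B(1) S finite_subset by blast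
  have spB: "span B = span S" 
    using span_mono[OF B(1)] span_minimal[OF B(3) subspace_span] by blast
  have sub: "L ` span S \<subseteq> span S"
    unfolding linear_span_image[OF L(1), symmetric] using L(3) by (simp add: span_minimal)
  have injB: "inj_on L (span B)" using L(2) spB by simp
  have ind: "independent (L ` B)" by (rule linear_independent_injective_image[OF L(1) B(2) injB])
  have card: "card (L ` B) = card B"
    using injB inj_on_subset span_superset by (intro card_image) blast
  have "span S \<subseteq> span (L ` B)"
  proof (rule ccontr)
    assume "\<not> span S \<subseteq> span (L ` B)"
    then obtain v where v: "v \<in> span S" "v \<notin> span (L ` B)" by blast
    have "independent (insert v (L ` B))" using ind v(2) by (simp add: independent_insert)
    moreover have "insert v (L ` B) \<subseteq> span B"
      using v(1) sub spB span_superset[of B] by auto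
    ultimately have "card (insert v (L ` B)) \<le> card B" using independent_span_bound[OF finB] by blast
    moreover have "v \<notin> L ` B" using v(2) span_base[of v "L ` B"] by blast
    ultimately show False using card finB by simp
  qed
  also have "\<dots> = L ` span S" using linear_span_image[OF L(1)] spB by simp
  finally show ?thesis using sub L(2) by (auto simp: bij_betw_def)
qed

text \<open>Weights \<open>u i\<close> become proportional to \<open>u i * c i\<close>. Positive
  factors keep the hull away from the hyperplane sent to infinity.\<close>

lemma proj_app_convex_hull:
  fixes x :: "'i \<Rightarrow> 'a::real_vector" and y :: "'i \<Rightarrow> 'b::real_vector"
  assumes L: "linear L" and S: "finite S" and c: "\<And>i. i \<in> S \<Longrightarrow> c i > 0"
    and Lx: "\<And>i. i \<in> S \<Longrightarrow> L (x i, 1) = c i *\<^sub>R (y i, 1::real)"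
  shows "proj_defined_on L (convex hull (x ` S))"
    and "proj_app L ` (convex hull (x ` S)) = convex hull (y ` S)"
proof -
  have Lc: "L (\<Sum>i\<in>S. u i *\<^sub>R x i, 1) = (\<Sum>i\<in>S. (u i * c i) *\<^sub>R y i, \<Sum>i\<in>S. u i * c i)"
    if u: "(\<Sum>i\<in>S. u i) = 1" for u
  proof -
    have "(\<Sum>i\<in>S. u i *\<^sub>R x i, 1) = (\<Sum>i\<in>S. u i *\<^sub>R (x i, 1::real))"
      unfolding sum_lift u ..
    then have "L (\<Sum>i\<in>S. u i *\<^sub>R x i, 1) = (\<Sum>i\<in>S. u i *\<^sub>R L (x i, 1))"
      by (simp only: linear_sum[OF L] linear_cmul[OF L])
    also have "\<dots> = (\<Sum>i\<in>S. (u i * c i) *\<^sub>R (y i, 1::real))"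
      using Lx by (intro sum.cong) auto
    finally show ?thesis unfolding sum_lift .
  qed
  have pos: "(\<Sum>i\<in>S. u i * c i) > 0" if u: "\<forall>i\<in>S. u i \<ge> 0" "(\<Sum>i\<in>S. u i) = 1" for u
  proof -
    obtain i where i: "i \<in> S" "u i \<noteq> 0" using u(2) by (metis sum.neutral zero_neq_one)
    have "u i * c i > 0" using u(1) i c[OF i(1)] by (simp add: order_less_le)
    then show ?thesis
      using S i u(1) c by (intro sum_pos2[of S i]) (auto intro: mult_nonneg_nonneg less_imp_le)
  qed
  show "proj_defined_on L (convex hull (x ` S))"
    unfolding proj_defined_on_def
  proof
    fix p assume "p \<in> convex hull (x ` S)"
    then obtain u where u: "\<forall>i\<in>S. u i \<ge> 0" "(\<Sum>i\<in>S. u i) = 1" "p = (\<Sum>i\<in>S. u i *\<^sub>R x i)"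
      by (rule in_convex_hull_image[OF S])
    show "snd (L (p, 1)) \<noteq> 0" unfolding u(3) Lc[OF u(2)] using pos[OF u(1,2)] by simp
  qed
  have app: "proj_app L (\<Sum>i\<in>S. u i *\<^sub>R x i) = (\<Sum>i\<in>S. (u i * c i / (\<Sum>i\<in>S. u i * c i)) *\<^sub>R y i)"
    if u: "(\<Sum>i\<in>S. u i) = 1" for u
    unfolding proj_app_def Lc[OF u] by (simp add: scaleR_sum_right divide_inverse mult.commute)
  show "proj_app L ` (convex hull (x ` S)) = convex hull (y ` S)"
  proof (intro equalityI subsetI)
    fix q assume "q \<in> proj_app L ` (convex hull (x ` S))"
    then obtain p where p: "p \<in> convex hull (x ` S)" "q = proj_app L p" by blast
    obtain u where u: "\<forall>i\<in>S. u i \<ge> 0" "(\<Sum>i\<in>S. u i) = 1" "p = (\<Sum>i\<in>S. u i *\<^sub>R x i)"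
      using p(1) by (rule in_convex_hull_image[OF S])
    have "(\<Sum>i\<in>S. (u i * c i / (\<Sum>i\<in>S. u i * c i)) *\<^sub>R y i) \<in> convex hull (y ` S)"
    proof (rule convex_sum[OF S])
      show "(\<Sum>i\<in>S. u i * c i / (\<Sum>i\<in>S. u i * c i)) = 1"
        using pos[OF u(1,2)] by (simp add: sum_divide_distrib[symmetric])
      show "0 \<le> u i * c i / (\<Sum>i\<in>S. u i * c i)" if "i \<in> S" for i
        using pos[OF u(1,2)] u(1) c[OF that] that by (simp add: less_imp_le)
    qed (auto intro: hull_inc)
    then show "q \<in> convex hull (y ` S)" unfolding p(2) u(3) app[OF u(2)] .
  next
    fix q assume "q \<in> convex hull (y ` S)"
    then obtain v where v: "\<forall>i\<in>S. v i \<ge> 0" "(\<Sum>i\<in>S. v i) = 1" "q = (\<Sum>i\<in>S. v i *\<^sub>R y i)"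
      by (rule in_convex_hull_image[OF S])
    define t where "t = (\<Sum>i\<in>S. v i / c i)"
    have "t > 0"
    proof -
      obtain i where i: "i \<in> S" "v i \<noteq> 0" using v(2) by (metis sum.neutral zero_neq_one)
      have "v i / c i > 0" using v(1) i c[OF i(1)] by (simp add: order_less_le)
      then show ?thesis
        unfolding t_def using S i v(1) c
        by (intro sum_pos2[of S i]) (auto intro: divide_nonneg_pos)
    qed
    \<comment> \<open>The inverse of the change of weights, normalized by \<open>t\<close>.\<close>
    define u where "u i = v i / c i / t" for i
    have u1: "(\<Sum>i\<in>S. u i) = 1"
      unfolding u_def sum_divide_distrib[symmetric] t_def[symmetric] using \<open>t > 0\<close> by simp
    have uc: "u i * c i = v i / t" if "i \<in> S" for i
      using c[OF that] by (simp add: u_def)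
    have s: "(\<Sum>i\<in>S. u i * c i) = 1 / t"
      using uc v(2) by (simp add: sum_divide_distrib[symmetric])
    have "(\<Sum>i\<in>S. u i *\<^sub>R x i) \<in> convex hull (x ` S)"
      by (rule convex_sum[OF S _ u1])
        (use v(1) c \<open>t > 0\<close> in \<open>auto simp: u_def less_imp_le intro: hull_inc\<close>)
    moreover have "proj_app L (\<Sum>i\<in>S. u i *\<^sub>R x i) = q"
      unfolding app[OF u1] s v(3) using uc \<open>t > 0\<close> by (intro sum.cong) auto
    ultimately show "q \<in> proj_app L ` (convex hull (x ` S))" by blast
  qed
qed

section \<open>Coordinates of finitely supported sequences\<close>

lemma lookup_scaleR [simp]:
  "Poly_Mapping.lookup (c *\<^sub>R x) i = c * Poly_Mapping.lookup (x :: 'a \<Rightarrow>\<^sub>0 real) i"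
proof -
  have "finite {i. c *\<^sub>R Poly_Mapping.lookup x i \<noteq> 0}"
    by (rule finite_subset[OF _ finite_keys[of x]]) (auto simp: in_keys_iff)
  then show ?thesis by (simp add: scaleR_poly_mapping_def)
qed

lemma linear_lookup: "linear (\<lambda>x :: 'a \<Rightarrow>\<^sub>0 real. Poly_Mapping.lookup x i)"
  by (rule linearI) (simp_all add: lookup_add)

lemma lookup_eq_0_if_eucl: "x \<in> eucl d \<Longrightarrow> d \<le> i \<Longrightarrow> Poly_Mapping.lookup x i = 0"
  by (auto simp: eucl_def in_keys_iff subset_iff)

lemma eucl_mono: "d \<le> n \<Longrightarrow> eucl d \<subseteq> eucl n"
  by (auto simp: eucl_def)

lemma single_in_eucl [simp]: "i < d \<Longrightarrow> Poly_Mapping.single i c \<in> eucl d"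
  by (auto simp: eucl_def)

abbreviation unit_vector :: "nat \<Rightarrow> nat \<Rightarrow>\<^sub>0 real" where
  "unit_vector i \<equiv> Poly_Mapping.single i 1"

lemma eucl_expansion:
  assumes "x \<in> eucl d"
  shows "x = (\<Sum>i<d. Poly_Mapping.lookup x i *\<^sub>R unit_vector i)"
proof (rule poly_mapping_eqI)
  fix k
  have "Poly_Mapping.lookup (\<Sum>i<d. Poly_Mapping.lookup x i *\<^sub>R unit_vector i) k
      = (\<Sum>i<d. if i = k then Poly_Mapping.lookup x k else 0)"
    unfolding linear_sum[OF linear_lookup] by (intro sum.cong) (auto simp: lookup_single)
  also have "\<dots> = Poly_Mapping.lookup x k"
    using lookup_eq_0_if_eucl[OF assms, of k] by simp
  finally show "Poly_Mapping.lookup x k = Poly_Mapping.lookup (\<Sum>i<d. Poly_Mapping.lookup x i *\<^sub>R unit_vector i) k" ..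
qed

lemma projectively_equivalent_translation:
  fixes P :: "'a::real_vector set"
  shows "projectively_equivalent P ((\<lambda>x. x + v) ` P)"
proof -
  \<comment> \<open>In homogeneous coordinates a translation is a shear.\<close>
  define L where "L p = (fst p + snd p *\<^sub>R v, snd p)" for p :: "'a \<times> real"
  have L: "linear L" by (rule linearI) (auto simp: L_def algebra_simps)
  have "inj L" by (rule injI) (auto simp: L_def prod_eq_iff)
  have "L ` ((affine hull P) \<times> {1}) = (affine hull ((\<lambda>x. x + v) ` P)) \<times> {1}"
  proof -
    have "affine hull ((\<lambda>x. x + v) ` P) = (\<lambda>x. x + v) ` (affine hull P)"
      using affine_hull_translation[of v P] by (simp add: add.commute)
    then show ?thesis by (auto simp: L_def image_iff)
  qed
  then have "L ` homogenization (affine hull P) = homogenization (affine hull ((\<lambda>x. x + v) ` P))"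
    unfolding homogenization_def linear_span_image[OF L, symmetric] by simp
  then have "projective_transformation L (affine hull P) (affine hull ((\<lambda>x. x + v) ` P))"
    using L \<open>inj L\<close> by (auto simp: projective_transformation_def bij_betw_def intro: inj_on_subset)
  moreover have "proj_defined_on L P" "proj_app L ` P = (\<lambda>x. x + v) ` P"
    by (auto simp: proj_defined_on_def proj_app_def L_def)
  ultimately show ?thesis unfolding projectively_equivalent_def by blast
qed

section \<open>The construction\<close>

text \<open>\<open>1\<close> is the form to which the simplifier brings
  \<open>unit_vector 0\<close>.\<close>

lemma one_in_eucl [simp]: "0 < d \<Longrightarrow> (1 :: nat \<Rightarrow>\<^sub>0 real) \<in> eucl d"
  using single_in_eucl[of 0 d 1] by simp

locale universal_construction =
  fixes d :: nat and V :: "(nat \<Rightarrow>\<^sub>0 real) set" and X :: "real set"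
  assumes V: "finite V" "V \<subseteq> eucl d" "\<And>v. v \<in> V \<Longrightarrow> v \<notin> convex hull (V - {v})"
    and X: "finite X" "hom_rigid X" "\<And>v k. v \<in> V \<Longrightarrow> k < d \<Longrightarrow> - Poly_Mapping.lookup v k \<in> X"
begin

definition B :: "(nat \<Rightarrow>\<^sub>0 real) set" where
  "B = (\<lambda>v. v + unit_vector d) ` V"

text \<open>Coordinates below \<open>d\<close> carry the polytope and coordinate \<open>d\<close>
  its height; two more guarantee three indices even for \<open>d = 0\<close>. Including
  \<open>B\<close> gives each base vertex a pair along its own ray.\<close>

definition R :: "(nat \<Rightarrow>\<^sub>0 real) set" where
  "R = (\<lambda>(i, j, x). unit_vector i - x *\<^sub>R unit_vector j) ` {(i, j, x). i < d + 3 \<and> j < d + 3 \<and> i \<noteq> j \<and> x \<in> X} \<union>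
       (\<lambda>(x, y). unit_vector 0 - x *\<^sub>R unit_vector 1 - y *\<^sub>R unit_vector 2) ` (X \<times> X) \<union> B"

abbreviation height :: "(nat \<Rightarrow>\<^sub>0 real) \<Rightarrow> real" where
  "height x \<equiv> Poly_Mapping.lookup x d"

definition index :: "(nat \<Rightarrow>\<^sub>0 real) \<Rightarrow> nat" where
  "index = (SOME f. bij_betw f R {..<card R})"

abbreviation dimension :: nat where
  "dimension \<equiv> d + 3 + card R"

definition extra_unit :: "(nat \<Rightarrow>\<^sub>0 real) \<Rightarrow> (nat \<Rightarrow>\<^sub>0 real)" where
  "extra_unit r = unit_vector (d + 3 + index r)"

definition pt :: "(nat \<Rightarrow>\<^sub>0 real) vert \<Rightarrow> (nat \<Rightarrow>\<^sub>0 real)" where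
  "pt i = (case i of Vtx a \<Rightarrow> a | Plus r \<Rightarrow> r + extra_unit r | Minus r \<Rightarrow> - r + extra_unit r)"

lemma pt_simps [simp]:
  "pt (Vtx a) = a" "pt (Plus r) = r + extra_unit r" "pt (Minus r) = - r + extra_unit r"
  by (simp_all add: pt_def)

lemma X01: "0 \<in> X" "1 \<in> X" using X(2) by (auto simp: hom_rigid_def)

lemma finite_B: "finite B" using V by (simp add: B_def)

lemma finite_R: "finite R"
proof -
  have "{(i, j, x). i < d + 3 \<and> j < d + 3 \<and> i \<noteq> j \<and> x \<in> X} \<subseteq> {..<d + 3} \<times> {..<d + 3} \<times> X" by auto
  then have "finite {(i, j, x). i < d + 3 \<and> j < d + 3 \<and> i \<noteq> j \<and> x \<in> X}"
    using finite_subset X(1) by blast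
  then show ?thesis using X(1) finite_B by (simp add: R_def)
qed

lemma R_pair: "i < d + 3 \<Longrightarrow> j < d + 3 \<Longrightarrow> i \<noteq> j \<Longrightarrow> x \<in> X \<Longrightarrow> unit_vector i - x *\<^sub>R unit_vector j \<in> R"
  unfolding R_def by (intro UnI1 image_eqI[of _ _ "(i, j, x)"]) auto

lemma R_triple: "x \<in> X \<Longrightarrow> y \<in> X \<Longrightarrow> unit_vector 0 - x *\<^sub>R unit_vector 1 - y *\<^sub>R unit_vector 2 \<in> R"
  unfolding R_def by (intro UnI1 UnI2 image_eqI[of _ _ "(x, y)"]) auto

lemma B_subset_R: "B \<subseteq> R" by (simp add: R_def)

lemma unit_vector_in_R: "i < d + 3 \<Longrightarrow> unit_vector i \<in> R"
  using R_pair[of i "if i = 0 then 1 else 0" 0] X01 by (cases "i = 0") auto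

lemma R_cases:
  assumes "r \<in> R"
  obtains i j x where "i < d + 3" "j < d + 3" "i \<noteq> j" "x \<in> X" "r = unit_vector i - x *\<^sub>R unit_vector j"
  | x y where "x \<in> X" "y \<in> X" "r = unit_vector 0 - x *\<^sub>R unit_vector 1 - y *\<^sub>R unit_vector 2"
  | v where "v \<in> V" "r = v + unit_vector d"
  using assms unfolding R_def B_def by auto

lemma R_eucl: "R \<subseteq> eucl (d + 3)"
proof
  fix r assume "r \<in> R"
  then show "r \<in> eucl (d + 3)"
  proof (cases rule: R_cases)
    case (3 v)
    then have "v \<in> eucl (d + 3)" using V(2) eucl_mono[of d "d + 3"] by auto
    then show ?thesis using 3 by (auto intro: subspace_add[OF subspace_eucl])
  qed (auto intro!: subspace_diff[OF subspace_eucl] subspace_scale[OF subspace_eucl])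
qed

lemma lookup_V: "v \<in> V \<Longrightarrow> d \<le> i \<Longrightarrow> Poly_Mapping.lookup v i = 0"
  using V(2) lookup_eq_0_if_eucl by blast

lemma height_B: "b \<in> B \<Longrightarrow> height b = 1"
  by (auto simp: B_def lookup_add lookup_single lookup_V)

lemma zero_notin_R: "0 \<notin> R"
proof
  assume "0 \<in> R"
  then show False
  proof (cases rule: R_cases)
    case (1 i j x)
    from arg_cong[OF 1(5), of "\<lambda>r. Poly_Mapping.lookup r i"] 1(3) show ?thesis
      by (simp add: lookup_minus lookup_single)
  next
    case (2 x y)
    from arg_cong[OF 2(3), of "\<lambda>r. Poly_Mapping.lookup r 0"] show ?thesis
      by (simp add: lookup_minus lookup_single)
  next
    case (3 v)
    from arg_cong[OF 3(2), of height] 3(1) show ?thesis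
      by (simp add: lookup_add lookup_single lookup_V)
  qed
qed

lemma B_vertex: "b \<in> B \<Longrightarrow> b \<notin> convex hull (B - {b})"
proof
  assume b: "b \<in> B" "b \<in> convex hull (B - {b})"
  then obtain v where v: "v \<in> V" "b = v + unit_vector d" by (auto simp: B_def)
  have "B - {b} = (\<lambda>x. unit_vector d + x) ` (V - {v})" using v by (auto simp: B_def add.commute)
  then have "b \<in> (\<lambda>x. unit_vector d + x) ` (convex hull (V - {v}))"
    using b(2) by (simp add: convex_hull_translation)
  then have "v \<in> convex hull (V - {v})" using v(2) by (auto simp: add.commute)
  then show False using V(3) v(1) by blast
qed

text \<open>Such a difference has only the first \<open>d\<close> coordinates, and the unit vectors
  there are directions of height zero.\<close>

lemma B_diff: "a \<in> B \<Longrightarrow> b \<in> B \<Longrightarrow> a - b \<in> span {r \<in> R. height r = 0}"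
proof -
  assume "a \<in> B" "b \<in> B"
  then obtain u v where "u \<in> V" "v \<in> V" "a - b = u - v" by (auto simp: B_def)
  then have "a - b \<in> eucl d" using V(2) by (auto intro: subspace_diff[OF subspace_eucl])
  then have "a - b = (\<Sum>i<d. Poly_Mapping.lookup (a - b) i *\<^sub>R unit_vector i)" by (rule eucl_expansion)
  moreover have "(\<Sum>i<d. Poly_Mapping.lookup (a - b) i *\<^sub>R unit_vector i) \<in> span {r \<in> R. height r = 0}"
    by (intro span_sum span_scale span_base) (auto simp: unit_vector_in_R lookup_single)
  ultimately show ?thesis by simp
qed

lemma index_bij: "bij_betw index R {..<card R}"
  unfolding index_def using ex_bij_betw_finite_nat[OF finite_R]
  by (intro someI_ex[of "\<lambda>f. bij_betw f R {..<card R}"]) (simp add: atLeast0LessThan)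

lemma index_less: "r \<in> R \<Longrightarrow> index r < card R"
  using bij_betwE[OF index_bij] by simp

lemma lookup_extra_unit: "r \<in> R \<Longrightarrow> s \<in> R \<Longrightarrow> Poly_Mapping.lookup (extra_unit r) (d + 3 + index s) = (if r = s then 1 else 0)"
  using bij_betw_imp_inj_on[OF index_bij] by (auto simp: extra_unit_def lookup_single when_def inj_on_def)

lemma sum_pt:
  "(\<Sum>i\<in>verts (insert 0 B) R. l i *\<^sub>R pt i) = (\<Sum>a\<in>insert 0 B. l (Vtx a) *\<^sub>R a) +
     (\<Sum>r\<in>R. (l (Plus r) - l (Minus r)) *\<^sub>R r) + (\<Sum>r\<in>R. (l (Plus r) + l (Minus r)) *\<^sub>R extra_unit r)"
proof -
  have "l (Plus r) *\<^sub>R (r + extra_unit r) + l (Minus r) *\<^sub>R (- r + extra_unit r) =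
      (l (Plus r) - l (Minus r)) *\<^sub>R r + (l (Plus r) + l (Minus r)) *\<^sub>R extra_unit r" for r
    by (simp add: algebra_simps)
  then show ?thesis
    by (simp add: sum_verts[OF finite.insertI[OF finite_B] finite_R] sum.distrib add.assoc)
qed

lemma dependency_pt:
  "(\<Sum>i\<in>verts (insert 0 B) R. l i *\<^sub>R (pt i, 1::real)) = 0 \<longleftrightarrow> lawrence_dependency (insert 0 B) R l"
proof
  have A: "(\<Sum>i\<in>verts (insert 0 B) R. l i) = (\<Sum>a\<in>insert 0 B. l (Vtx a)) + (\<Sum>r\<in>R. l (Plus r) + l (Minus r))"
    by (rule sum_verts[OF finite.insertI[OF finite_B] finite_R])
  {
    assume "(\<Sum>i\<in>verts (insert 0 B) R. l i *\<^sub>R (pt i, 1::real)) = 0"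
    then have s: "(\<Sum>i\<in>verts (insert 0 B) R. l i *\<^sub>R pt i) = 0" "(\<Sum>i\<in>verts (insert 0 B) R. l i) = 0"
      unfolding sum_lift by (simp_all add: zero_prod_def)
    have pm: "l (Plus s) + l (Minus s) = 0" if s: "s \<in> R" for s
    proof -
      \<comment> \<open>Base vertices and directions vanish in the coordinate reserved for
        \<open>s\<close>, so it sees only the pair of \<open>s\<close>.\<close>
      have van: "Poly_Mapping.lookup x (d + 3 + index s) = 0" if "x \<in> insert 0 R" for x
        using R_eucl that lookup_eq_0_if_eucl[of x "d + 3"] by auto
      have "(\<Sum>a\<in>insert 0 B. l (Vtx a) * Poly_Mapping.lookup a (d + 3 + index s)) = 0"
        using van B_subset_R by (intro sum.neutral) auto
      moreover have "(\<Sum>r\<in>R. (l (Plus r) - l (Minus r)) * Poly_Mapping.lookup r (d + 3 + index s)) = 0"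
        using van by (intro sum.neutral) auto
      ultimately have "Poly_Mapping.lookup (\<Sum>i\<in>verts (insert 0 B) R. l i *\<^sub>R pt i) (d + 3 + index s) =
          (\<Sum>r\<in>R. (l (Plus r) + l (Minus r)) * Poly_Mapping.lookup (extra_unit r) (d + 3 + index s))"
        unfolding sum_pt lookup_add linear_sum[OF linear_lookup] lookup_scaleR
        by (simp only: add_0)
      also have "\<dots> = (\<Sum>r\<in>R. if r = s then l (Plus s) + l (Minus s) else 0)"
        using s by (intro sum.cong) (auto simp: lookup_extra_unit)
      also have "\<dots> = l (Plus s) + l (Minus s)" using s finite_R by simp
      finally show ?thesis using \<open>(\<Sum>i\<in>verts (insert 0 B) R. l i *\<^sub>R pt i) = 0\<close> by simp
    qed
    then have "(\<Sum>r\<in>R. (l (Plus r) + l (Minus r)) *\<^sub>R extra_unit r) = 0" "(\<Sum>r\<in>R. l (Plus r) + l (Minus r)) = 0"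
      by simp_all
    then show "lawrence_dependency (insert 0 B) R l"
      using s pm unfolding sum_pt A lawrence_dependency_def by simp
  }
  {
    assume l: "lawrence_dependency (insert 0 B) R l"
    then have "(\<Sum>r\<in>R. (l (Plus r) + l (Minus r)) *\<^sub>R extra_unit r) = 0" "(\<Sum>r\<in>R. l (Plus r) + l (Minus r)) = 0"
      by (simp_all add: lawrence_dependency_def)
    then show "(\<Sum>i\<in>verts (insert 0 B) R. l i *\<^sub>R (pt i, 1::real)) = 0"
      using l unfolding sum_lift sum_pt A lawrence_dependency_def by (simp add: zero_prod_def)
  }
qed

sublocale lawrence_extension B R height "\<lambda>i. (pt i, 1::real)"
proof (rule lawrence_extension.intro)
  show "linear height" by (rule linear_lookup)
qed (use finite_B finite_R height_B B_subset_R zero_notin_R B_vertex B_diff dependency_pt in auto)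

lemma finite_I: "finite I" using finite_B finite_R by (simp add: finite_verts)

lemma extra_unit_eucl: "r \<in> R \<Longrightarrow> extra_unit r \<in> eucl dimension"
  using index_less by (simp add: extra_unit_def)

lemma R_eucl_dimension: "R \<subseteq> eucl dimension"
  using R_eucl eucl_mono[of "d + 3" dimension] by auto

lemma pt_eucl: "i \<in> I \<Longrightarrow> pt i \<in> eucl dimension"
proof (cases i)
  case (Vtx a)
  assume "i \<in> I"
  then show ?thesis
    using Vtx B_subset_R R_eucl_dimension subspace_0[OF subspace_eucl] by auto
qed (use R_eucl_dimension extra_unit_eucl in \<open>auto intro!: subspace_add[OF subspace_eucl] subspace_diff[OF subspace_eucl]\<close>)

text \<open>The polytope is full-dimensional, so a linear map fixed on the homogenized vertices is a
  transformation of the whole space.\<close>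

lemma span_pt: "span ((\<lambda>i. (pt i, 1::real)) ` I) = eucl dimension \<times> UNIV"
proof
  have "subspace (eucl dimension \<times> (UNIV :: real set))"
    using subspace_eucl by (intro subspace_Times) auto
  then show "span ((\<lambda>i. (pt i, 1::real)) ` I) \<subseteq> eucl dimension \<times> UNIV"
    using pt_eucl by (intro span_minimal) auto
next
  let ?S = "span ((\<lambda>i. (pt i, 1::real)) ` I)"
  have pt: "(pt i, 1) \<in> ?S" if "i \<in> I" for i using that by (intro span_base) auto
  have 1: "(0, 1) \<in> ?S" using pt[of "Vtx 0"] by simp
  have r: "(r, 0) \<in> ?S" if "r \<in> R" for r
  proof -
    have "(pt (Plus r), 1::real) - (pt (Minus r), 1) = 2 *\<^sub>R (r, 0)"
      by (simp add: prod_eq_iff scaleR_2)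
    then have "(r, 0) = (1 / 2) *\<^sub>R ((pt (Plus r), 1::real) - (pt (Minus r), 1))"
      by (simp only: scaleR_scaleR) simp
    moreover have "(1 / 2) *\<^sub>R ((pt (Plus r), 1::real) - (pt (Minus r), 1)) \<in> ?S"
      by (intro span_scale span_diff pt) (use that in simp_all)
    ultimately show ?thesis by (simp only:)
  qed
  have ap: "(extra_unit r, 0) \<in> ?S" if "r \<in> R" for r
  proof -
    have "(extra_unit r, 0) = (pt (Plus r), 1::real) - (r, 0) - (0, 1)" by simp
    then show ?thesis using pt[of "Plus r"] r[OF that] 1 that by (metis span_diff verts_simps(2))
  qed
  have unit: "(unit_vector k, 0) \<in> ?S" if k: "k < dimension" for k
  proof (cases "k < d + 3")
    case True
    then show ?thesis using r unit_vector_in_R by blast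
  next
    case False
    then have "k - (d + 3) \<in> index ` R"
      using k bij_betw_imp_surj_on[OF index_bij] by auto
    then obtain r where "r \<in> R" "k = d + 3 + index r" using False by auto
    then show ?thesis using ap[of r] by (simp add: extra_unit_def)
  qed
  show "eucl dimension \<times> UNIV \<subseteq> ?S"
  proof clarify
    fix x :: "nat \<Rightarrow>\<^sub>0 real" and t :: real assume x: "x \<in> eucl dimension"
    have "(x, t) = (\<Sum>k<dimension. Poly_Mapping.lookup x k *\<^sub>R (unit_vector k, 0)) + t *\<^sub>R (0, 1)"
    proof -
      have "(\<Sum>k<dimension. Poly_Mapping.lookup x k *\<^sub>R (unit_vector k, 0::real)) = (x, 0)"
        by (subst (2) eucl_expansion[OF x]) (simp add: prod_eq_iff fst_sum snd_sum)
      then show ?thesis by simp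
    qed
    also have "\<dots> \<in> ?S"
      using unit 1 by (intro span_add span_sum span_scale) auto
    finally show "(x, t) \<in> ?S" .
  qed
qed

lemma rigid:
  assumes fac: "\<And>S. S \<subseteq> I \<Longrightarrow> facial I (\<lambda>i. (pt i, 1::real)) S \<longleftrightarrow> facial I w' S"
  shows "\<exists>c. (\<forall>i\<in>I. c i > 0) \<and>
    (\<forall>l. (\<Sum>i\<in>I. l i *\<^sub>R (pt i, 1::real)) = 0 \<longleftrightarrow> (\<Sum>i\<in>I. (l i * c i) *\<^sub>R w' i) = 0)"
proof -
  obtain \<alpha> \<beta> where ab: "lawrence_pairs (insert 0 B) R w' \<alpha> \<beta>"
    "conformally_covered R (\<lambda>r. r) (lawrence_pairs.vec w' \<alpha> \<beta>)"
    "conformally_covered R (lawrence_pairs.vec w' \<alpha> \<beta>) (\<lambda>r. r)"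
    using facially_equivalent_pairs[OF fac] by blast
  note coordinate = X(3)
  interpret von_staudt_configuration "d + 3" unit_vector X R "lawrence_pairs.vec w' \<alpha> \<beta>"
    "\<lambda>i x. Poly_Mapping.lookup x i"
  proof (rule von_staudt_configuration.intro)
    show "linear (\<lambda>x :: nat \<Rightarrow>\<^sub>0 real. Poly_Mapping.lookup x i)" for i by (rule linear_lookup)
    show "Poly_Mapping.lookup (unit_vector j) i = (if i = j then 1 else 0)" for i j
      by (simp add: lookup_single when_def)
  qed (use X finite_R R_pair R_triple ab in auto)
  have cases: "(\<exists>i j x. i < d + 3 \<and> j < d + 3 \<and> i \<noteq> j \<and> x \<in> X \<and> r = unit_vector i - x *\<^sub>R unit_vector j) \<or>
      (\<exists>x y. x \<in> X \<and> y \<in> X \<and> r = unit_vector 0 - x *\<^sub>R unit_vector 1 - y *\<^sub>R unit_vector 2) \<or>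
      (\<exists>p a. p < d + 3 \<and> r = unit_vector p + (\<Sum>k\<in>{..<d + 3} - {p}. a k *\<^sub>R unit_vector k) \<and>
        (\<forall>k<d + 3. k \<noteq> p \<longrightarrow> - a k \<in> X))" if "r \<in> R" for r
    using that
    proof (cases rule: R_cases)
      case (3 v)
      \<comment> \<open>The height \<open>d\<close> serves as \<open>p\<close>, since a base vertex
        has coefficient \<open>1\<close> there.\<close>
      define a where "a k = (if k < d then Poly_Mapping.lookup v k else 0)" for k
      have "(\<Sum>k\<in>{..<d + 3} - {d}. a k *\<^sub>R unit_vector k) = (\<Sum>k<d. a k *\<^sub>R unit_vector k)"
        by (intro sum.mono_neutral_right) (auto simp: a_def)
      also have "\<dots> = (\<Sum>k<d. Poly_Mapping.lookup v k *\<^sub>R unit_vector k)"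
        by (intro sum.cong) (auto simp: a_def)
      also have "\<dots> = v" using eucl_expansion[of v d] V(2) 3(1) by auto
      finally have "r = unit_vector d + (\<Sum>k\<in>{..<d + 3} - {d}. a k *\<^sub>R unit_vector k)"
        using 3(2) by (simp add: add.commute)
      moreover have "\<forall>k<d + 3. k \<noteq> d \<longrightarrow> - a k \<in> X"
        using coordinate[OF 3(1)] X01 by (simp add: a_def)
      ultimately show ?thesis by (intro disjI2 exI[of _ d] exI[of _ a]) simp
    qed blast+
  obtain M where M: "linear M" "independent_family {..<d + 3} (\<lambda>i. M (unit_vector i))"
    "\<forall>r\<in>R. \<exists>c>0. lawrence_pairs.vec w' \<alpha> \<beta> r = c *\<^sub>R M r"
    by (rule linear_up_to_scaling[OF cases])
  have "x = 0" if x: "x \<in> span R" "M x = 0" for x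
  proof -
    have xe: "x \<in> eucl (d + 3)" using span_minimal[OF R_eucl subspace_eucl] x(1) by blast
    have "M x = (\<Sum>i<d + 3. Poly_Mapping.lookup x i *\<^sub>R M (unit_vector i))"
      by (subst eucl_expansion[OF xe]) (simp only: linear_sum[OF M(1)] linear_cmul[OF M(1)])
    then have "Poly_Mapping.lookup x i = 0" if "i < d + 3" for i
      using independent_familyD[OF M(2), of "Poly_Mapping.lookup x" i] x(2) that by simp
    then have "(\<Sum>i<d + 3. Poly_Mapping.lookup x i *\<^sub>R unit_vector i) = 0" by simp
    then show ?thesis using eucl_expansion[OF xe] by simp
  qed
  then show ?thesis using rigidity[OF fac ab(1) M(1) _ bspec[OF M(3)]] by blast
qed

definition polytope_hat :: "(nat \<Rightarrow>\<^sub>0 real) set" where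
  "polytope_hat = convex hull (pt ` I)"

lemma polytope_in_hat: "polytope_in dimension polytope_hat"
proof -
  have "pt ` I \<subseteq> eucl dimension" using pt_eucl by auto
  then have "polytope_hat \<subseteq> eucl dimension"
    unfolding polytope_hat_def
    by (rule hull_minimal) (rule subspace_imp_convex[OF subspace_eucl])
  then show ?thesis
    unfolding polytope_in_def polytope_def polytope_hat_def using finite_I by blast
qed

lemma projectively_unique_hat: "projectively_unique_in dimension polytope_hat"
  unfolding projectively_unique_in_def
proof (intro conjI allI impI)
  show "polytope_in dimension polytope_hat" by (rule polytope_in_hat)
  fix P' \<phi> assume P': "polytope_in dimension P'" and iso: "combinatorial_isomorphism \<phi> polytope_hat P'"
  have "polytope P'" using P' by (simp add: polytope_in_def)
  obtain y where y: "P' = convex hull (y ` I)"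
    "\<And>S. S \<subseteq> I \<Longrightarrow> facial I (\<lambda>i. (pt i, 1::real)) S \<longleftrightarrow> facial I (\<lambda>i. (y i, 1::real)) S"
    "\<And>F. F face_of polytope_hat \<Longrightarrow> \<phi> F = convex hull (y ` {i \<in> I. pt i \<in> F})"
    "\<And>F. F face_of polytope_hat \<Longrightarrow> F = convex hull (pt ` {i \<in> I. pt i \<in> F})"
    unfolding polytope_hat_def
    using combinatorial_isomorphism_facial[OF finite_I facial_singleton \<open>polytope P'\<close> iso[unfolded polytope_hat_def]]
    by blast
  obtain c where c: "\<forall>i\<in>I. c i > 0" "\<forall>l. (\<Sum>i\<in>I. l i *\<^sub>R (pt i, 1::real)) = 0 \<longleftrightarrow> (\<Sum>i\<in>I. (l i * c i) *\<^sub>R (y i, 1::real)) = 0"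
    using rigid[of "\<lambda>i. (y i, 1::real)"] y(2) by blast
  \<comment> \<open>The factors move into the vectors, so the linear map will hit rescaled
    homogenized vertices of \<open>P'\<close>.\<close>
  have dep: "(\<Sum>i\<in>I. l i *\<^sub>R (pt i, 1::real)) = 0 \<longleftrightarrow> (\<Sum>i\<in>I. l i *\<^sub>R (c i *\<^sub>R (y i, 1::real))) = 0" for l
    using spec[OF c(2), of l] by (simp only: scaleR_scaleR)
  obtain L where L: "linear L" "\<forall>i\<in>I. L (pt i, 1::real) = c i *\<^sub>R (y i, 1::real)"
    "inj_on L (span ((\<lambda>i. (pt i, 1::real)) ` I))"
    by (rule linear_map_of_dependencies[OF finite_I dep])
  have yE: "y i \<in> eucl dimension" if "i \<in> I" for i
    using P' y(1) that hull_subset[of "y ` I" convex] by (auto simp: polytope_in_def)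
  \<comment> \<open>\<open>P'\<close> lies in the same space, so injectivity is enough.\<close>
  have "bij_betw L (span ((\<lambda>i. (pt i, 1::real)) ` I)) (span ((\<lambda>i. (pt i, 1::real)) ` I))"
  proof (rule linear_inj_on_span_imp_bij_betw[OF _ L(1,3)])
    show "L ` (\<lambda>i. (pt i, 1)) ` I \<subseteq> span ((\<lambda>i. (pt i, 1)) ` I)"
      unfolding span_pt using L(2) subspace_scale[OF subspace_eucl yE] by auto
  qed (use finite_I in simp)
  then have "projective_transformation L (eucl dimension) (eucl dimension)"
    unfolding span_pt projective_transformation_def homogenization_subspace[OF subspace_eucl] using L(1) by simp
  moreover have "proj_defined_on L polytope_hat"
    unfolding polytope_hat_def
    by (rule proj_app_convex_hull(1)[OF L(1) finite_I, of c pt y]) (use c(1) L(2) in auto)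
  moreover have "proj_app L ` F = \<phi> F" if F: "F face_of polytope_hat" for F
  proof -
    let ?S = "{i \<in> I. pt i \<in> F}"
    have "proj_app L ` (convex hull (pt ` ?S)) = convex hull (y ` ?S)"
      by (rule proj_app_convex_hull(2)[OF L(1), of ?S c pt y]) (use finite_I c(1) L(2) in auto)
    then show ?thesis using y(3)[OF F] y(4)[OF F] by simp
  qed
  ultimately show "\<exists>L. projective_transformation L (eucl dimension) (eucl dimension) \<and>
      proj_defined_on L polytope_hat \<and> (\<forall>F. F face_of polytope_hat \<longrightarrow> proj_app L ` F = \<phi> F)"
    by blast
qed

lemma base_face: "(\<lambda>x. x + unit_vector d) ` (convex hull V) face_of polytope_hat"
proof -
  have "convex hull (pt ` (Vtx ` B)) face_of polytope_hat"
    unfolding polytope_hat_def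
    by (rule face_of_if_facial[OF finite_I facial_singletons_imp_inj[OF finite_I facial_singleton]])
      (use facial_base[of "{}"] in auto)
  moreover have "pt ` (Vtx ` B) = (\<lambda>x. unit_vector d + x) ` V"
    by (simp add: B_def image_image add.commute[of _ "unit_vector d"])
  moreover have "(\<lambda>x. x + unit_vector d) = (\<lambda>x. unit_vector d + x)" by (simp add: fun_eq_iff add.commute)
  ultimately show ?thesis by (simp only: convex_hull_translation)
qed

end

theorem theorem1:
  fixes d :: nat and P :: "(nat \<Rightarrow>\<^sub>0 real) set"
  assumes "algebraic_polytope_in d P"
  shows "\<exists>(e :: nat) (Q :: (nat \<Rightarrow>\<^sub>0 real) set) (F :: (nat \<Rightarrow>\<^sub>0 real) set).
           polytope_in e Q \<and> projectively_unique_in e Q \<and>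
           F face_of Q \<and> projectively_equivalent P F"
proof -
  have P: "polytope P" "P \<subseteq> eucl d"
    and alg: "\<And>v i. v extreme_point_of P \<Longrightarrow> i < d \<Longrightarrow> algebraic (Poly_Mapping.lookup v i)"
    using assms by (auto simp: algebraic_polytope_in_def polytope_in_def)
  obtain W where W: "finite W" "P = convex hull W" using P(1) by (auto simp: polytope_def)
  define V where "V = {v. v extreme_point_of P}"
  have hullV: "P = convex hull V"
    using convex_hull_extreme_points[OF W(1)] W(2) by (simp add: V_def)
  have V: "finite V" "V \<subseteq> eucl d"
    using W extreme_points_of_convex_hull[of W] P(2)
    by (auto simp: V_def extreme_point_of_def intro: finite_subset)
  \<comment> \<open>An extreme point of a hull is one of the generators, so no vertex lies in the
    hull of the others.\<close>
  have Vv: "v \<notin> convex hull (V - {v})" if v: "v \<in> V" for v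
  proof
    assume "v \<in> convex hull (V - {v})"
    then have "convex hull (V - {v}) = P"
      using hullV v by (metis hull_redundant insert_Diff)
    then have "v extreme_point_of convex hull (V - {v})" using v by (simp add: V_def)
    then show False using extreme_point_of_convex_hull by blast
  qed
  let ?S = "(\<lambda>(v, i). Poly_Mapping.lookup v i) ` (V \<times> {..<d})"
  have "finite ?S" using V(1) by simp
  moreover have "algebraic a" if "a \<in> ?S" for a using that alg by (auto simp: V_def)
  ultimately obtain X where X: "finite X" "hom_rigid X" "uminus ` ?S \<subseteq> X"
    using algebraic_set_imp_hom_rigid[of ?S] by blast
  interpret universal_construction d V X
  proof
    show "- Poly_Mapping.lookup v k \<in> X" if "v \<in> V" "k < d" for v k
      using X(3) that by auto
  qed (use V Vv X in auto)
  have "projectively_equivalent P ((\<lambda>x. x + unit_vector d) ` P)"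
    by (rule projectively_equivalent_translation)
  then show ?thesis
    using polytope_in_hat projectively_unique_hat base_face hullV by blast
qed

end
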